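(* Let $n\ge2$. (1) Let $\mathfrak A$ be a Banach algebra, $X_1,\dots,X_n\in\mathfrak A$, let $\phi=X_1\mathbf 1_{[0,1)}\boldsymbol.\ldots\boldsymbol.X_n\mathbf 1_{[0,1)}$, and let $\lambda\in[0,1]$. Then $$\sum_{k=1}^\infty\left|\mu^{(\lambda)}_{k,\mathrm R}(\phi)\right|\le\Gamma^{(\lambda)}_{\mathrm{real}}(|X_1|,\dots,|X_n|)\le\overline\Gamma_{\mathrm{real}}(|X_1|,\dots,|X_n|)$$ (all terms being well-defined in $[0,+\infty]$), and these are finite if $|X_1|+\dots+|X_n|<\mathrm C_n$. (2) Consequently, if $|X_1|+\dots+|X_n|<\mathrm C_n$, then $\phi$ is $M$-controlled and the logarithmic version of the Baker–Campbell–Hausdorff formula holds: $\log\big((\exp X_1)\cdots(\exp X_n)\big)$ exists, and it equals $\sum_{k=1}^\infty\mu_{k,\mathrm R}(\phi)$, which is absolutely convergent. (3) On the other hand, there is a Banach algebra $\mathfrak A$ and $X_1,\dots,X_n\in\mathfrak A$ with $|X_1|+\dots+|X_n|=\mathrm C_n$ such that there is no element $X\in\mathfrak A$ with $\exp X=(\exp X_1)\cdots(\exp X_n)$.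
   Context: Banach algebras are unital, real or complex; for real ones, spectra and expressions with complex scalars are taken in the complexification with norm $|x|=\inf\{\sum_i|t_i|\,|x_i|: x=\sum_i t_ix_i,\ x_i\in\mathfrak A,\ t_i\in\mathbb C\}$. $\phi=X_1\mathbf 1_{[0,1)}\boldsymbol.\ldots\boldsymbol.X_n\mathbf 1_{[0,1)}$ is the concatenated measure on $[0,n)$ with density equal to $X_i$ on $[i-1,i)$ with respect to Lebesgue measure. For $\sigma\in\Sigma_k$, $\mathrm{asc}(\sigma)$, $\mathrm{des}(\sigma)$ are the numbers of $i$ with $\sigma(i)<\sigma(i+1)$, resp. $\sigma(i)>\sigma(i+1)$. $\mu_k^{(\lambda)}(Y_1,\dots,Y_k)=\sum_{\sigma\in\Sigma_k}\lambda^{\mathrm{asc}(\sigma)}(\lambda-1)^{\mathrm{des}(\sigma)}Y_{\sigma(1)}\cdots Y_{\sigma(k)}$ and $\mu_k(Y_1,\dots,Y_k)=\int_0^1\mu_k^{(\lambda)}(Y_1,\dots,Y_k)\,\mathrm d\lambda$; for a measure $\phi$ on $I$, $\mu^{(\lambda)}_{k,\mathrm R}(\phi)=\int_{t_1\le\dots\le t_k\in I}\mu^{(\lambda)}_k(\phi(t_1),\dots,\phi(t_k))$ and similarly for $\mu_{k,\mathrm R}(\phi)$. Here $\mu_{k,\mathrm R}(\phi)$ is the degree $k$ homogeneous part of the formal series $\mathrm{BCH}(X_1,\dots,X_n)=\log((\exp X_1)\cdots(\exp X_n))$. The time-ordered exponential is $\exp_{\mathrm R}(\phi)=1+\sum_{k\ge1}\int_{t_1\le\dots\le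 t_k\in I}\phi(t_1)\cdots\phi(t_k)$ (here equal to $(\exp X_1)\cdots(\exp X_n)$). $\log A$ exists iff the spectrum of $A$ is disjoint from $(-\infty,0]$, and then $\log A=\int_0^1 (A-1)(\lambda+(1-\lambda)A)^{-1}\,\mathrm d\lambda$. $\phi$ is $M$-controlled if $\log\exp_{\mathrm R}(t\cdot\phi)$ exists for every complex $t$ with $|t|\le1$. For formal noncommuting variables $X_1,\dots,X_n$ and $A=(\exp X_1)\cdots(\exp X_n)$: $\Gamma^{(\lambda)}(X_1,\dots,X_n)$ is the formal noncommutative power series $\mathcal R^{(\lambda)}(A)=(A-1)(\lambda+(1-\lambda)A)^{-1}$ with the coefficient of each monomial replaced by its absolute value; $\Gamma(X_1,\dots,X_n)$ is $\log A$ with each coefficient replaced by its absolute value. For $x_i\in[0,+\infty]$, $\Gamma^{(\lambda)}_{\mathrm{real}}(x_1,\dots,x_n)\in[0,+\infty]$ and $\Gamma_{\mathrm{real}}(x_1,\dots,x_n)\in[0,+\infty]$ are the values of these series with $x_i$ substituted for $X_i$, and $\overline\Gamma_{\mathrm{real}}(x_1,\dots,x_n)=\sup_{\lambda\in[0,1]}\Gamma^{(\lambda)}_{\mathrm{real}}(x_1,\dots,x_n)$. For $n\ge2$, $\mathrm C_n=\min\{x_1+\dots+x_n: x_1,\dots,x_n\in[0,+\infty),\ \Gamma_{\mathrm{real}}(x_1,\dots,x_n)=+\infty\}$. *)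

theory Defs
  imports "HOL-Analysis.Analysis" "HOL-Combinatorics.Permutations" "HOL-Algebra.Ring"
begin

text \<open>
  Real Banach algebras (unital, with \<open>norm 1 = 1\<close>) are the types of sort
  \<open>{real_normed_algebra_1, banach}\<close>.  The library has no class for complex ones.
\<close>

class scaleC =
  fixes scaleC :: "complex \<Rightarrow> 'a \<Rightarrow> 'a" (infixr \<open>*\<^sub>C\<close> 75)

class complex_banach_algebra = real_normed_algebra_1 + banach + scaleC +
  assumes scaleC_of_real: "complex_of_real r *\<^sub>C x = r *\<^sub>R x"
    and scaleC_add_right: "c *\<^sub>C (x + y) = c *\<^sub>C x + c *\<^sub>C y"
    and scaleC_add_left: "(c + d) *\<^sub>C x = c *\<^sub>C x + d *\<^sub>C x"
    and scaleC_scaleC: "c *\<^sub>C (d *\<^sub>C x) = (c * d) *\<^sub>C x"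
    and scaleC_mult_left: "(c *\<^sub>C x) * y = c *\<^sub>C (x * y)"
    and scaleC_mult_right: "x * (c *\<^sub>C y) = c *\<^sub>C (x * y)"
    and norm_scaleC: "norm (c *\<^sub>C x) = cmod c * norm x"


section \<open>The complexification of a real Banach algebra\<close>

text \<open>\<open>Cplx a b\<close> stands for $a + \mathrm{i} b$.\<close>

datatype 'a cplx = Cplx (re: 'a) (im: 'a)

definition complexify :: "'a::zero \<Rightarrow> 'a cplx"
  where "complexify a = Cplx a 0"

lemma cplx_eq_iff: "x = y \<longleftrightarrow> re x = re y \<and> im x = im y"
  by (cases x; cases y) simp

instantiation cplx :: (real_algebra_1) real_algebra_1
begin

definition "0 = Cplx 0 0"
definition "1 = Cplx 1 0"
definition "x + y = Cplx (re x + re y) (im x + im y)"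
definition "x - y = Cplx (re x - re y) (im x - im y)"
definition "- x = Cplx (- re x) (- im x)"
definition "x * y = Cplx (re x * re y - im x * im y) (re x * im y + im x * re y)"
definition "r *\<^sub>R x = Cplx (r *\<^sub>R re x) (r *\<^sub>R im x)"

instance
  by standard
    (simp_all add: cplx_eq_iff zero_cplx_def one_cplx_def plus_cplx_def minus_cplx_def
      uminus_cplx_def times_cplx_def scaleR_cplx_def algebra_simps)

end

lemma re_im_cplx [simp]:
  "re 0 = 0" "im 0 = 0" "re 1 = 1" "im 1 = 0"
  "re (x + y) = re x + re y" "im (x + y) = im x + im y"
  "re (x - y) = re x - re y" "im (x - y) = im x - im y"
  "re (- x) = - re x" "im (- x) = - im x"
  "re (x * y) = re x * re y - im x * im y" "im (x * y) = re x * im y + im x * re y"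
  "re (r *\<^sub>R x) = r *\<^sub>R re x" "im (r *\<^sub>R x) = r *\<^sub>R im x"
  by (simp_all add: zero_cplx_def one_cplx_def plus_cplx_def minus_cplx_def
      uminus_cplx_def times_cplx_def scaleR_cplx_def)

instantiation cplx :: (real_algebra_1) scaleC
begin

definition "c *\<^sub>C x = Cplx (Re c *\<^sub>R re x - Im c *\<^sub>R im x) (Re c *\<^sub>R im x + Im c *\<^sub>R re x)"

instance ..

end

lemma re_im_scaleC [simp]:
  "re (c *\<^sub>C x) = Re c *\<^sub>R re x - Im c *\<^sub>R im x"
  "im (c *\<^sub>C x) = Re c *\<^sub>R im x + Im c *\<^sub>R re x"
  by (simp_all add: scaleC_cplx_def)

text \<open>
  The norm is $|x| = \inf\{\sum_i |t_i|\,|x_i| : x = \sum_i t_i x_i\}$; the list \<open>ps\<close>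
  consists of the pairs $(t_i, x_i)$.
\<close>

definition comb :: "(complex \<times> 'a::real_algebra_1) list \<Rightarrow> 'a cplx"
  where "comb ps = (\<Sum>(t, a)\<leftarrow>ps. t *\<^sub>C complexify a)"

definition comb_cost :: "(complex \<times> 'a::real_normed_vector) list \<Rightarrow> real"
  where "comb_cost ps = (\<Sum>(t, a)\<leftarrow>ps. cmod t * norm a)"

definition cplx_norm :: "'a::real_normed_algebra_1 cplx \<Rightarrow> real"
  where "cplx_norm x = Inf {comb_cost ps | ps. comb ps = x}"

lemma comb_simps [simp]:
  "comb [] = 0"
  "comb (p # ps) = fst p *\<^sub>C complexify (snd p) + comb ps"
  "comb (ps @ qs) = comb ps + comb qs"
  by (simp_all add: comb_def case_prod_unfold)

lemma comb_cost_simps [simp]: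
  "comb_cost [] = 0"
  "comb_cost (p # ps) = cmod (fst p) * norm (snd p) + comb_cost ps"
  "comb_cost (ps @ qs) = comb_cost ps + comb_cost qs"
  by (simp_all add: comb_cost_def case_prod_unfold)

lemma re_im_complexify [simp]: "re (complexify a) = a" "im (complexify a) = 0"
  by (simp_all add: complexify_def)

lemma comb_cost_nonneg: "0 \<le> comb_cost ps"
  by (induction ps) simp_all

lemma comb_split: "comb [(1, re x), (\<i>, im x)] = x"
  by (simp add: cplx_eq_iff)

lemma norm_cplx_le: "cplx_norm (comb ps) \<le> comb_cost ps"
  unfolding cplx_norm_def
  by (rule cInf_lower) (auto intro!: bdd_belowI[of _ 0] simp: comb_cost_nonneg)

lemma norm_cplx_greatest: "(\<And>ps. comb ps = x \<Longrightarrow> c \<le> comb_cost ps) \<Longrightarrow> c \<le> cplx_norm x"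
  for x :: "'a::real_normed_algebra_1 cplx"
  unfolding cplx_norm_def using comb_split[of x] by (intro cInf_greatest) blast+

lemma norm_cplx_approx:
  fixes x :: "'a::real_normed_algebra_1 cplx"
  assumes "cplx_norm x < c"
  obtains ps where "comb ps = x" "comb_cost ps < c"
  using norm_cplx_greatest[of x c] assms by fastforce

lemma norm_re_im_comb: "norm (re (comb ps)) \<le> comb_cost ps \<and> norm (im (comb ps)) \<le> comb_cost ps"
proof (induction ps)
  case (Cons p ps)
  have 1: "\<bar>Re (fst p)\<bar> * norm (snd p) \<le> cmod (fst p) * norm (snd p)"
    "\<bar>Im (fst p)\<bar> * norm (snd p) \<le> cmod (fst p) * norm (snd p)"
    by (simp_all add: abs_Re_le_cmod abs_Im_le_cmod mult_right_mono)
  show ?case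
    using Cons 1 by (auto intro!: order_trans[OF norm_triangle_ineq] add_mono)
qed simp

lemma norm_re_le: "norm (re x) \<le> cplx_norm x" and norm_im_le: "norm (im x) \<le> cplx_norm x"
  for x :: "'a::real_normed_algebra_1 cplx"
  using norm_re_im_comb by (auto intro!: norm_cplx_greatest)

lemma norm_cplx_le_re_im: "cplx_norm (x :: 'a::real_normed_algebra_1 cplx) \<le> norm (re x) + norm (im x)"
  using norm_cplx_le[of "[(1, re x), (\<i>, im x)]"] by (simp only: comb_split) simp

lemma norm_complexify: "cplx_norm (complexify a) = norm a" for a :: "'a::real_normed_algebra_1"
  using norm_re_le[of "complexify a"] norm_cplx_le_re_im[of "complexify a"] by simp

lemma norm_cplx_triangle: "cplx_norm (x + y) \<le> cplx_norm x + cplx_norm y" for x y :: "'a::real_normed_algebra_1 cplx"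
proof (rule field_le_epsilon)
  fix e :: real assume "0 < e"
  then have *: "cplx_norm x < cplx_norm x + e/2" "cplx_norm y < cplx_norm y + e/2" by simp_all
  obtain ps where ps: "comb ps = x" "comb_cost ps < cplx_norm x + e/2"
    using norm_cplx_approx[OF *(1)] .
  obtain qs where qs: "comb qs = y" "comb_cost qs < cplx_norm y + e/2"
    using norm_cplx_approx[OF *(2)] .
  show "cplx_norm (x + y) \<le> cplx_norm x + cplx_norm y + e"
    using norm_cplx_le[of "ps @ qs"] ps qs by simp
qed

lemma norm_cplx_scaleC_le: "cplx_norm (c *\<^sub>C x) \<le> cmod c * cplx_norm x" for x :: "'a::real_normed_algebra_1 cplx"
proof (cases "c = 0")
  case True
  then have "c *\<^sub>C x = comb []" by (simp add: cplx_eq_iff)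
  then show ?thesis using norm_cplx_le[of "[]"] True by (metis comb_cost_simps(1) norm_zero mult_zero_left)
next
  case False
  have *: "comb (map (\<lambda>(t, a). (c * t, a)) ps) = c *\<^sub>C comb ps \<and>
      comb_cost (map (\<lambda>(t, a). (c * t, a)) ps) = cmod c * comb_cost ps" for ps :: "(complex \<times> 'a) list"
    by (induction ps) (auto simp: cplx_eq_iff algebra_simps norm_mult)
  have "cplx_norm (c *\<^sub>C x) / cmod c \<le> cplx_norm x"
  proof (rule norm_cplx_greatest)
    fix ps assume "comb ps = x"
    then have "cplx_norm (c *\<^sub>C x) \<le> cmod c * comb_cost ps"
      using norm_cplx_le[of "map (\<lambda>(t, a). (c * t, a)) ps"] * by metis
    then show "cplx_norm (c *\<^sub>C x) / cmod c \<le> comb_cost ps"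
      using False by (simp add: field_simps)
  qed
  then show ?thesis using False by (simp add: field_simps)
qed

lemma norm_cplx_scaleC: "cplx_norm (c *\<^sub>C x) = cmod c * cplx_norm x" for x :: "'a::real_normed_algebra_1 cplx"
proof (cases "c = 0")
  case True
  then show ?thesis
    using norm_cplx_scaleC_le[of c x] norm_cplx_greatest[of "c *\<^sub>C x" 0] comb_cost_nonneg by fastforce
next
  case False
  have "inverse c *\<^sub>C (c *\<^sub>C x) = (inverse c * c) *\<^sub>C x"
    by (simp add: cplx_eq_iff algebra_simps)
  then have "x = inverse c *\<^sub>C (c *\<^sub>C x)"
    using False by (simp add: cplx_eq_iff)
  then have "cplx_norm x \<le> cmod (inverse c) * cplx_norm (c *\<^sub>C x)"
    by (metis norm_cplx_scaleC_le)
  then have "cmod c * cplx_norm x \<le> cplx_norm (c *\<^sub>C x)"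
    using False by (simp add: norm_inverse norm_divide field_simps)
  then show ?thesis using norm_cplx_scaleC_le[of c x] by simp
qed

lemma norm_cplx_mult: "cplx_norm (x * y) \<le> cplx_norm x * cplx_norm y" for x y :: "'a::real_normed_algebra_1 cplx"
proof -
  have 1: "cplx_norm (comb ps * y) \<le> comb_cost ps * cplx_norm y" for ps :: "(complex \<times> 'a) list" and y
  proof (induction ps)
    case Nil
    then show ?case using norm_cplx_le[of "[]"] by simp
  next
    case (Cons p ps)
    have 2: "cplx_norm (complexify a * y) \<le> norm a * cplx_norm y" for a :: 'a
    proof (cases "a = 0")
      case True
      then have "complexify a * y = comb []" by (simp add: cplx_eq_iff)
      then show ?thesis using norm_cplx_le[of "[]"] True by (metis comb_cost_simps(1) norm_zero mult_zero_left)
    next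
      case False
      have *: "comb (map (\<lambda>(t, b). (t, a * b)) qs) = complexify a * comb qs \<and>
          comb_cost (map (\<lambda>(t, b). (t, a * b)) qs) \<le> norm a * comb_cost qs" for qs
      proof (induction qs)
        case (Cons q qs)
        have "cmod (fst q) * norm (a * snd q) \<le> cmod (fst q) * (norm a * norm (snd q))"
          by (intro mult_left_mono norm_mult_ineq) simp
        then show ?case using Cons
          by (auto simp: cplx_eq_iff algebra_simps split: prod.splits)
      qed (simp add: cplx_eq_iff)
      have "cplx_norm (complexify a * y) / norm a \<le> cplx_norm y"
      proof (rule norm_cplx_greatest)
        fix qs assume "comb qs = y"
        then have "cplx_norm (complexify a * y) \<le> norm a * comb_cost qs"
          using norm_cplx_le[of "map (\<lambda>(t, b). (t, a * b)) qs"] * by (metis order_trans)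
        then show "cplx_norm (complexify a * y) / norm a \<le> comb_cost qs"
          using False by (simp add: field_simps)
      qed
      then show ?thesis using False by (simp add: field_simps)
    qed
    have "comb (p # ps) * y = fst p *\<^sub>C (complexify (snd p) * y) + comb ps * y"
      by (simp add: cplx_eq_iff algebra_simps)
    then have "cplx_norm (comb (p # ps) * y) \<le> cplx_norm (fst p *\<^sub>C (complexify (snd p) * y)) + cplx_norm (comb ps * y)"
      by (simp add: norm_cplx_triangle)
    also have "\<dots> \<le> cmod (fst p) * (norm (snd p) * cplx_norm y) + comb_cost ps * cplx_norm y"
      using Cons 2[of "snd p"] by (intro add_mono) (simp_all add: norm_cplx_scaleC mult_left_mono)
    finally show ?case by (simp add: algebra_simps)
  qed
  show ?thesis
  proof (cases "cplx_norm y = 0")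
    case True
    obtain ps where "comb ps = x" using comb_split by blast
    then show ?thesis using 1[of ps y] True by simp
  next
    case False
    then have pos: "0 < cplx_norm y"
      using norm_cplx_greatest[of y 0] comb_cost_nonneg by fastforce
    have "cplx_norm (x * y) / cplx_norm y \<le> cplx_norm x"
    proof (rule norm_cplx_greatest)
      fix ps assume "comb ps = x"
      then show "cplx_norm (x * y) / cplx_norm y \<le> comb_cost ps"
        using 1[of ps y] pos by (simp add: field_simps)
    qed
    then show ?thesis using pos by (simp add: field_simps)
  qed
qed

lemma scaleC_of_real_cplx: "complex_of_real r *\<^sub>C x = r *\<^sub>R x" for x :: "'a::real_algebra_1 cplx"
  by (simp add: cplx_eq_iff)

instantiation cplx :: (real_normed_algebra_1) real_normed_algebra_1
begin

definition "norm (x :: 'a cplx) = cplx_norm x"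
definition sgn_cplx_def: "sgn (x :: 'a cplx) = x /\<^sub>R norm x"
definition dist_cplx_def: "dist (x :: 'a cplx) y = norm (x - y)"
definition uniformity_cplx_def:
  "(uniformity :: ('a cplx \<times> 'a cplx) filter) = (INF e\<in>{0 <..}. principal {(x, y). dist x y < e})"
definition open_cplx_def:
  "open (U :: 'a cplx set) \<longleftrightarrow> (\<forall>x\<in>U. eventually (\<lambda>(x', y). x' = x \<longrightarrow> y \<in> U) uniformity)"

instance
proof
  fix x y :: "'a cplx" and r :: real
  show "norm x = 0 \<longleftrightarrow> x = 0"
  proof
    show "norm x = 0 \<Longrightarrow> x = 0"
      using norm_re_le[of x] norm_im_le[of x] by (simp add: cplx_eq_iff norm_cplx_def)
    show "x = 0 \<Longrightarrow> norm x = 0"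
      using norm_cplx_scaleC[of 0 x] by (simp add: scaleC_cplx_def zero_cplx_def norm_cplx_def)
  qed
  show "norm (r *\<^sub>R x) = \<bar>r\<bar> * norm x"
    by (metis norm_cplx_def norm_cplx_scaleC norm_of_real scaleC_of_real_cplx real_norm_def)
  show "norm (1 :: 'a cplx) = 1"
    using norm_complexify[of "1::'a"] by (simp add: complexify_def one_cplx_def norm_cplx_def)
  show "norm (x + y) \<le> norm x + norm y" "norm (x * y) \<le> norm x * norm y"
    by (simp_all add: norm_cplx_def norm_cplx_triangle norm_cplx_mult)
qed (rule sgn_cplx_def dist_cplx_def uniformity_cplx_def open_cplx_def)+

end

instance cplx :: ("{real_normed_algebra_1, banach}") banach
proof
  fix X :: "nat \<Rightarrow> 'a cplx" assume X: "Cauchy X"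
  have c: "Cauchy (\<lambda>n. f (X n))" if "\<And>x y. dist (f x) (f y) \<le> dist x y" for f :: "'a cplx \<Rightarrow> 'a"
    using X that unfolding Cauchy_def by (meson order_le_less_trans)
  have "Cauchy (\<lambda>n. re (X n))"
    by (rule c) (metis dist_norm norm_re_le norm_cplx_def re_im_cplx(7))
  then obtain a where a: "(\<lambda>n. re (X n)) \<longlonglongrightarrow> a"
    using Cauchy_convergent convergent_def by blast
  have "Cauchy (\<lambda>n. im (X n))"
    by (rule c) (metis dist_norm norm_im_le norm_cplx_def re_im_cplx(8))
  then obtain b where b: "(\<lambda>n. im (X n)) \<longlonglongrightarrow> b"
    using Cauchy_convergent convergent_def by blast
  have "X \<longlonglongrightarrow> Cplx a b"
  proof (rule LIM_zero_cancel, rule Lim_null_comparison)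
    show "\<forall>\<^sub>F n in sequentially. norm (X n - Cplx a b) \<le> norm (re (X n) - a) + norm (im (X n) - b)"
      using norm_cplx_le_re_im[of "X _ - Cplx a b"] by (intro always_eventually allI) (simp add: norm_cplx_def)
    show "(\<lambda>n. norm (re (X n) - a) + norm (im (X n) - b)) \<longlonglongrightarrow> 0"
      using tendsto_add[OF tendsto_norm[OF LIM_zero[OF a]] tendsto_norm[OF LIM_zero[OF b]]] by simp
  qed
  then show "convergent X" by (auto simp: convergent_def)
qed

instance cplx :: ("{real_normed_algebra_1, banach}") complex_banach_algebra
  by standard (simp_all add: norm_cplx_def norm_cplx_scaleC, simp_all add: cplx_eq_iff algebra_simps)


section \<open>Inverses, spectra and logarithms\<close>

definition has_inverse :: "'a::monoid_mult \<Rightarrow> bool"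
  where "has_inverse a \<longleftrightarrow> (\<exists>b. a * b = 1 \<and> b * a = 1)"

definition alg_inverse :: "'a::monoid_mult \<Rightarrow> 'a"
  where "alg_inverse a = (THE b. a * b = 1 \<and> b * a = 1)"

lemma alg_inverse_eqI: "a * b = 1 \<Longrightarrow> b * a = 1 \<Longrightarrow> alg_inverse a = b"
  unfolding alg_inverse_def by (rule the_equality) (simp, metis mult.assoc mult_1_left mult_1_right)

text \<open>The function $\mathcal R^{(\lambda)}(a) = (a-1)(\lambda+(1-\lambda)a)^{-1}$.\<close>

definition resolvent_fn :: "real \<Rightarrow> 'a::real_algebra_1 \<Rightarrow> 'a"
  where "resolvent_fn l a = (a - 1) * alg_inverse (of_real l + (1 - l) *\<^sub>R a)"

definition alg_spectrum :: "'a::complex_banach_algebra \<Rightarrow> complex set"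
  where "alg_spectrum a = {z. \<not> has_inverse (z *\<^sub>C 1 - a)}"

definition log_exists :: "'a::complex_banach_algebra \<Rightarrow> bool"
  where "log_exists a \<longleftrightarrow> alg_spectrum a \<inter> complex_of_real ` {..0} = {}"

definition alg_log :: "'a::{real_normed_algebra_1, banach} \<Rightarrow> 'a"
  where "alg_log a = integral {0..1} (\<lambda>l. resolvent_fn l a)"


section \<open>Measures, time-ordered integrals and the Magnus expansion\<close>

text \<open>
  A measure on \<open>I\<close> is given by its density \<open>\<phi>\<close> with respect to Lebesgue measure.
  \<open>ordered_integral I k F\<close> is the integral of \<open>F [t\<^sub>1, \<dots>, t\<^sub>k]\<close> over
  $\{t_1 \le \dots \le t_k \in I\}$, computed as an iterated integral with $t_k$ outermost
  (the multidimensional integrals of the library do not allow the dimension to vary, and its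
  Bochner integral requires a separable target).  For densities as in \<open>concat_density\<close> all
  the integrals involved exist, see \<open>ordered_integral_integrable\<close> below.
\<close>

fun ordered_integral :: "real set \<Rightarrow> nat \<Rightarrow> (real list \<Rightarrow> 'a) \<Rightarrow> 'a::real_normed_vector"
  where
    "ordered_integral I 0 F = F []"
  | "ordered_integral I (Suc k) F =
       integral I (\<lambda>t. ordered_integral (I \<inter> {..t}) k (\<lambda>ts. F (ts @ [t])))"

definition concat_density :: "nat \<Rightarrow> (nat \<Rightarrow> 'a::real_vector) \<Rightarrow> real \<Rightarrow> 'a"
  where "concat_density n X t = (\<Sum>i = 1..n. indicat_real {real i - 1..<real i} t *\<^sub>R X i)"

definition asc :: "nat \<Rightarrow> (nat \<Rightarrow> nat) \<Rightarrow> nat"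
  where "asc k \<sigma> = card {i. Suc i < k \<and> \<sigma> i < \<sigma> (Suc i)}"

definition des :: "nat \<Rightarrow> (nat \<Rightarrow> nat) \<Rightarrow> nat"
  where "des k \<sigma> = card {i. Suc i < k \<and> \<sigma> i > \<sigma> (Suc i)}"

text \<open>The list \<open>Ys\<close> of length $k$ is indexed from $0$, so permutations act on \<open>{..<k}\<close>.\<close>

definition mu_res :: "real \<Rightarrow> 'a::real_algebra_1 list \<Rightarrow> 'a"
  where "mu_res l Ys = (let k = length Ys in
    \<Sum>\<sigma> | \<sigma> permutes {..<k}.
      (l ^ asc k \<sigma> * (l - 1) ^ des k \<sigma>) *\<^sub>R prod_list (map (\<lambda>i. Ys ! \<sigma> i) [0..<k]))"

definition mu :: "'a::{real_normed_algebra_1, banach} list \<Rightarrow> 'a"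
  where "mu Ys = integral {0..1} (\<lambda>l. mu_res l Ys)"

definition mu_res_R :: "real \<Rightarrow> real set \<Rightarrow> (real \<Rightarrow> 'a) \<Rightarrow> nat \<Rightarrow> 'a::{real_normed_algebra_1, banach}"
  where "mu_res_R l I \<phi> k = ordered_integral I k (\<lambda>ts. mu_res l (map \<phi> ts))"

definition mu_R :: "real set \<Rightarrow> (real \<Rightarrow> 'a) \<Rightarrow> nat \<Rightarrow> 'a::{real_normed_algebra_1, banach}"
  where "mu_R I \<phi> k = ordered_integral I k (\<lambda>ts. mu (map \<phi> ts))"

definition exp_R :: "real set \<Rightarrow> (real \<Rightarrow> 'a) \<Rightarrow> 'a::{real_normed_algebra_1, banach}"
  where "exp_R I \<phi> = 1 + (\<Sum>k. ordered_integral I (Suc k) (\<lambda>ts. prod_list (map \<phi> ts)))"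

definition M_controlled :: "real set \<Rightarrow> (real \<Rightarrow> 'a::complex_banach_algebra) \<Rightarrow> bool"
  where "M_controlled I \<phi> \<longleftrightarrow> (\<forall>t. cmod t \<le> 1 \<longrightarrow> log_exists (exp_R I (\<lambda>s. t *\<^sub>C \<phi> s)))"

definition exp_prod :: "nat \<Rightarrow> (nat \<Rightarrow> 'a) \<Rightarrow> 'a::{real_normed_algebra_1, banach}"
  where "exp_prod n X = prod_list (map (\<lambda>i. exp (X i)) [1..<Suc n])"

lemma concat_density_eq:
  assumes "i \<in> {1..n}" "t \<in> {real i - 1..<real i}"
  shows "concat_density n X t = X i"
proof -
  have "indicat_real {real j - 1..<real j} t *\<^sub>R X j = (if j = i then X i else 0)" for j
    using assms(2) by (cases j i rule: linorder_cases) (auto simp: indicator_def)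
  then show ?thesis
    using assms(1) by (simp add: concat_density_def)
qed

lemma ordered_integral_integrable:
  fixes F :: "'b::real_vector list \<Rightarrow> 'a::banach" and X :: "nat \<Rightarrow> 'b" and n :: nat
  defines "I \<equiv> {0..<real n}" and "\<phi> \<equiv> concat_density n X"
  shows "(\<lambda>t. ordered_integral (I \<inter> {..t}) k (\<lambda>ts. F (map \<phi> (ts @ [t])))) integrable_on (I \<inter> {..s})"
proof -
  define g where "g k F t = ordered_integral (I \<inter> {..t}) k (\<lambda>ts. F (map \<phi> ts))"
    for k t and F :: "'b list \<Rightarrow> 'a"
  define h where "h k F t = g k (\<lambda>Ys. F (Ys @ [\<phi> t])) t" for k t and F :: "'b list \<Rightarrow> 'a"
  have h: "h k F integrable_on {0..real n}"
    if g: "\<And>F. continuous_on {0..real n} (g k F)" for k F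
  proof -
    have "h k F integrable_on {0..real m}" if "m \<le> n" for m
      using that
    proof (induction m)
      case (Suc m)
      have "g k (\<lambda>Ys. F (Ys @ [X (Suc m)])) integrable_on {real m..real (Suc m)}"
        using Suc.prems by (intro integrable_continuous_interval continuous_on_subset[OF g]) auto
      then have "h k F integrable_on {real m..real (Suc m)}"
      proof (rule integrable_spike_finite[rotated 2])
        fix t assume "t \<in> {real m..real (Suc m)} - {real (Suc m)}"
        then have "\<phi> t = X (Suc m)"
          unfolding \<phi>_def using Suc.prems by (intro concat_density_eq) auto
        then show "h k F t = g k (\<lambda>Ys. F (Ys @ [X (Suc m)])) t"
          by (simp add: h_def)
      qed simp
      moreover have "h k F integrable_on {0..real m}"
        using Suc by simp
      ultimately show ?case
        using Henstock_Kurzweil_Integration.integrable_combine[of 0 "real m" "real (Suc m)" "h k F"] by simp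
    qed (use integrable_on_refl[of _ "0::real"] in simp)
    then show ?thesis by blast
  qed
  have restrict: "f integrable_on (I \<inter> {..t}) \<and> integral (I \<inter> {..t}) f = integral {0..t} f"
    if "f integrable_on {0..real n}" "t \<le> real n" for f :: "real \<Rightarrow> 'a" and t
  proof -
    have 1: "f integrable_on {0..t}"
      using that(2) by (intro integrable_on_subinterval[OF that(1)]) auto
    have 2: "negligible {x \<in> {0..t} - I \<inter> {..t}. f x \<noteq> 0}"
      by (rule negligible_subset[of "{real n}"]) (use that(2) in \<open>auto simp: I_def\<close>)
    have 3: "negligible {x \<in> I \<inter> {..t} - {0..t}. f x \<noteq> 0}"
      by (rule negligible_subset[OF negligible_empty]) (auto simp: I_def)
    show ?thesis
      using integrable_spike_set[OF 1 2 3] integral_spike_set[OF 3 2] by simp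
  qed
  have g: "continuous_on {0..real n} (g k F)" for k F
  proof (induction k arbitrary: F)
    case 0
    then show ?case by (simp add: g_def)
  next
    case (Suc k)
    have eq: "g (Suc k) F t = integral {0..t} (h k F)" if "t \<in> {0..real n}" for t
    proof -
      have "g (Suc k) F t = integral (I \<inter> {..t}) (h k F)"
        unfolding g_def h_def ordered_integral.simps
        by (rule integral_cong) (auto simp: Int_assoc min_absorb2)
      then show ?thesis using restrict[OF h[OF Suc.IH]] that by auto
    qed
    show ?case
      by (rule continuous_on_eq[OF indefinite_integral_continuous_1[OF h[OF Suc.IH]]]) (simp add: eq)
  qed
  have "h k F integrable_on (I \<inter> {..min s (real n)})"
    using restrict[OF h[OF g]] by auto
  moreover have "I \<inter> {..min s (real n)} = I \<inter> {..s}"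
    by (auto simp: I_def)
  ultimately show ?thesis
    by (simp add: h_def[abs_def] g_def)
qed


section \<open>Formal noncommutative power series\<close>

text \<open>A series is identified with the family of its coefficients, indexed by words.\<close>

typedef 'x ncps = "UNIV :: ('x list \<Rightarrow> real) set"
  morphisms ncps_nth Abs_ncps ..

setup_lifting type_definition_ncps

instantiation ncps :: (type) real_algebra_1
begin

lift_definition zero_ncps :: "'a ncps" is "\<lambda>_. 0" .
lift_definition one_ncps :: "'a ncps" is "\<lambda>w. if w = [] then 1 else 0" .
lift_definition plus_ncps :: "'a ncps \<Rightarrow> 'a ncps \<Rightarrow> 'a ncps" is "\<lambda>f g w. f w + g w" .
lift_definition minus_ncps :: "'a ncps \<Rightarrow> 'a ncps \<Rightarrow> 'a ncps" is "\<lambda>f g w. f w - g w" .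
lift_definition uminus_ncps :: "'a ncps \<Rightarrow> 'a ncps" is "\<lambda>f w. - f w" .
lift_definition scaleR_ncps :: "real \<Rightarrow> 'a ncps \<Rightarrow> 'a ncps" is "\<lambda>r f w. r * f w" .
lift_definition times_ncps :: "'a ncps \<Rightarrow> 'a ncps \<Rightarrow> 'a ncps"
  is "\<lambda>f g w. \<Sum>i\<le>length w. f (take i w) * g (drop i w)" .

instance
proof
  fix a b c :: "'a ncps" and r s :: real
  show "a * b * c = a * (b * c)"
  proof (transfer, rule ext)
    fix f g h :: "'a list \<Rightarrow> real" and w :: "'a list"
    let ?n = "length w"
    have "(\<Sum>j\<le>?n. (\<Sum>i\<le>length (take j w). f (take i (take j w)) * g (drop i (take j w))) * h (drop j w)) =
        (\<Sum>(j, i)\<in>(SIGMA j:{..?n}. {..j}). f (take i w) * g (drop i (take j w)) * h (drop j w))"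
      by (simp add: sum_distrib_right sum.Sigma min_absorb1 min_absorb2)
    also have "\<dots> = (\<Sum>(i, k)\<in>(SIGMA i:{..?n}. {..?n - i}).
        f (take i w) * g (take k (drop i w)) * h (drop (i + k) w))"
      by (rule sum.reindex_bij_witness[of _ "\<lambda>(i, k). (i + k, i)" "\<lambda>(j, i). (i, j - i)"])
        (auto simp: drop_take)
    also have "\<dots> = (\<Sum>i\<le>?n. f (take i w) *
        (\<Sum>k\<le>length (drop i w). g (take k (drop i w)) * h (drop k (drop i w))))"
      by (simp add: sum_distrib_left sum.Sigma mult.assoc add.commute)
    finally show "(\<Sum>j\<le>?n. (\<Sum>i\<le>length (take j w). f (take i (take j w)) * g (drop i (take j w))) * h (drop j w)) =
        (\<Sum>i\<le>?n. f (take i w) * (\<Sum>k\<le>length (drop i w). g (take k (drop i w)) * h (drop k (drop i w))))" .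
  qed
  show "1 * a = a"
  proof (transfer, rule ext)
    fix f :: "'a list \<Rightarrow> real" and w
    have "(\<Sum>i\<le>length w. (if take i w = [] then 1 else 0) * f (drop i w)) = (\<Sum>i\<in>{0}. f (drop i w))"
      by (rule sum.mono_neutral_cong_right) auto
    then show "(\<Sum>i\<le>length w. (if take i w = [] then 1 else 0) * f (drop i w)) = f w" by simp
  qed
  show "a * 1 = a"
  proof (transfer, rule ext)
    fix f :: "'a list \<Rightarrow> real" and w
    have "(\<Sum>i\<le>length w. f (take i w) * (if drop i w = [] then 1 else 0)) = (\<Sum>i\<in>{length w}. f (take i w))"
      by (rule sum.mono_neutral_cong_right) auto
    then show "(\<Sum>i\<le>length w. f (take i w) * (if drop i w = [] then 1 else 0)) = f w" by simp
  qed
  show "(0 :: 'a ncps) \<noteq> 1"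
    by transfer (metis zero_neq_one)
qed (transfer, force simp: algebra_simps sum.distrib sum_distrib_left)+

end

lift_definition ncps_var :: "'x \<Rightarrow> 'x ncps" is "\<lambda>x w. if w = [x] then 1 else 0" .

text \<open>
  For series $f$ without constant term, $f^k$ has no terms of degree less than $k$; hence the
  coefficient of a word \<open>w\<close> in $\exp f$ and $\log(1+f)$ only involves $k \le$ \<open>length w\<close>.
\<close>

definition ncps_exp :: "'x ncps \<Rightarrow> 'x ncps"
  where "ncps_exp f = Abs_ncps (\<lambda>w. \<Sum>k\<le>length w. ncps_nth (f ^ k) w / fact k)"

definition ncps_log :: "'x ncps \<Rightarrow> 'x ncps"
  where "ncps_log a = Abs_ncps (\<lambda>w. \<Sum>k = 1..length w. (- 1) ^ (k + 1) / real k * ncps_nth ((a - 1) ^ k) w)"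

definition ncps_exp_prod :: "nat \<Rightarrow> nat ncps"
  where "ncps_exp_prod n = prod_list (map (\<lambda>i. ncps_exp (ncps_var i)) [1..<Suc n])"

text \<open>The value at \<open>x\<close> of \<open>f\<close> with its coefficients replaced by their absolute values.\<close>

definition abs_value :: "nat \<Rightarrow> nat ncps \<Rightarrow> (nat \<Rightarrow> ennreal) \<Rightarrow> ennreal"
  where "abs_value n f x = (\<Sum>\<^sub>\<infinity>w\<in>lists {1..n}. ennreal \<bar>ncps_nth f w\<bar> * prod_list (map x w))"

definition Gamma_res :: "real \<Rightarrow> nat \<Rightarrow> (nat \<Rightarrow> ennreal) \<Rightarrow> ennreal"
  where "Gamma_res l n x = abs_value n (resolvent_fn l (ncps_exp_prod n)) x"

definition Gamma_log :: "nat \<Rightarrow> (nat \<Rightarrow> ennreal) \<Rightarrow> ennreal"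
  where "Gamma_log n x = abs_value n (ncps_log (ncps_exp_prod n)) x"

definition Gamma_sup :: "nat \<Rightarrow> (nat \<Rightarrow> ennreal) \<Rightarrow> ennreal"
  where "Gamma_sup n x = (SUP l\<in>{0..1}. Gamma_res l n x)"

text \<open>\<open>LEAST\<close> denotes the minimum of the set (not merely its infimum).\<close>

definition C_const :: "nat \<Rightarrow> real"
  where "C_const n = (LEAST c. \<exists>x :: nat \<Rightarrow> real. (\<forall>i\<in>{1..n}. 0 \<le> x i) \<and>
    Gamma_log n (\<lambda>i. ennreal (x i)) = \<infinity> \<and> c = (\<Sum>i = 1..n. x i))"


section \<open>Banach algebras as structures\<close>

text \<open>
  Existence of a Banach algebra cannot be expressed by quantifying over types, so for this purpose
  (real) Banach algebras are also described as structures with an explicit carrier.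
\<close>

record 'a normed_ring = "'a ring" +
  scal :: "real \<Rightarrow> 'a \<Rightarrow> 'a"
  nrm :: "'a \<Rightarrow> real"

definition struct_lim :: "('a, 'm) normed_ring_scheme \<Rightarrow> (nat \<Rightarrow> 'a) \<Rightarrow> 'a \<Rightarrow> bool"
  where "struct_lim A f y \<longleftrightarrow> y \<in> carrier A \<and> (\<lambda>n. nrm A (f n \<ominus>\<^bsub>A\<^esub> y)) \<longlonglongrightarrow> 0"

locale banach_algebra = ring A for A :: "('a, 'm) normed_ring_scheme" (structure) +
  assumes scal_closed: "x \<in> carrier A \<Longrightarrow> scal A r x \<in> carrier A"
    and scal_add_right: "\<lbrakk>x \<in> carrier A; y \<in> carrier A\<rbrakk> \<Longrightarrow> scal A r (x \<oplus> y) = scal A r x \<oplus> scal A r y"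
    and scal_add_left: "x \<in> carrier A \<Longrightarrow> scal A (r + s) x = scal A r x \<oplus> scal A s x"
    and scal_scal: "x \<in> carrier A \<Longrightarrow> scal A r (scal A s x) = scal A (r * s) x"
    and scal_one: "x \<in> carrier A \<Longrightarrow> scal A 1 x = x"
    and scal_mult_left: "\<lbrakk>x \<in> carrier A; y \<in> carrier A\<rbrakk> \<Longrightarrow> scal A r x \<otimes> y = scal A r (x \<otimes> y)"
    and scal_mult_right: "\<lbrakk>x \<in> carrier A; y \<in> carrier A\<rbrakk> \<Longrightarrow> x \<otimes> scal A r y = scal A r (x \<otimes> y)"
    and nrm_eq_0_iff: "x \<in> carrier A \<Longrightarrow> nrm A x = 0 \<longleftrightarrow> x = \<zero>"
    and nrm_triangle: "\<lbrakk>x \<in> carrier A; y \<in> carrier A\<rbrakk> \<Longrightarrow> nrm A (x \<oplus> y) \<le> nrm A x + nrm A y"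
    and nrm_scal: "x \<in> carrier A \<Longrightarrow> nrm A (scal A r x) = \<bar>r\<bar> * nrm A x"
    and nrm_mult: "\<lbrakk>x \<in> carrier A; y \<in> carrier A\<rbrakk> \<Longrightarrow> nrm A (x \<otimes> y) \<le> nrm A x * nrm A y"
    and nrm_one: "nrm A \<one> = 1"
    and complete: "\<lbrakk>\<And>n::nat. f n \<in> carrier A;
      \<And>e. 0 < e \<Longrightarrow> \<exists>N. \<forall>m\<ge>N. \<forall>n\<ge>N. nrm A (f m \<ominus> f n) < e\<rbrakk> \<Longrightarrow> \<exists>y. struct_lim A f y"

definition struct_exp :: "('a, 'm) normed_ring_scheme \<Rightarrow> 'a \<Rightarrow> 'a"
  where "struct_exp A x =
    (THE y. struct_lim A (\<lambda>N. \<Oplus>\<^bsub>A\<^esub>k\<in>{..<N}. scal A (1 / fact k) (x [^]\<^bsub>A\<^esub> k)) y)"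

definition struct_exp_prod :: "('a, 'm) normed_ring_scheme \<Rightarrow> nat \<Rightarrow> (nat \<Rightarrow> 'a) \<Rightarrow> 'a"
  where "struct_exp_prod A n X =
    foldr (\<lambda>i y. struct_exp A (X i) \<otimes>\<^bsub>A\<^esub> y) [1..<Suc n] \<one>\<^bsub>A\<^esub>"

text \<open>Compatibility with the type class: \<open>type_struct\<close> is the structure carried by a type.\<close>

definition type_struct :: "'a::real_normed_algebra_1 normed_ring"
  where "type_struct = \<lparr>carrier = UNIV, mult = (*), one = 1, zero = 0, add = (+), scal = scaleR, nrm = norm\<rparr>"

lemma ring_type_struct: "ring type_struct"
  by unfold_locales
    (auto simp: type_struct_def algebra_simps Units_def intro: exI[of _ "- _"] left_minus right_minus)

lemma type_struct_minus: "x \<ominus>\<^bsub>type_struct\<^esub> y = x - y"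
proof -
  interpret ring type_struct by (rule ring_type_struct)
  have "\<ominus>\<^bsub>type_struct\<^esub> y = - y"
    using minus_equality[of "- y" y] by (simp add: type_struct_def)
  then show ?thesis by (simp add: a_minus_def) (simp add: type_struct_def)
qed

lemma struct_lim_type_struct: "struct_lim type_struct f y \<longleftrightarrow> f \<longlonglongrightarrow> y"
  unfolding struct_lim_def type_struct_minus
  by (simp add: type_struct_def tendsto_norm_zero_iff LIM_zero_iff)

lemma banach_algebra_type_struct: "banach_algebra (type_struct :: 'a::{real_normed_algebra_1, banach} normed_ring)"
proof -
  interpret ring type_struct by (rule ring_type_struct)
  show ?thesis
  proof unfold_locales
    fix f :: "nat \<Rightarrow> 'a"
    assume "\<And>e. 0 < e \<Longrightarrow> \<exists>N. \<forall>m\<ge>N. \<forall>n\<ge>N. nrm type_struct (f m \<ominus>\<^bsub>type_struct\<^esub> f n) < e"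
    then have "Cauchy f"
      unfolding Cauchy_def dist_norm type_struct_minus by (simp add: type_struct_def)
    then show "\<exists>y. struct_lim type_struct f y"
      using Cauchy_convergent convergent_def struct_lim_type_struct by blast
  qed (auto simp: type_struct_def algebra_simps norm_triangle_ineq norm_mult_ineq)
qed

lemma struct_exp_type_struct: "struct_exp type_struct x = exp x"
  for x :: "'a::{real_normed_algebra_1, banach}"
proof -
  interpret ring "type_struct :: 'a normed_ring" by (rule ring_type_struct)
  have pow: "x [^]\<^bsub>type_struct\<^esub> k = x ^ k" for k :: nat
    by (induction k) (simp_all add: type_struct_def power_commutes)
  have sum: "(\<Oplus>\<^bsub>type_struct\<^esub>k\<in>{..<N}. f k) = (\<Sum>k<N. f k)" for f :: "nat \<Rightarrow> 'a" and N
  proof (induction N)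
    case (Suc N)
    have "carrier (type_struct :: 'a normed_ring) = UNIV" "\<And>x y :: 'a. x \<oplus>\<^bsub>type_struct\<^esub> y = x + y"
      by (simp_all add: type_struct_def)
    with Suc show ?case by (simp add: lessThan_Suc finsum_insert)
  qed (simp_all add: type_struct_def finsum_empty[unfolded type_struct_def])
  have "(\<lambda>N. \<Sum>k<N. scal type_struct (1 / fact k) (x ^ k)) \<longlonglongrightarrow> exp x"
    using summable_LIMSEQ[OF summable_exp_generic[of x]]
    by (simp add: exp_def type_struct_def inverse_eq_divide)
  then show ?thesis
    unfolding struct_exp_def struct_lim_type_struct pow sum
    using LIMSEQ_unique by blast
qed

lemma struct_exp_prod_type_struct: "struct_exp_prod type_struct n X = exp_prod n X"
  for X :: "nat \<Rightarrow> 'a::{real_normed_algebra_1, banach}"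
proof -
  have "foldr (\<lambda>i. (\<otimes>\<^bsub>type_struct\<^esub>) (exp (X i))) is \<one>\<^bsub>type_struct\<^esub> = prod_list (map (\<lambda>i. exp (X i)) is)" for "is"
    by (induction "is") (simp_all add: type_struct_def)
  then show ?thesis
    unfolding struct_exp_prod_def exp_prod_def struct_exp_type_struct .
qed

end

theory Submission
  imports Defs "HOL-Computational_Algebra.Formal_Power_Series" "HOL-Combinatorics.Multiset_Permutations"
begin

text \<open>
  The ordered integral of \<open>mu_res l\<close> is the degree \<open>k\<close> part of the resolvent of
  $\exp X_1\cdots\exp X_n$: in a permutation with weight $\lambda^{\mathrm{asc}}(\lambda-1)^{\mathrm{des}}$ one splits
  off an increasing suffix, which reproduces the recursion $R(\lambda+(1-\lambda)A)=A-1$.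
  Convergence of $\Gamma^{(\lambda)}$ at $x$ means that $\lambda+(1-\lambda)A$, with $X_i$ replaced by $x_i$ times
  a generator, is invertible in the algebra of absolutely summable noncommutative series. Hence the
  pairs $(\lambda,x)$ where it diverges form a closed set, and there is such a pair with minimal
  $x_1+\dots+x_n$, which may be chosen with two nonzero coordinates. At this pair the series of the
  logarithm also diverges: let $j$ be the first letter with $x_j>0$, and let $\lambda_0$ be the singular
  parameter. The words composed of $2k$ blocks $j^m v$, $v$ a word in larger letters, have coefficients
  $\int_0^1\prod(\dots)\,\mathrm d\lambda$, and fixing the signs at $\lambda_0$ bounds their total from below by
  an integral of order $1/k$. So the minimum is $\mathrm C_n$, and the algebra above, where the only possible
  logarithm is the formal one, has no logarithm of $A$ at the minimal point.
\<close>

section \<open>Substitution into univariate power series\<close>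

text \<open>The obstacle: \<open>Gamma_log\<close> integrates signed coefficients over \<lambda>
  before absolute values are taken, so divergence of \<open>Gamma_res\<close> at one \<lambda> does
  not by itself make \<open>Gamma_log\<close> infinite; cancellation must be excluded. Two facts do
  this. The coefficient of a word factorises wherever the letter changes, with weight \<lambda> at
  an ascent and \<lambda> - 1 at a descent. And, for regular factors,
  \<open>res_denom l (a * b)\<close> can be singular only if \<lambda>(1 - \<lambda>) times the
  norms of the two resolvents is at least 1. So A is cut into the exponential of the letter j and
  the product of the later ones. At a minimal pair with two positive coordinates both parts are
  regular for every \<lambda>, because their points have smaller sums; their resolvents are then
  Lipschitz in \<lambda>, and signs chosen at the singular parameter stay useful near it. An even
  number of blocks makes the integrand an even power, hence nonnegative, and a 2k-th power of a
  Lipschitz function close to 1 at one point stays above 1/2 on an interval of length of order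
  1/k.\<close>

lemma ncps_eqI: "(\<And>w. ncps_nth f w = ncps_nth g w) \<Longrightarrow> f = g"
  by (simp add: ncps_nth_inject[symmetric] fun_eq_iff)

lemma ncps_nth_simps [simp]:
  "ncps_nth 0 w = 0"
  "ncps_nth 1 w = (if w = [] then 1 else 0)"
  "ncps_nth (f + g) w = ncps_nth f w + ncps_nth g w"
  "ncps_nth (f - g) w = ncps_nth f w - ncps_nth g w"
  "ncps_nth (- f) w = - ncps_nth f w"
  "ncps_nth (r *\<^sub>R f) w = r * ncps_nth f w"
  "ncps_nth (Abs_ncps h) w = h w"
  by (simp_all add: zero_ncps.rep_eq one_ncps.rep_eq plus_ncps.rep_eq minus_ncps.rep_eq
      uminus_ncps.rep_eq scaleR_ncps.rep_eq Abs_ncps_inverse)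

lemma ncps_nth_mult: "ncps_nth (f * g) w = (\<Sum>i\<le>length w. ncps_nth f (take i w) * ncps_nth g (drop i w))"
  by (simp add: times_ncps.rep_eq)

lemma ncps_nth_mult_Nil [simp]: "ncps_nth (f * g) [] = ncps_nth f [] * ncps_nth g []"
  by (simp add: ncps_nth_mult)

lemma ncps_nth_power_eq_0:
  assumes "ncps_nth f [] = 0" "length w < k"
  shows "ncps_nth (f ^ k) w = 0"
  using assms(2)
proof (induction k arbitrary: w)
  case (Suc k)
  have "ncps_nth f (take i w) * ncps_nth (f ^ k) (drop i w) = 0" if "i \<le> length w" for i
    using Suc that assms(1) by (cases i) auto
  then show ?case by (auto simp: ncps_nth_mult intro!: sum.neutral)
qed simp

text \<open>\<open>ncps_exp\<close>, \<open>ncps_log\<close> and the resolvent are all of this form,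
  so their identities reduce to identities in the commutative ring \<open>real fps\<close>.
  Truncating at \<open>length w\<close> is exact when \<open>f\<close> has no constant term.\<close>

definition fps_subst :: "real fps \<Rightarrow> 'x ncps \<Rightarrow> 'x ncps"
  where "fps_subst p f = Abs_ncps (\<lambda>w. \<Sum>k\<le>length w. fps_nth p k * ncps_nth (f ^ k) w)"

text \<open>A common bound \<open>N\<close> lets all prefixes and suffixes of a word be expanded
  over the same index range, as the product rule requires.\<close>

lemma ncps_nth_fps_subst:
  assumes "ncps_nth f [] = 0" "length w \<le> N"
  shows "ncps_nth (fps_subst p f) w = (\<Sum>k\<le>N. fps_nth p k * ncps_nth (f ^ k) w)"
  unfolding fps_subst_def ncps_nth_simps
  by (rule sum.mono_neutral_left) (use assms in \<open>auto simp: ncps_nth_power_eq_0 not_le\<close>)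

lemma fps_subst_diff: "fps_subst (p - q) f = fps_subst p f - fps_subst q f"
  by (rule ncps_eqI) (simp add: fps_subst_def sum_subtractf algebra_simps)

lemma fps_subst_one [simp]: "fps_subst 1 f = 1"
proof (rule ncps_eqI)
  fix w
  have "ncps_nth (fps_subst 1 f) w = (\<Sum>k\<in>{0}. fps_nth 1 k * ncps_nth (f ^ k) w)"
    unfolding fps_subst_def ncps_nth_simps by (rule sum.mono_neutral_right) auto
  then show "ncps_nth (fps_subst 1 f) w = ncps_nth 1 w" by simp
qed

lemma fps_subst_X:
  assumes "ncps_nth f [] = 0"
  shows "fps_subst fps_X f = f"
proof (rule ncps_eqI)
  fix w
  have "ncps_nth (fps_subst fps_X f) w = (\<Sum>k\<le>Suc (length w). fps_nth fps_X k * ncps_nth (f ^ k) w)"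
    by (rule ncps_nth_fps_subst) (use assms in auto)
  also have "\<dots> = (\<Sum>k\<in>{1}. fps_nth fps_X k * ncps_nth (f ^ k) w)"
    by (rule sum.mono_neutral_right) auto
  finally show "ncps_nth (fps_subst fps_X f) w = ncps_nth f w" by simp
qed

lemma fps_subst_mult:
  assumes f: "ncps_nth f [] = 0"
  shows "fps_subst (p * q) f = fps_subst p f * fps_subst q f"
proof (rule ncps_eqI)
  fix w :: "'a list"
  let ?N = "length w"
  let ?g = "\<lambda>k l. fps_nth p k * fps_nth q l * ncps_nth (f ^ (k + l)) w"
  have zero: "?g k l = 0" if "\<not> k + l \<le> ?N" for k l
    using that by (simp add: ncps_nth_power_eq_0[OF f])
  have "ncps_nth (fps_subst p f * fps_subst q f) w = (\<Sum>i\<le>?N.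
      (\<Sum>k\<le>?N. fps_nth p k * ncps_nth (f ^ k) (take i w)) *
      (\<Sum>l\<le>?N. fps_nth q l * ncps_nth (f ^ l) (drop i w)))"
    by (simp add: ncps_nth_mult ncps_nth_fps_subst[OF f, where N = ?N])
  also have "\<dots> = (\<Sum>i\<le>?N. \<Sum>k\<le>?N. \<Sum>l\<le>?N. fps_nth p k * fps_nth q l *
      (ncps_nth (f ^ k) (take i w) * ncps_nth (f ^ l) (drop i w)))"
    by (simp add: sum_product algebra_simps)
  also have "\<dots> = (\<Sum>k\<le>?N. \<Sum>i\<le>?N. \<Sum>l\<le>?N. fps_nth p k * fps_nth q l *
      (ncps_nth (f ^ k) (take i w) * ncps_nth (f ^ l) (drop i w)))"
    by (rule sum.swap)
  also have "\<dots> = (\<Sum>k\<le>?N. \<Sum>l\<le>?N. \<Sum>i\<le>?N. fps_nth p k * fps_nth q l *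
      (ncps_nth (f ^ k) (take i w) * ncps_nth (f ^ l) (drop i w)))"
    by (rule sum.cong[OF refl], rule sum.swap)
  also have "\<dots> = (\<Sum>k\<le>?N. \<Sum>l\<le>?N. ?g k l)"
    by (simp add: power_add ncps_nth_mult sum_distrib_left)
  also have "\<dots> = (\<Sum>(k, l)\<in>{..?N} \<times> {..?N}. ?g k l)"
    by (simp add: sum.cartesian_product)
  \<comment> \<open>Powers beyond the length of \<open>w\<close> vanish, so the square shrinks to
    the triangle that carries the coefficients of \<open>p * q\<close>.\<close>
  also have "\<dots> = (\<Sum>(k, l)\<in>{(k, l). k + l \<le> ?N}. ?g k l)"
  proof (rule sum.mono_neutral_right)
    show "\<forall>z\<in>{..?N} \<times> {..?N} - {(k, l). k + l \<le> ?N}. (case z of (k, l) \<Rightarrow> ?g k l) = 0"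
    proof
      fix z assume "z \<in> {..?N} \<times> {..?N} - {(k, l). k + l \<le> ?N}"
      then obtain k l where "z = (k, l)" "\<not> k + l \<le> ?N" by auto
      then show "(case z of (k, l) \<Rightarrow> ?g k l) = 0" using zero[of k l] by simp
    qed
  qed auto
  also have "\<dots> = (\<Sum>m\<le>?N. \<Sum>k\<le>m. ?g k (m - k))"
    by (rule sum.triangle_reindex_eq)
  also have "\<dots> = (\<Sum>m\<le>?N. fps_nth (p * q) m * ncps_nth (f ^ m) w)"
    by (rule sum.cong) (auto simp: fps_mult_nth atLeast0AtMost sum_distrib_right)
  finally show "ncps_nth (fps_subst (p * q) f) w = ncps_nth (fps_subst p f * fps_subst q f) w"
    by (simp add: fps_subst_def)
qed

lemma fps_subst_power: "ncps_nth f [] = 0 \<Longrightarrow> fps_subst (p ^ k) f = fps_subst p f ^ k"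
  by (induction k) (auto simp: fps_subst_mult)

lemma fps_subst_scaleR: "fps_subst (fps_const c * p) f = c *\<^sub>R fps_subst p f"
  by (rule ncps_eqI) (simp add: fps_subst_def sum_distrib_left algebra_simps)

lemma fps_subst_compose:
  assumes f: "ncps_nth f [] = 0" and q: "fps_nth q 0 = 0"
  shows "fps_subst p (fps_subst q f) = fps_subst (p oo q) f"
proof (rule ncps_eqI)
  fix w :: "'a list"
  let ?N = "length w"
  have "ncps_nth (fps_subst p (fps_subst q f)) w = (\<Sum>k\<le>?N. fps_nth p k * ncps_nth (fps_subst (q ^ k) f) w)"
    by (simp add: fps_subst_def[of p] fps_subst_power f)
  also have "\<dots> = (\<Sum>k\<le>?N. \<Sum>j\<le>?N. fps_nth p k * fps_nth (q ^ k) j * ncps_nth (f ^ j) w)"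
    by (simp add: fps_subst_def sum_distrib_left mult.assoc)
  also have "\<dots> = (\<Sum>j\<le>?N. (\<Sum>k\<le>?N. fps_nth p k * fps_nth (q ^ k) j) * ncps_nth (f ^ j) w)"
    by (subst sum.swap) (simp add: sum_distrib_right)
  also have "\<dots> = (\<Sum>j\<le>?N. fps_nth (p oo q) j * ncps_nth (f ^ j) w)"
  proof (rule sum.cong[OF refl])
    fix j assume "j \<in> {..?N}"
    then have "(\<Sum>k\<le>?N. fps_nth p k * fps_nth (q ^ k) j) = (\<Sum>k = 0..j. fps_nth p k * fps_nth (q ^ k) j)"
      by (intro sum.mono_neutral_right) (auto simp: startsby_zero_power_prefix[OF q])
    then show "(\<Sum>k\<le>?N. fps_nth p k * fps_nth (q ^ k) j) * ncps_nth (f ^ j) w =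
        fps_nth (p oo q) j * ncps_nth (f ^ j) w"
      by (simp add: fps_compose_nth)
  qed
  finally show "ncps_nth (fps_subst p (fps_subst q f)) w = ncps_nth (fps_subst (p oo q) f) w"
    by (simp add: fps_subst_def)
qed

lemma ncps_exp_eq_subst: "ncps_exp f = fps_subst (fps_exp 1) f"
  by (simp add: ncps_exp_def fps_subst_def field_simps)

lemma ncps_log_eq_subst: "ncps_log a = fps_subst (fps_ln 1) (a - 1)"
proof (rule ncps_eqI)
  fix w
  have "(\<Sum>k\<le>length w. fps_nth (fps_ln 1) k * ncps_nth ((a - 1) ^ k) w) =
      (\<Sum>k = 1..length w. fps_nth (fps_ln 1) k * ncps_nth ((a - 1) ^ k) w)"
    by (rule sum.mono_neutral_right) (auto simp: fps_ln_nth not_le)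
  also have "\<dots> = (\<Sum>k = 1..length w. (- 1) ^ (k + 1) / real k * ncps_nth ((a - 1) ^ k) w)"
    by (rule sum.cong) (auto simp: fps_ln_nth power_eq_if)
  finally show "ncps_nth (ncps_log a) w = ncps_nth (fps_subst (fps_ln 1) (a - 1)) w"
    by (simp add: ncps_log_def fps_subst_def)
qed

text \<open>The univariate identity log(1 + (e^X - 1)) = X, transported by substitution. It later
  pins down every candidate for a logarithm.\<close>

lemma ncps_log_exp:
  assumes "ncps_nth f [] = 0"
  shows "ncps_log (ncps_exp f) = f"
proof -
  have "ncps_exp f - 1 = fps_subst (fps_exp 1 - 1) f"
    by (simp add: ncps_exp_eq_subst fps_subst_diff)
  then have "ncps_log (ncps_exp f) = fps_subst (fps_ln 1 oo (fps_exp 1 - 1)) f"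
    using fps_subst_compose[OF assms, of "fps_exp 1 - 1" "fps_ln 1"] by (simp add: ncps_log_eq_subst)
  also have "fps_ln 1 oo (fps_exp 1 - 1) = (fps_X :: real fps)"
    using fps_inv_fps_exp_compose(1)[of 1] by (simp add: fps_ln_fps_exp_inv)
  finally show ?thesis using assms by (simp add: fps_subst_X)
qed

section \<open>The formal resolvent and its integral\<close>

definition geometric_fps :: "real \<Rightarrow> real fps"
  where "geometric_fps c = Abs_fps (\<lambda>k. c ^ k)"

lemma geometric_fps: "(1 - fps_const c * fps_X) * geometric_fps c = 1"
proof (rule fps_ext)
  fix k
  have "(1 - fps_const c * fps_X) * geometric_fps c = geometric_fps c - fps_const c * (fps_X * geometric_fps c)"
    by (simp add: algebra_simps)
  then show "fps_nth ((1 - fps_const c * fps_X) * geometric_fps c) k = fps_nth 1 k"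
    by (cases k) (auto simp: geometric_fps_def)
qed

lemma of_real_ncps_nth [simp]: "ncps_nth (of_real c) w = (if w = [] then c else 0)"
  by (simp add: of_real_def)

context
  fixes a :: "'x ncps" and l :: real
  assumes a: "ncps_nth a [] = 1"
begin

text \<open>Since \<open>of_real l + (1 - l) *\<^sub>R a\<close> equals 1 - (l - 1)(a - 1), its
  inverse is the geometric series of ratio l - 1 in \<open>a - 1\<close>.\<close>

definition res_inv :: "'x ncps"
  where "res_inv = fps_subst (geometric_fps (l - 1)) (a - 1)"

lemma res_inv:
  "(of_real l + (1 - l) *\<^sub>R a) * res_inv = 1" "res_inv * (of_real l + (1 - l) *\<^sub>R a) = 1"
proof -
  have z: "ncps_nth (a - 1) [] = 0" using a by simp
  have d: "of_real l + (1 - l) *\<^sub>R a = fps_subst (1 - fps_const (l - 1) * fps_X) (a - 1)"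
    unfolding fps_subst_diff fps_subst_scaleR fps_subst_X[OF z] fps_subst_one
    by (simp add: of_real_def algebra_simps)
  show "(of_real l + (1 - l) *\<^sub>R a) * res_inv = 1" "res_inv * (of_real l + (1 - l) *\<^sub>R a) = 1"
    unfolding d res_inv_def using geometric_fps[of "l - 1"]
    by (simp_all add: fps_subst_mult[OF z, symmetric] mult.commute)
qed

lemma resolvent_fn_eq_res_inv: "resolvent_fn l a = (a - 1) * res_inv"
  unfolding resolvent_fn_def by (simp add: alg_inverse_eqI[OF res_inv])

lemma resolvent_fn_mult: "resolvent_fn l a * (of_real l + (1 - l) *\<^sub>R a) = a - 1"
  by (simp add: resolvent_fn_eq_res_inv mult.assoc res_inv)

lemma ncps_nth_resolvent_fn:
  "ncps_nth (resolvent_fn l a) w = (\<Sum>k = 1..length w. (l - 1) ^ (k - 1) * ncps_nth ((a - 1) ^ k) w)"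
proof -
  have z: "ncps_nth (a - 1) [] = 0" using a by simp
  have "resolvent_fn l a = fps_subst (fps_X * geometric_fps (l - 1)) (a - 1)"
    unfolding resolvent_fn_eq_res_inv res_inv_def fps_subst_mult[OF z] fps_subst_X[OF z] ..
  then have "ncps_nth (resolvent_fn l a) w =
      (\<Sum>k\<le>length w. fps_nth (fps_X * geometric_fps (l - 1)) k * ncps_nth ((a - 1) ^ k) w)"
    by (simp add: fps_subst_def)
  also have "\<dots> = (\<Sum>k = 1..length w. fps_nth (fps_X * geometric_fps (l - 1)) k * ncps_nth ((a - 1) ^ k) w)"
    by (rule sum.mono_neutral_right) (auto simp: not_le)
  finally show ?thesis by (simp add: geometric_fps_def)
qed

lemma ncps_nth_resolvent_fn_Nil [simp]: "ncps_nth (resolvent_fn l a) [] = 0"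
  by (simp add: ncps_nth_resolvent_fn)

text \<open>Comparison of coefficients in R(l + (1 - l)a) = a - 1. The term of R a with empty suffix
  joins l R, and the two weights add up to 1.\<close>

lemma ncps_nth_resolvent_fn_rec:
  assumes "w \<noteq> []"
  shows "ncps_nth (resolvent_fn l a) w = ncps_nth a w -
    (1 - l) * (\<Sum>i<length w. ncps_nth (resolvent_fn l a) (take i w) * ncps_nth a (drop i w))"
proof -
  let ?R = "resolvent_fn l a"
  have "?R * (of_real l + (1 - l) *\<^sub>R a) = l *\<^sub>R ?R + (1 - l) *\<^sub>R (?R * a)"
    by (simp add: of_real_def algebra_simps)
  then have "ncps_nth (a - 1) w = l * ncps_nth ?R w + (1 - l) * ncps_nth (?R * a) w"
    by (simp flip: resolvent_fn_mult)
  moreover have "ncps_nth (?R * a) w =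
      (\<Sum>i<length w. ncps_nth ?R (take i w) * ncps_nth a (drop i w)) + ncps_nth ?R w"
    by (simp add: ncps_nth_mult lessThan_Suc_atMost[symmetric] a)
  ultimately show ?thesis using assms by (simp add: algebra_simps)
qed

end

text \<open>For each word the resolvent coefficient is a polynomial in \<open>l\<close>, and the
  integral of \<open>(l - 1) ^ (k - 1)\<close> over [0, 1] is (-1)^(k+1)/k, the k-th coefficient of
  the logarithm.\<close>

lemma ncps_log_has_integral:
  assumes a: "ncps_nth a [] = 1"
  shows "((\<lambda>l. ncps_nth (resolvent_fn l a) w) has_integral ncps_nth (ncps_log a) w) {0..1}"
proof -
  have 1: "((\<lambda>l. (l - 1) ^ (k - 1)) has_integral ((1 - 1) ^ k / k - (0 - 1 :: real) ^ k / k)) {0..1}"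
    if "1 \<le> k" for k :: nat
    using that by (intro fundamental_theorem_of_calculus)
      (auto intro!: derivative_eq_intros simp flip: has_real_derivative_iff_has_vector_derivative)
  have 2: "((\<lambda>l. (l - 1) ^ (k - 1)) has_integral ((- 1 :: real) ^ (k + 1) / k)) {0..1}"
    if "1 \<le> k" for k :: nat
    using 1[OF that] that by (simp add: power_0_left)
  have "((\<lambda>l. \<Sum>k = 1..length w. (l - 1) ^ (k - 1) * ncps_nth ((a - 1) ^ k) w) has_integral
      (\<Sum>k = 1..length w. (- 1) ^ (k + 1) / real k * ncps_nth ((a - 1) ^ k) w)) {0..1}"
    by (intro has_integral_sum has_integral_mult_left) (use 2 in auto)
  then show ?thesis
    using a by (simp add: ncps_nth_resolvent_fn ncps_log_def)
qed


section \<open>The coefficients of the resolvent\<close>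

lemma ncps_nth_var_power: "ncps_nth (ncps_var i ^ k) w = (if w = replicate k i then 1 else 0)"
proof (induction k arbitrary: w)
  case (Suc k)
  show ?case
  proof (cases w)
    case (Cons x v)
    have "ncps_nth (ncps_var i ^ Suc k) w =
        (\<Sum>j\<le>length w. ncps_nth (ncps_var i) (take j w) * ncps_nth (ncps_var i ^ k) (drop j w))"
      by (simp add: ncps_nth_mult)
    also have "\<dots> = (\<Sum>j\<in>{1}. ncps_nth (ncps_var i) (take j w) * ncps_nth (ncps_var i ^ k) (drop j w))"
    proof (rule sum.mono_neutral_right)
      show "\<forall>j\<in>{..length w} - {1}. ncps_nth (ncps_var i) (take j w) * ncps_nth (ncps_var i ^ k) (drop j w) = 0"
      proof
        fix j assume j: "j \<in> {..length w} - {1}"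
        then have "length (take j w) \<noteq> length [i]" by auto
        then have "take j w \<noteq> [i]" by metis
        then show "ncps_nth (ncps_var i) (take j w) * ncps_nth (ncps_var i ^ k) (drop j w) = 0"
          by (simp add: ncps_var.rep_eq)
      qed
    qed (auto simp: Cons)
    finally show ?thesis by (simp add: Cons Suc ncps_var.rep_eq)
  qed (simp add: ncps_var.rep_eq)
qed simp

lemma ncps_nth_exp_var:
  "ncps_nth (ncps_exp (ncps_var i)) w = (if w = replicate (length w) i then 1 / fact (length w) else 0)"
proof -
  have "(\<Sum>k\<le>length w. ncps_nth (ncps_var i ^ k) w / fact k) =
      (\<Sum>k\<in>{length w}. ncps_nth (ncps_var i ^ k) w / fact k)"
    by (rule sum.mono_neutral_right) (auto simp: ncps_nth_var_power)
  then show ?thesis by (simp add: ncps_exp_def ncps_nth_var_power)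
qed

lemma ncps_exp_prod_0 [simp]: "ncps_exp_prod 0 = 1"
  by (simp add: ncps_exp_prod_def)

lemma ncps_exp_prod_Suc [simp]: "ncps_exp_prod (Suc n) = ncps_exp_prod n * ncps_exp (ncps_var (Suc n))"
  by (simp add: ncps_exp_prod_def)

lemma snoc_replicate_cases:
  obtains u c where "w = u @ replicate c s" "u = [] \<or> last u \<noteq> s"
proof (induction w arbitrary: thesis rule: rev_induct)
  case (snoc x w)
  show ?case
  proof (cases "x = s")
    case True
    obtain u c where "w = u @ replicate c s" "u = [] \<or> last u \<noteq> s" by (rule snoc.IH)
    then show ?thesis using snoc.prems[of u "Suc c"] True by (simp add: replicate_append_same)
  qed (use snoc.prems[of "w @ [x]" 0] in simp)
qed simp

lemma sorted_le_last:
  fixes u :: "'a::linorder list"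
  assumes "sorted u" "x \<in> set u"
  shows "x \<le> last u"
proof -
  have "u \<noteq> []" using assms by auto
  then have "sorted (butlast u @ [last u])" "x \<in> set (butlast u @ [last u])" using assms by simp_all
  then show ?thesis unfolding sorted_append by auto
qed

text \<open>In the product with the last exponential only the cut before the maximal final run of
  \<open>Suc n\<close> contributes: an earlier cut leaves another letter in the suffix, a later one
  leaves \<open>Suc n\<close> in the prefix.\<close>

lemma ncps_nth_exp_prod:
  "ncps_nth (ncps_exp_prod n) w =
    (if sorted w \<and> set w \<subseteq> {1..n} then \<Prod>i = 1..n. 1 / fact (count_list w i) else 0)"
proof (induction n arbitrary: w)
  case (Suc n)
  let ?s = "Suc n" and ?a = "ncps_nth (ncps_exp_prod n)" and ?e = "ncps_nth (ncps_exp (ncps_var (Suc n)))"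
  obtain u c where w: "w = u @ replicate c ?s" and u: "u = [] \<or> last u \<noteq> ?s"
    by (rule snoc_replicate_cases)
  have "ncps_nth (ncps_exp_prod (Suc n)) w = (\<Sum>i\<le>length w. ?a (take i w) * ?e (drop i w))"
    by (simp add: ncps_nth_mult)
  also have "\<dots> = (\<Sum>i\<in>{length u}. ?a (take i w) * ?e (drop i w))"
  proof (rule sum.mono_neutral_right)
    show "\<forall>i\<in>{..length w} - {length u}. ?a (take i w) * ?e (drop i w) = 0"
    proof
      fix i assume i: "i \<in> {..length w} - {length u}"
      show "?a (take i w) * ?e (drop i w) = 0"
      proof (cases "i < length u")
        case True
        then have "last u \<in> set (drop i u)"
            using last_in_set[of "drop i u"] by (simp add: last_drop)
          with True have "last u \<in> set (drop i w)" "last u \<noteq> ?s"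
            using u by (auto simp: w)
          then have "drop i w \<noteq> replicate (length (drop i w)) ?s"
          by (metis in_set_replicate)
        then show ?thesis by (simp add: ncps_nth_exp_var)
      next
        case False
        with i obtain d where "i = length u + Suc d" "Suc d \<le> c"
          by (auto simp: w not_less dest!: le_Suc_ex) (metis Suc_pred add_cancel_right_right gr0I)
        then have "?s \<in> set (take i w)" by (auto simp: w)
        then show ?thesis by (auto simp: Suc.IH)
      qed
    qed
  qed (auto simp: w)
  also have "\<dots> = ?a u / fact c"
    by (simp add: w ncps_nth_exp_var)
  also have "\<dots> = (if sorted w \<and> set w \<subseteq> {1..?s} then \<Prod>i = 1..?s. 1 / fact (count_list w i) else 0)"
  proof (cases "sorted u \<and> set u \<subseteq> {1..n}")
    case True
    then have 1: "sorted w \<and> set w \<subseteq> {1..?s}"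
      by (force simp: w sorted_append)
    have 2: "count_list (replicate c ?s) i = (if i = ?s then c else 0)" for i
      by (induction c) auto
    have 3: "count_list u ?s = 0" using True by (auto simp: count_list_0_iff)
    have 4: "count_list w i = count_list u i" if "i \<in> {1..n}" for i
      using that by (simp add: w 2)
    have "(\<Prod>i = 1..?s. 1 / fact (count_list w i)) = (\<Prod>i = 1..n. 1 / fact (count_list w i)) / (fact c :: real)"
      using 3 by (simp add: w 2)
    also have "\<dots> = (\<Prod>i = 1..n. 1 / fact (count_list u i)) / (fact c :: real)"
      using 4 by (auto intro!: prod.cong arg_cong2[where f = "(/)"])
    finally show ?thesis using True 1 by (simp add: Suc.IH)
  next
    case False
    have "sorted u \<and> set u \<subseteq> {1..n}" if *: "sorted w" "set w \<subseteq> {1..?s}"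
    proof (cases "u = []")
      case u': False
      have su: "sorted u" using * by (simp add: w sorted_append)
      have "x \<le> n" if "x \<in> set u" for x
      proof -
        have "x \<le> last u" using su that u'
          by (intro sorted_le_last)
        moreover have "last u \<le> ?s" using * last_in_set[OF u'] by (auto simp: w)
        ultimately show ?thesis using u u' by simp
      qed
      then show ?thesis using su * by (auto simp: w)
    qed simp
    with False show ?thesis by (auto simp: Suc.IH)
  qed
  finally show ?case .
qed simp

lemma ncps_nth_exp_prod_Nil [simp]: "ncps_nth (ncps_exp_prod n) [] = 1"
  by (simp add: ncps_nth_exp_prod)

text \<open>At an ascent, sortedness forces the two parts to have disjoint letters, so the
  factorials multiply; a descent at the junction destroys sortedness.\<close>

lemma ncps_nth_exp_prod_append:
  assumes "u \<noteq> []" "v \<noteq> []" "last u \<noteq> hd v"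
  shows "ncps_nth (ncps_exp_prod n) (u @ v) =
    (if last u < hd v then ncps_nth (ncps_exp_prod n) u * ncps_nth (ncps_exp_prod n) v else 0)"
proof -
  note last = sorted_le_last
  have hd: "hd v \<le> y" if "sorted v" "y \<in> set v" for y
    using that assms by (cases v) auto
  show ?thesis
  proof (cases "last u < hd v")
    case True
    have 1: "sorted (u @ v) \<longleftrightarrow> sorted u \<and> sorted v"
      using last hd True unfolding sorted_append by (meson le_trans less_imp_le)
    have "fact (count_list (u @ v) i) = (fact (count_list u i) * fact (count_list v i) :: real)"
      if "sorted u" "sorted v" for i
    proof -
      have "i \<notin> set u \<or> i \<notin> set v"
        using last[OF that(1)] hd[OF that(2)] True by (meson le_trans leD)
      then show ?thesis by (auto simp: count_list_0_iff[symmetric])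
    qed
    then show ?thesis
      using True by (auto simp: ncps_nth_exp_prod 1 prod.distrib[symmetric] simp del: count_list_append)
  next
    case False
    then have "\<not> sorted (u @ v)"
      using assms unfolding sorted_append
      by (meson last_in_set hd_in_set le_neq_implies_less)
    then show ?thesis using False by (simp add: ncps_nth_exp_prod)
  qed
qed

section \<open>Factorisation of the resolvent coefficients\<close>

lemma sum_lessThan_add: "(\<Sum>i<m + n. f i) = (\<Sum>i<m. f i) + (\<Sum>j<n. f (m + j))"
  for f :: "nat \<Rightarrow> 'a::comm_monoid_add" and m n :: nat
  by (induction n) (simp_all add: ac_simps)

abbreviation res_coeff :: "nat \<Rightarrow> real \<Rightarrow> nat list \<Rightarrow> real"
  where "res_coeff n l \<equiv> ncps_nth (resolvent_fn l (ncps_exp_prod n))"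

text \<open>Induction on \<open>q\<close> through the suffix recursion of the resolvent. Iterated,
  it makes a coefficient the product of those of the maximal constant runs, times \<open>l\<close>
  for every ascent and \<open>l - 1\<close> for every descent between runs.\<close>

lemma res_coeff_append:
  assumes p: "p \<noteq> []" and "q \<noteq> []" "last p \<noteq> hd q"
  shows "res_coeff n l (p @ q) = (if last p < hd q then l else l - 1) * res_coeff n l p * res_coeff n l q"
  using assms(2,3)
proof (induction "length q" arbitrary: q rule: less_induct)
  case less
  let ?F = "res_coeff n l" and ?a = "ncps_nth (ncps_exp_prod n)"
  let ?S = "\<lambda>w. \<Sum>i<length w. ?F (take i w) * ?a (drop i w)"
  define c where "c = (if last p < hd q then l else l - 1)"
  \<comment> \<open>\<open>d\<close> is the junction weight for \<open>ncps_exp_prod n\<close>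
    itself, that is, \<open>c\<close> at \<open>l = 1\<close>. The leftover terms cancel because
    \<open>d - (1 - l) - c = 0\<close>.\<close>
  define d :: real where "d = (if last p < hd q then 1 else 0)"
  have rec: "(1 - l) * (\<Sum>i<length w. ?F (take i w) * ?a (drop i w)) = ?a w - ?F w" if "w \<noteq> []" for w
    using ncps_nth_resolvent_fn_rec[of "ncps_exp_prod n" w l] that by simp
  have 1: "(\<Sum>i<length p. ?F (take i (p @ q)) * ?a (drop i (p @ q))) =
      d * ?a q * (\<Sum>i<length p. ?F (take i p) * ?a (drop i p))"
    unfolding sum_distrib_left
  proof (rule sum.cong[OF refl])
    fix i assume "i \<in> {..<length p}"
    then have "?a (drop i (p @ q)) = d * ?a (drop i p) * ?a q"
      using less.prems by (simp add: ncps_nth_exp_prod_append d_def)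
    then show "?F (take i (p @ q)) * ?a (drop i (p @ q)) = d * ?a q * (?F (take i p) * ?a (drop i p))"
      using \<open>i \<in> _\<close> by simp
  qed
  \<comment> \<open>The cut at the junction, \<open>j = 0\<close>, gives \<open>?F p * ?a q\<close>
    without weight; in the sum on the right the term \<open>j = 0\<close> vanishes as
    \<open>?F [] = 0\<close>.\<close>
  have 2: "(\<Sum>j<length q. ?F (take (length p + j) (p @ q)) * ?a (drop (length p + j) (p @ q))) =
      ?F p * ?a q + c * ?F p * (\<Sum>j<length q. ?F (take j q) * ?a (drop j q))"
  proof -
    obtain m where m: "length q = Suc m" using less.prems by (cases q) auto
    have "?F (p @ take (Suc j) q) = c * ?F p * ?F (take (Suc j) q)" if "j < m" for j
    proof -
      have "take (Suc j) q \<noteq> []" "hd (take (Suc j) q) = hd q" "length (take (Suc j) q) < length q"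
        using less.prems that m by auto
      then show ?thesis
        using less.hyps[of "take (Suc j) q"] less.prems by (simp add: c_def)
    qed
    then show ?thesis
      unfolding m sum.lessThan_Suc_shift by (simp add: sum_distrib_left mult.assoc)
  qed
  have "?F (p @ q) = ?a (p @ q) -
      (1 - l) * (\<Sum>i<length p + length q. ?F (take i (p @ q)) * ?a (drop i (p @ q)))"
    using ncps_nth_resolvent_fn_rec[of "ncps_exp_prod n" "p @ q" l] p by simp
  also have "\<dots> = d * ?a p * ?a q - (d * ?a q * (?a p - ?F p) + (1 - l) * ?F p * ?a q + c * ?F p * (?a q - ?F q))"
    unfolding sum_lessThan_add 1 2
  proof -
    have "?a (p @ q) = d * ?a p * ?a q"
      using ncps_nth_exp_prod_append[OF p less.prems] by (simp add: d_def)
    then show "?a (p @ q) - (1 - l) * (d * ?a q * ?S p + (?F p * ?a q + c * ?F p * ?S q)) =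
        d * ?a p * ?a q - (d * ?a q * (?a p - ?F p) + (1 - l) * ?F p * ?a q + c * ?F p * (?a q - ?F q))"
      unfolding rec[OF p, symmetric] rec[OF less.prems(1), symmetric] by (simp only: algebra_simps)
  qed
  also have "\<dots> = c * ?F p * ?F q + (d - (1 - l) - c) * ?F p * ?a q"
    by (simp add: algebra_simps)
  also have "d - (1 - l) - c = 0"
    using less.prems by (simp add: c_def d_def)
  finally show ?case by (simp add: c_def)
qed

lemma ncps_support_mult:
  assumes "\<And>w. w \<notin> lists S \<Longrightarrow> ncps_nth f w = 0" "\<And>w. w \<notin> lists S \<Longrightarrow> ncps_nth g w = 0" "w \<notin> lists S"
  shows "ncps_nth (f * g) w = 0"
  unfolding ncps_nth_mult
proof (intro sum.neutral ballI)
  fix i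
  have "take i w \<notin> lists S \<or> drop i w \<notin> lists S"
    using assms(3) by (metis append_in_lists_conv append_take_drop_id)
  then show "ncps_nth f (take i w) * ncps_nth g (drop i w) = 0" using assms(1,2) by auto
qed

lemma ncps_support_exp_prod: "w \<notin> lists {1..n} \<Longrightarrow> ncps_nth (ncps_exp_prod n) w = 0"
  by (auto simp: ncps_nth_exp_prod)

lemma ncps_support_power:
  assumes "\<And>w. w \<notin> lists S \<Longrightarrow> ncps_nth f w = 0" "w \<notin> lists S"
  shows "ncps_nth (f ^ k) w = 0"
  using assms(2)
proof (induction k arbitrary: w)
  case (Suc k)
  then show ?case using ncps_support_mult[of S f "f ^ k" w] assms(1) by simp
qed auto

lemma res_coeff_support: "w \<notin> lists {1..n} \<Longrightarrow> res_coeff n l w = 0"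
proof -
  assume w: "w \<notin> lists {1..n}"
  have "ncps_nth (ncps_exp_prod n - 1) v = 0" if "v \<notin> lists {1..n}" for v
    using ncps_support_exp_prod[OF that] that by auto
  then have "ncps_nth ((ncps_exp_prod n - 1) ^ k) w = 0" for k
    using ncps_support_power[of "{1..n}"] w by blast
  then show ?thesis by (simp add: ncps_nth_resolvent_fn)
qed

lemma res_coeff_Nil [simp]: "res_coeff n l [] = 0"
  by (rule ncps_nth_resolvent_fn_Nil) simp

lemma continuous_res_coeff [continuous_intros]: "continuous_on A (\<lambda>l. res_coeff n l w)"
  by (simp add: ncps_nth_resolvent_fn) (intro continuous_intros)

text \<open>Replaces each variable by \<open>x i\<close> times itself. This homomorphism turns
  absolute convergence at \<open>x\<close> into summability of the coefficients.\<close>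

definition ncps_scale :: "('x \<Rightarrow> real) \<Rightarrow> 'x ncps \<Rightarrow> 'x ncps"
  where "ncps_scale x f = Abs_ncps (\<lambda>w. ncps_nth f w * prod_list (map x w))"

lemma ncps_nth_scale [simp]: "ncps_nth (ncps_scale x f) w = ncps_nth f w * prod_list (map x w)"
  by (simp add: ncps_scale_def)

lemma ncps_scale_mult: "ncps_scale x (f * g) = ncps_scale x f * ncps_scale x g"
proof (rule ncps_eqI)
  fix w
  have "prod_list (map x w) = prod_list (map x (take i w)) * prod_list (map x (drop i w))" for i
    by (metis append_take_drop_id map_append prod_list.append)
  then show "ncps_nth (ncps_scale x (f * g)) w = ncps_nth (ncps_scale x f * ncps_scale x g) w"
    by (simp add: ncps_nth_mult sum_distrib_right sum_distrib_left mult_ac)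
qed

lemma ncps_scale_simps:
  "ncps_scale x (f + g) = ncps_scale x f + ncps_scale x g"
  "ncps_scale x (f - g) = ncps_scale x f - ncps_scale x g"
  "ncps_scale x (r *\<^sub>R f) = r *\<^sub>R ncps_scale x f"
  "ncps_scale x 1 = 1"
  by (auto intro!: ncps_eqI simp: algebra_simps)

lemma ncps_scale_power: "ncps_scale x (f ^ k) = ncps_scale x f ^ k"
  by (induction k) (simp_all add: ncps_scale_simps ncps_scale_mult)

lemma ncps_scale_log: "ncps_scale x (ncps_log a) = ncps_log (ncps_scale x a)"
proof (rule ncps_eqI)
  fix w
  have "ncps_nth ((ncps_scale x a - 1) ^ k) w = ncps_nth ((a - 1) ^ k) w * prod_list (map x w)" for k
    by (metis ncps_nth_scale ncps_scale_power ncps_scale_simps(2,4))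
  then show "ncps_nth (ncps_scale x (ncps_log a)) w = ncps_nth (ncps_log (ncps_scale x a)) w"
    by (auto simp: ncps_log_def sum_distrib_right intro!: sum.cong)
qed


section \<open>Graded evaluation of noncommutative power series\<close>

definition words :: "nat \<Rightarrow> nat \<Rightarrow> nat list set"
  where "words n k = {w. set w \<subseteq> {1..n} \<and> length w = k}"

lemma finite_words [simp]: "finite (words n k)"
  unfolding words_def by (rule finite_lists_length_eq) simp

lemma words_0 [simp]: "words n 0 = {[]}"
  by (auto simp: words_def)

text \<open>The homogeneous part of degree \<open>k\<close>, evaluated at \<open>X\<close>. Keeping
  degrees apart makes products finite sums and matches the terms of the Magnus series.\<close>

definition ev :: "nat \<Rightarrow> (nat \<Rightarrow> 'a::real_algebra_1) \<Rightarrow> nat ncps \<Rightarrow> nat \<Rightarrow> 'a"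
  where "ev n X f k = (\<Sum>w\<in>words n k. ncps_nth f w *\<^sub>R prod_list (map X w))"

lemma sum_words_split:
  assumes "i \<le> k"
  shows "(\<Sum>w\<in>words n k. h (take i w) (drop i w)) = (\<Sum>u\<in>words n i. \<Sum>v\<in>words n (k - i). h u v)"
proof -
  have "(\<Sum>w\<in>words n k. h (take i w) (drop i w)) = (\<Sum>(u, v)\<in>words n i \<times> words n (k - i). h u v)"
    by (rule sum.reindex_bij_witness[of _ "\<lambda>(u, v). u @ v" "\<lambda>w. (take i w, drop i w)"])
      (use assms in \<open>auto simp: words_def dest: in_set_takeD in_set_dropD\<close>)
  then show ?thesis by (simp add: sum.cartesian_product)
qed

lemma ev_mult: "ev n X (f * g) k = (\<Sum>j\<le>k. ev n X f j * ev n X g (k - j))"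
proof -
  have "ncps_nth (f * g) w *\<^sub>R prod_list (map X w) = (\<Sum>j\<le>k.
      (ncps_nth f (take j w) *\<^sub>R prod_list (map X (take j w))) *
      (ncps_nth g (drop j w) *\<^sub>R prod_list (map X (drop j w))))" if "w \<in> words n k" for w
  proof -
    have "prod_list (map X w) = prod_list (map X (take i w)) * prod_list (map X (drop i w))" for i
      by (metis append_take_drop_id map_append prod_list.append)
    then show ?thesis
      using that by (simp add: ncps_nth_mult scaleR_sum_left words_def mult.commute)
  qed
  then have "ev n X (f * g) k = (\<Sum>w\<in>words n k. \<Sum>j\<le>k.
      (ncps_nth f (take j w) *\<^sub>R prod_list (map X (take j w))) *
      (ncps_nth g (drop j w) *\<^sub>R prod_list (map X (drop j w))))"
    by (simp add: ev_def)
  also have "\<dots> = (\<Sum>j\<le>k. \<Sum>w\<in>words n k.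
      (ncps_nth f (take j w) *\<^sub>R prod_list (map X (take j w))) *
      (ncps_nth g (drop j w) *\<^sub>R prod_list (map X (drop j w))))"
    by (rule sum.swap)
  also have "\<dots> = (\<Sum>j\<le>k. ev n X f j * ev n X g (k - j))"
    unfolding ev_def sum_product
    by (intro sum.cong[OF refl] sum_words_split[of _ _ "\<lambda>u v. (ncps_nth f u *\<^sub>R prod_list (map X u)) *
      (ncps_nth g v *\<^sub>R prod_list (map X v))"]) auto
  finally show ?thesis .
qed

lemma ev_simps:
  "ev n X (f + g) k = ev n X f k + ev n X g k"
  "ev n X (f - g) k = ev n X f k - ev n X g k"
  "ev n X (r *\<^sub>R f) k = r *\<^sub>R ev n X f k"
  "ev n X 1 k = (if k = 0 then 1 else 0)"
     apply (simp_all add: ev_def sum.distrib sum_subtractf scaleR_left_distrib scaleR_left_diff_distrib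
      scaleR_sum_right)
  by (auto simp: words_def intro!: sum.neutral)

lemma ev_0: "ev n X f 0 = of_real (ncps_nth f [])"
  by (simp add: ev_def of_real_def)

lemma ev_exp_var:
  assumes "i \<in> {1..n}"
  shows "ev n X (ncps_exp (ncps_var i)) k = (1 / fact k) *\<^sub>R X i ^ k"
proof -
  have "ev n X (ncps_exp (ncps_var i)) k =
      (\<Sum>w\<in>{replicate k i}. ncps_nth (ncps_exp (ncps_var i)) w *\<^sub>R prod_list (map X w))"
    unfolding ev_def
    by (rule sum.mono_neutral_right[OF finite_words]) (use assms in \<open>auto simp: words_def ncps_nth_exp_var\<close>)
  then show ?thesis by (simp add: ncps_nth_exp_var prod_list_replicate)
qed


section \<open>Invertibility in Banach algebras\<close>

lemma has_inverse_alg_inverse: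
  assumes "has_inverse a"
  shows "a * alg_inverse a = 1" "alg_inverse a * a = 1"
  using assms alg_inverse_eqI unfolding has_inverse_def by metis+

lemma has_inverseI: "a * b = 1 \<Longrightarrow> b * a = 1 \<Longrightarrow> has_inverse a"
  unfolding has_inverse_def by blast

lemma has_inverse_mult:
  assumes "has_inverse a" "has_inverse b"
  shows "has_inverse (a * b)"
proof (rule has_inverseI)
  show "a * b * (alg_inverse b * alg_inverse a) = 1"
    using has_inverse_alg_inverse[OF assms(1)] has_inverse_alg_inverse[OF assms(2)]
    by (metis mult.assoc mult_1_right)
  show "(alg_inverse b * alg_inverse a) * (a * b) = 1"
    using has_inverse_alg_inverse[OF assms(1)] has_inverse_alg_inverse[OF assms(2)]
    by (metis mult.assoc mult_1_right)
qed

lemma neumann_series: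
  fixes y :: "'a::{real_normed_algebra_1, banach}"
  assumes "norm y < 1"
  obtains z where "(1 - y) * z = 1" "z * (1 - y) = 1" "norm z \<le> 1 / (1 - norm y)"
proof -
  have geo: "(\<lambda>k. norm y ^ k) sums (1 / (1 - norm y))"
    using geometric_sums[of "norm y"] assms by simp
  have s: "summable (\<lambda>k. norm (y ^ k))"
    by (rule summable_comparison_test[OF _ sums_summable[OF geo]]) (auto simp: norm_power_ineq)
  define z where "z = (\<Sum>k. y ^ k)"
  have z: "z = 1 + (\<Sum>k. y ^ Suc k)"
    unfolding z_def using suminf_split_head[OF summable_norm_cancel[OF s]] by simp
  have "(\<Sum>k. y ^ Suc k) = y * z" "(\<Sum>k. y ^ Suc k) = z * y"
    unfolding z_def using suminf_mult[OF summable_norm_cancel[OF s]] suminf_mult2[OF summable_norm_cancel[OF s]]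
    by (simp_all add: power_commutes)
  then have "(1 - y) * z = 1" "z * (1 - y) = 1"
    using z by (metis add_diff_cancel_right' left_diff_distrib mult_1_left,
        metis add_diff_cancel_right' right_diff_distrib mult_1_right)
  moreover have "norm z \<le> 1 / (1 - norm y)"
    unfolding z_def
    using summable_norm[OF s] suminf_le[OF norm_power_ineq s sums_summable[OF geo]] sums_unique[OF geo]
    by linarith
  ultimately show ?thesis using that by blast
qed

text \<open>A Neumann series inverts \<open>b * c\<close>, which equals 1 - b(a - c). The factor 2
  bounds the inverses uniformly near \<open>a\<close>, which the compactness argument in
  \<open>inverse_bounded\<close> exploits.\<close>

lemma inverse_perturb:
  fixes a :: "'a::{real_normed_algebra_1, banach}"
  assumes "a * b = 1" "b * a = 1" "norm (c - a) * norm b \<le> 1 / 2"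
  obtains d where "c * d = 1" "d * c = 1" "norm d \<le> 2 * norm b"
proof -
  have "norm (b * (a - c)) \<le> 1 / 2"
    using norm_mult_ineq[of b "a - c"] assms(3) by (simp add: norm_minus_commute mult.commute)
  then obtain z where z: "(1 - b * (a - c)) * z = 1" "z * (1 - b * (a - c)) = 1"
    "norm z \<le> 1 / (1 - norm (b * (a - c)))" and y: "norm (b * (a - c)) \<le> 1 / 2"
    using neumann_series[of "b * (a - c)"] by auto
  have "1 / (1 - norm (b * (a - c))) \<le> 1 / (1 / 2)" using y by (intro divide_left_mono) auto
  then have z2: "norm z \<le> 2" using z(3) by simp
  have bc: "1 - b * (a - c) = b * c"
    using assms(2) by (simp add: algebra_simps)
  have 1: "b * (c * z) = 1" "z * b * c = 1" using z by (simp_all add: bc mult.assoc)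
  then have "c * z = a" using assms by (metis mult.assoc mult_1_left mult_1_right)
  then have "c * (z * b) = 1" using assms by (metis mult.assoc)
  moreover have "norm (z * b) \<le> 2 * norm b"
    using norm_mult_ineq[of z b] mult_right_mono[OF z2, of "norm b"] by simp
  ultimately show ?thesis using that 1 by blast
qed


section \<open>The algebra of absolutely summable noncommutative power series\<close>

definition l1_bound :: "'x ncps \<Rightarrow> real \<Rightarrow> bool"
  where "l1_bound f B \<longleftrightarrow> (\<forall>W. finite W \<longrightarrow> (\<Sum>w\<in>W. \<bar>ncps_nth f w\<bar>) \<le> B)"

lemma l1_bound_add: "l1_bound f A \<Longrightarrow> l1_bound g B \<Longrightarrow> l1_bound (f + g) (A + B)"
  unfolding l1_bound_def
  by (auto intro!: order_trans[OF sum_mono[OF abs_triangle_ineq]] add_mono simp: sum.distrib)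

lemma l1_bound_scaleR: "l1_bound f A \<Longrightarrow> l1_bound (r *\<^sub>R f) (\<bar>r\<bar> * A)"
  unfolding l1_bound_def by (auto simp: abs_mult mult_left_mono simp flip: sum_distrib_left)

text \<open>A word with a marked cut is determined by its two parts, so the sum over
  \<open>W\<close> embeds injectively into a finite double sum over prefixes and suffixes.\<close>

lemma l1_bound_mult:
  assumes "l1_bound f A" "l1_bound g B"
  shows "l1_bound (f * g) (A * B)"
  unfolding l1_bound_def
proof (intro allI impI)
  fix W :: "'a list set" assume W: "finite W"
  have A: "0 \<le> A" using assms(1) unfolding l1_bound_def by (metis finite.emptyI sum.empty)
  let ?S = "SIGMA w:W. {..length w}"
  let ?h = "\<lambda>(u, v). \<bar>ncps_nth f u\<bar> * \<bar>ncps_nth g v\<bar>"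
  let ?i = "\<lambda>(w, i). (take i w, drop i w)"
  have fin: "finite ?S" using W by auto
  have inj: "inj_on ?i ?S"
  proof (rule inj_onI, clarify)
    fix w i v j assume *: "i \<le> length w" "j \<le> length v" "take i w = take j v" "drop i w = drop j v"
    then have "w = v" by (metis append_take_drop_id)
    moreover have "i = j" using * by (metis length_take min_absorb2)
    ultimately show "w = v \<and> i = j" ..
  qed
  have "(\<Sum>w\<in>W. \<bar>ncps_nth (f * g) w\<bar>) \<le>
      (\<Sum>w\<in>W. \<Sum>i\<le>length w. \<bar>ncps_nth f (take i w)\<bar> * \<bar>ncps_nth g (drop i w)\<bar>)"
    unfolding ncps_nth_mult abs_mult[symmetric] by (intro sum_mono sum_abs)
  also have "\<dots> = (\<Sum>p\<in>?S. ?h (?i p))"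
    using W by (simp add: sum.Sigma case_prod_unfold)
  also have "\<dots> = sum ?h (?i ` ?S)"
    by (simp add: sum.reindex[OF inj])
  also have "\<dots> \<le> sum ?h (fst ` ?i ` ?S \<times> snd ` ?i ` ?S)"
    using fin by (intro sum_mono2 subset_fst_snd) auto
  also have "\<dots> = (\<Sum>u\<in>fst ` ?i ` ?S. \<bar>ncps_nth f u\<bar>) * (\<Sum>v\<in>snd ` ?i ` ?S. \<bar>ncps_nth g v\<bar>)"
    by (simp add: sum_product sum.cartesian_product)
  also have "\<dots> \<le> A * B"
    using assms fin A unfolding l1_bound_def by (intro mult_mono) (auto intro!: sum_nonneg)
  finally show "(\<Sum>w\<in>W. \<bar>ncps_nth (f * g) w\<bar>) \<le> A * B" .
qed

lemma l1_bound_single: "l1_bound (Abs_ncps (\<lambda>w. if w = u then c else 0)) \<bar>c\<bar>"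
  unfolding l1_bound_def
proof (intro allI impI)
  fix W :: "'a list set" assume "finite W"
  then have "(\<Sum>w\<in>W. \<bar>if w = u then c else 0\<bar>) = (\<Sum>w\<in>W \<inter> {u}. \<bar>c\<bar>)"
    by (intro sum.mono_neutral_cong_right) auto
  also have "\<dots> \<le> (\<Sum>w\<in>{u}. \<bar>c\<bar>)" by (rule sum_mono2) auto
  finally show "(\<Sum>w\<in>W. \<bar>ncps_nth (Abs_ncps (\<lambda>w. if w = u then c else 0)) w\<bar>) \<le> \<bar>c\<bar>" by simp
qed

lemma ncps_one_eq: "(1 :: 'x ncps) = Abs_ncps (\<lambda>w. if w = [] then 1 else 0)"
  by (rule ncps_eqI) simp

lemma l1_bound_one: "l1_bound 1 1"
  unfolding ncps_one_eq using l1_bound_single[of "[]" 1] by simp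

lemma l1_bound_minus: "l1_bound f A \<Longrightarrow> l1_bound (- f) A"
  by (simp add: l1_bound_def)

text \<open>The norm is unweighted: the radii enter through the elements
  \<open>x i *\<^sub>R ell1_var i\<close>, so a single algebra handles all points
  \<open>x\<close>.\<close>

typedef 'x ell1 = "{f :: 'x ncps. \<exists>B. l1_bound f B}"
  morphisms series Abs_ell1
  using l1_bound_one by blast

setup_lifting type_definition_ell1

instantiation ell1 :: (type) real_algebra_1
begin

lift_definition zero_ell1 :: "'a ell1" is 0
  by (auto simp: l1_bound_def)
lift_definition one_ell1 :: "'a ell1" is 1
  using l1_bound_one by blast
lift_definition plus_ell1 :: "'a ell1 \<Rightarrow> 'a ell1 \<Rightarrow> 'a ell1" is "(+)"
  using l1_bound_add by blast
lift_definition minus_ell1 :: "'a ell1 \<Rightarrow> 'a ell1 \<Rightarrow> 'a ell1" is "(-)"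
  using l1_bound_add l1_bound_minus by (metis diff_conv_add_uminus)
lift_definition uminus_ell1 :: "'a ell1 \<Rightarrow> 'a ell1" is uminus
  using l1_bound_minus by blast
lift_definition scaleR_ell1 :: "real \<Rightarrow> 'a ell1 \<Rightarrow> 'a ell1" is scaleR
  using l1_bound_scaleR by blast
lift_definition times_ell1 :: "'a ell1 \<Rightarrow> 'a ell1 \<Rightarrow> 'a ell1" is "(*)"
  using l1_bound_mult by blast

instance
  by standard (transfer, simp add: algebra_simps)+

end

lemmas series_simps [simp] =
  zero_ell1.rep_eq one_ell1.rep_eq plus_ell1.rep_eq minus_ell1.rep_eq uminus_ell1.rep_eq
  scaleR_ell1.rep_eq times_ell1.rep_eq

lemma series_power [simp]: "series (x ^ k) = series x ^ k"
  by (induction k) simp_all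

lemma series_of_real [simp]: "series (of_real r) = of_real r"
  by (simp add: of_real_def)

lemma ell1_eqI: "series x = series y \<Longrightarrow> x = y"
  by (simp add: series_inject)

instantiation ell1 :: (type) real_normed_algebra_1
begin

definition norm_ell1 :: "'a ell1 \<Rightarrow> real"
  where "norm_ell1 x = (SUP W\<in>{W. finite W}. \<Sum>w\<in>W. \<bar>ncps_nth (series x) w\<bar>)"
definition sgn_ell1_def: "sgn (x :: 'a ell1) = x /\<^sub>R norm x"
definition dist_ell1_def: "dist (x :: 'a ell1) y = norm (x - y)"
definition uniformity_ell1_def:
  "(uniformity :: ('a ell1 \<times> 'a ell1) filter) = (INF e\<in>{0 <..}. principal {(x, y). dist x y < e})"
definition open_ell1_def:
  "open (U :: 'a ell1 set) \<longleftrightarrow> (\<forall>x\<in>U. eventually (\<lambda>(x', y). x' = x \<longrightarrow> y \<in> U) uniformity)"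

lemma l1_bound_norm: "l1_bound (series x) (norm x)"
  unfolding l1_bound_def
proof (intro allI impI)
  fix W :: "'a list set" assume W: "finite W"
  obtain B where "l1_bound (series x) B" using series[of x] by auto
  then have "bdd_above ((\<lambda>W. \<Sum>w\<in>W. \<bar>ncps_nth (series x) w\<bar>) ` {W. finite W})"
    by (auto simp: l1_bound_def intro!: bdd_aboveI2[where M = B])
  then show "(\<Sum>w\<in>W. \<bar>ncps_nth (series x) w\<bar>) \<le> norm x"
    unfolding norm_ell1_def using W by (intro cSUP_upper) auto
qed

lemma norm_ell1_le: "l1_bound (series x) B \<Longrightarrow> norm x \<le> B"
  unfolding norm_ell1_def l1_bound_def by (intro cSUP_least) auto

lemma nth_le_norm_ell1: "\<bar>ncps_nth (series x) w\<bar> \<le> norm x"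
  using l1_bound_norm[of x, unfolded l1_bound_def, rule_format, of "{w}"] by simp

instance
proof
  fix x y :: "'a ell1" and r :: real
  have le: "norm (r *\<^sub>R x) \<le> \<bar>r\<bar> * norm x" for r and x :: "'a ell1"
    using l1_bound_scaleR[OF l1_bound_norm] by (intro norm_ell1_le) simp
  show "norm x = 0 \<longleftrightarrow> x = 0"
  proof
    assume "norm x = 0"
    then show "x = 0"
      using nth_le_norm_ell1[of x] by (auto intro!: ell1_eqI ncps_eqI)
  next
    assume "x = 0"
    moreover have "norm x \<ge> 0" using nth_le_norm_ell1[of x "[]"] by simp
    ultimately show "norm x = 0" using le[of 0 x] by simp
  qed
  show "norm (r *\<^sub>R x) = \<bar>r\<bar> * norm x"
  proof (cases "r = 0")
    case True
    have "norm x \<ge> 0" "norm (0 *\<^sub>R x) \<ge> 0"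
      using nth_le_norm_ell1[of x "[]"] nth_le_norm_ell1[of "0 *\<^sub>R x" "[]"] by simp_all
    then show ?thesis using le[of r x] True by simp
  next
    case False
    then have "norm x \<le> \<bar>inverse r\<bar> * norm (r *\<^sub>R x)"
      using le[of "inverse r" "r *\<^sub>R x"] by simp
    then have "\<bar>r\<bar> * norm x \<le> norm (r *\<^sub>R x)"
      using False by (simp add: field_simps abs_inverse)
    then show ?thesis using le[of r x] by simp
  qed
  show "norm (x + y) \<le> norm x + norm y"
    using l1_bound_add[OF l1_bound_norm l1_bound_norm] by (intro norm_ell1_le) simp
  show "norm (x * y) \<le> norm x * norm y"
    using l1_bound_mult[OF l1_bound_norm l1_bound_norm] by (intro norm_ell1_le) simp
  show "norm (1 :: 'a ell1) = 1"
    using norm_ell1_le[of "1 :: 'a ell1" 1] l1_bound_one nth_le_norm_ell1[of "1 :: 'a ell1" "[]"] by simp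
qed (rule sgn_ell1_def dist_ell1_def uniformity_ell1_def open_ell1_def)+

end

lemma series_Abs_ell1: "l1_bound f B \<Longrightarrow> series (Abs_ell1 f) = f"
  by (rule Abs_ell1_inverse) blast

instance ell1 :: (type) banach
proof
  fix X :: "nat \<Rightarrow> 'a ell1" assume X: "Cauchy X"
  define g where "g w = lim (\<lambda>n. ncps_nth (series (X n)) w)" for w
  have g: "(\<lambda>n. ncps_nth (series (X n)) w) \<longlonglongrightarrow> g w" for w
  proof -
    have "Cauchy (\<lambda>n. ncps_nth (series (X n)) w)"
      unfolding Cauchy_def
    proof (intro allI impI)
      fix e :: real assume "0 < e"
      then obtain M where "\<forall>m\<ge>M. \<forall>n\<ge>M. dist (X m) (X n) < e"
        using X unfolding Cauchy_def by blast
      moreover have "dist (ncps_nth (series (X m)) w) (ncps_nth (series (X n)) w) \<le> dist (X m) (X n)" for m n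
        using nth_le_norm_ell1[of "X m - X n" w] by (simp add: dist_norm)
      ultimately show "\<exists>M. \<forall>m\<ge>M. \<forall>n\<ge>M. dist (ncps_nth (series (X m)) w) (ncps_nth (series (X n)) w) < e"
        by (meson order_le_less_trans)
    qed
    then show ?thesis unfolding g_def by (simp add: Cauchy_convergent_iff convergent_LIMSEQ_iff)
  qed
  \<comment> \<open>The Cauchy bound on a finite set of words passes to the coefficientwise limit
    \<open>g\<close>.\<close>
  have bound: "l1_bound (series (X m) - Abs_ncps g) e" if M: "\<And>n. n \<ge> M \<Longrightarrow> norm (X m - X n) \<le> e" for m M e
    unfolding l1_bound_def
  proof (intro allI impI)
    fix W :: "'a list set" assume W: "finite W"
    have "(\<lambda>n. \<Sum>w\<in>W. \<bar>ncps_nth (series (X m - X n)) w\<bar>) \<longlonglongrightarrow> (\<Sum>w\<in>W. \<bar>ncps_nth (series (X m)) w - g w\<bar>)"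
      using g by (auto intro!: tendsto_intros)
    moreover have "(\<Sum>w\<in>W. \<bar>ncps_nth (series (X m - X n)) w\<bar>) \<le> e" if "n \<ge> M" for n
      using l1_bound_norm[of "X m - X n"] M[OF that] W unfolding l1_bound_def by (metis order_trans)
    ultimately show "(\<Sum>w\<in>W. \<bar>ncps_nth (series (X m) - Abs_ncps g) w\<bar>) \<le> e"
      by (intro LIMSEQ_le_const2) auto
  qed
  obtain M where M: "\<And>m n. m \<ge> M \<Longrightarrow> n \<ge> M \<Longrightarrow> norm (X m - X n) < 1"
    using X unfolding Cauchy_def dist_norm by (meson zero_less_one)
  have "l1_bound (series (X M) - Abs_ncps g) 1"
    using M by (intro bound[of M]) (auto intro: less_imp_le)
  then have "l1_bound (series (X M) + (- (series (X M) - Abs_ncps g))) (norm (X M) + 1)"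
    by (intro l1_bound_add l1_bound_norm l1_bound_minus)
  then have s: "series (Abs_ell1 (Abs_ncps g)) = Abs_ncps g"
    by (intro series_Abs_ell1) simp
  have "X \<longlonglongrightarrow> Abs_ell1 (Abs_ncps g)"
  proof (rule metric_LIMSEQ_I)
    fix e :: real assume "0 < e"
    then obtain M where M: "\<And>m n. m \<ge> M \<Longrightarrow> n \<ge> M \<Longrightarrow> norm (X m - X n) < e / 2"
      using X unfolding Cauchy_def dist_norm by (meson half_gt_zero)
    have "norm (X m - Abs_ell1 (Abs_ncps g)) \<le> e / 2" if "m \<ge> M" for m
      using M[OF that] by (intro norm_ell1_le) (auto simp: s intro!: bound[of M] less_imp_le)
    then show "\<exists>no. \<forall>n\<ge>no. dist (X n) (Abs_ell1 (Abs_ncps g)) < e"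
      using \<open>0 < e\<close> unfolding dist_norm by (intro exI[of _ M] allI impI) fastforce
  qed
  then show "convergent X" by (auto simp: convergent_def)
qed

lift_definition ell1_var :: "'x \<Rightarrow> 'x ell1" is ncps_var
  using l1_bound_single[of _ 1] by (metis ncps_var_def map_fun_apply id_apply)

lemma norm_ell1_var [simp]: "norm (ell1_var i) = 1"
proof (rule antisym)
  show "norm (ell1_var i) \<le> 1"
    using l1_bound_single[of "[i]" 1] by (intro norm_ell1_le) (simp add: ell1_var.rep_eq ncps_var_def)
  show "1 \<le> norm (ell1_var i)"
    using nth_le_norm_ell1[of "ell1_var i" "[i]"] by (simp add: ell1_var.rep_eq ncps_var.rep_eq)
qed

lemma bounded_linear_ncps_nth: "bounded_linear (\<lambda>x. ncps_nth (series x) w)"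
  by (rule bounded_linear_intro[where K = 1]) (auto simp: nth_le_norm_ell1)


section \<open>The product of exponentials of the generators\<close>

lemma series_exp:
  assumes "ncps_nth (series y) [] = 0"
  shows "series (exp y) = ncps_exp (series y)"
proof (rule ncps_eqI)
  fix w
  have s: "summable (\<lambda>k. y ^ k /\<^sub>R fact k)" by (rule summable_exp_generic)
  have "ncps_nth (series (exp y)) w = (\<Sum>k. ncps_nth (series (y ^ k /\<^sub>R fact k)) w)"
    unfolding exp_def by (rule bounded_linear.suminf[OF bounded_linear_ncps_nth s])
  also have "\<dots> = (\<Sum>k\<le>length w. ncps_nth (series y ^ k) w / fact k)"
    by (subst suminf_finite[of "{..length w}"]) (auto simp: not_le ncps_nth_power_eq_0[OF assms] field_simps)
  finally show "ncps_nth (series (exp y)) w = ncps_nth (ncps_exp (series y)) w"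
    by (simp add: ncps_exp_def)
qed

lemma exp_prod_0 [simp]: "exp_prod 0 X = 1"
  by (simp add: exp_prod_def)

lemma exp_prod_Suc [simp]: "exp_prod (Suc n) X = exp_prod n X * exp (X (Suc n))"
  by (simp add: exp_prod_def)

lemma ncps_scale_exp: "ncps_scale x (ncps_exp f) = ncps_exp (ncps_scale x f)"
  by (rule ncps_eqI) (simp add: ncps_exp_def ncps_scale_power[symmetric] sum_distrib_right)

lemma ncps_scale_var: "ncps_scale x (ncps_var i) = x i *\<^sub>R ncps_var i"
  by (rule ncps_eqI) (auto simp: ncps_var.rep_eq)

definition ell1_exp :: "nat \<Rightarrow> (nat \<Rightarrow> real) \<Rightarrow> nat ell1"
  where "ell1_exp n x = exp_prod n (\<lambda>i. x i *\<^sub>R ell1_var i)"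

lemma series_exp_var: "series (exp (x i *\<^sub>R ell1_var i)) = ncps_scale x (ncps_exp (ncps_var i))"
  by (simp add: series_exp ell1_var.rep_eq ncps_var.rep_eq ncps_scale_exp ncps_scale_var)

lemma series_ell1_exp: "series (ell1_exp n x) = ncps_scale x (ncps_exp_prod n)"
  unfolding ell1_exp_def
  by (induction n) (simp_all add: ncps_scale_simps ncps_scale_mult series_exp_var)

definition res_denom :: "real \<Rightarrow> 'a::real_algebra_1 \<Rightarrow> 'a"
  where "res_denom l a = of_real l + (1 - l) *\<^sub>R a"

lemma resolvent_fn_res_denom: "resolvent_fn l a = (a - 1) * alg_inverse (res_denom l a)"
  by (simp add: resolvent_fn_def res_denom_def)

lemma ncps_scale_of_real [simp]: "ncps_scale x (of_real l) = of_real l"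
  by (simp add: of_real_def ncps_scale_simps)

lemma series_res_denom:
  "series (res_denom l (ell1_exp n x)) = ncps_scale x (res_denom l (ncps_exp_prod n))"
  by (simp add: res_denom_def series_ell1_exp ncps_scale_simps)

abbreviation regular :: "nat \<Rightarrow> real \<Rightarrow> (nat \<Rightarrow> real) \<Rightarrow> bool"
  where "regular n l x \<equiv> has_inverse (res_denom l (ell1_exp n x))"

text \<open>A left and a right inverse of the same formal series coincide. Thus an inverse in the
  algebra can only be the formal geometric series, which is thereby summable.\<close>

lemma series_alg_inverse:
  assumes "regular n l x"
  shows "series (alg_inverse (res_denom l (ell1_exp n x))) = ncps_scale x (res_inv (ncps_exp_prod n) l)"
proof -
  let ?d = "res_denom l (ell1_exp n x)"
  have "series (alg_inverse ?d) * series ?d = 1"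
    by (metis has_inverse_alg_inverse(2)[OF assms] times_ell1.rep_eq one_ell1.rep_eq)
  moreover have "series ?d * ncps_scale x (res_inv (ncps_exp_prod n) l) = 1"
    unfolding series_res_denom ncps_scale_mult[symmetric]
    by (simp add: res_denom_def res_inv ncps_scale_simps)
  ultimately show ?thesis by (metis mult.assoc mult_1_left mult_1_right)
qed

lemma series_resolvent_fn:
  assumes "regular n l x"
  shows "series (resolvent_fn l (ell1_exp n x)) = ncps_scale x (resolvent_fn l (ncps_exp_prod n))"
  by (simp add: resolvent_fn_res_denom[of l "ell1_exp n x"] series_alg_inverse[OF assms]
      resolvent_fn_eq_res_inv ncps_scale_mult ncps_scale_simps series_ell1_exp)

section \<open>Dependence on the parameter and the radii\<close>

lemma continuous_on_exp_algebra: "continuous_on UNIV (exp :: 'a::{real_normed_algebra_1, banach} \<Rightarrow> 'a)"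
proof -
  have "continuous_on (ball 0 r) (exp :: 'a \<Rightarrow> 'a)" for r :: real
  proof (cases "r > 0")
    case True
    have bound: "norm (x ^ k /\<^sub>R fact k) \<le> r ^ k /\<^sub>R fact k" if "x \<in> ball 0 r" for x :: 'a and k
    proof -
      have "norm (x ^ k) \<le> norm x ^ k" by (rule norm_power_ineq)
      also have "\<dots> \<le> r ^ k" using that by (intro power_mono) auto
      finally show ?thesis by (simp add: field_simps)
    qed
    have "uniform_limit (ball 0 r) (\<lambda>n x :: 'a. \<Sum>k<n. x ^ k /\<^sub>R fact k) (\<lambda>x. \<Sum>k. x ^ k /\<^sub>R fact k) sequentially"
      by (rule Weierstrass_m_test[OF bound summable_exp_generic])
    then show ?thesis
      unfolding exp_def by (rule uniform_limit_theorem[rotated]) (auto intro!: always_eventually continuous_on_sum continuous_intros)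
  qed (simp add: ball_empty)
  moreover have "(\<Union>k :: nat. ball (0 :: 'a) (real k)) = UNIV"
    using reals_Archimedean2 by auto
  ultimately show ?thesis
    using continuous_on_open_UN[of UNIV "\<lambda>k :: nat. ball (0 :: 'a) (real k)" exp] by simp
qed

lemma tendsto_exp_prod:
  fixes X :: "'b \<Rightarrow> nat \<Rightarrow> 'a::{real_normed_algebra_1, banach}"
  assumes "\<And>i. i \<in> {1..n} \<Longrightarrow> ((\<lambda>t. X t i) \<longlongrightarrow> Y i) F"
  shows "((\<lambda>t. exp_prod n (X t)) \<longlongrightarrow> exp_prod n Y) F"
  using assms
proof (induction n)
  case (Suc n)
  have "((\<lambda>t. exp (X t (Suc n))) \<longlongrightarrow> exp (Y (Suc n))) F"
    by (rule continuous_on_tendsto_compose[OF continuous_on_exp_algebra]) (use Suc.prems in simp_all)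
  moreover have "((\<lambda>t. exp_prod n (X t)) \<longlongrightarrow> exp_prod n Y) F"
    using Suc by simp
  ultimately show ?case by (simp add: tendsto_mult)
qed simp

lemma tendsto_res_denom:
  assumes "(l \<longlongrightarrow> l0) F" "\<And>i. i \<in> {1..n} \<Longrightarrow> ((\<lambda>t. x t i) \<longlongrightarrow> x0 i) F"
  shows "((\<lambda>t. res_denom (l t) (ell1_exp n (x t))) \<longlongrightarrow> res_denom l0 (ell1_exp n x0)) F"
  unfolding res_denom_def ell1_exp_def
  by (intro tendsto_intros tendsto_exp_prod) (use assms in \<open>auto intro!: tendsto_intros\<close>)

text \<open>Invertibility is an open condition, jointly in the parameter and the radii. The
  accompanying norm bound is what compactness turns into uniformity in \<open>l\<close>.\<close>

lemma eventually_regular: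
  assumes "(l \<longlongrightarrow> l0) F" "\<And>i. i \<in> {1..n} \<Longrightarrow> ((\<lambda>t. x t i) \<longlongrightarrow> x0 i) F" "regular n l0 x0"
  shows "\<forall>\<^sub>F t in F. regular n (l t) (x t) \<and> norm (alg_inverse (res_denom (l t) (ell1_exp n (x t)))) \<le>
    2 * norm (alg_inverse (res_denom l0 (ell1_exp n x0)))"
proof -
  let ?a = "res_denom l0 (ell1_exp n x0)"
  let ?b = "alg_inverse ?a"
  have "((\<lambda>t. norm (res_denom (l t) (ell1_exp n (x t)) - ?a) * norm ?b) \<longlongrightarrow> 0 * norm ?b) F"
    by (intro tendsto_intros tendsto_norm_zero) (use tendsto_res_denom[OF assms(1,2)] in \<open>simp add: LIM_zero\<close>)
  then have "\<forall>\<^sub>F t in F. norm (res_denom (l t) (ell1_exp n (x t)) - ?a) * norm ?b < 1 / 2"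
    by (rule order_tendstoD) simp
  then show ?thesis
  proof eventually_elim
    case (elim t)
    then obtain d where d: "res_denom (l t) (ell1_exp n (x t)) * d = 1" "d * res_denom (l t) (ell1_exp n (x t)) = 1"
      "norm d \<le> 2 * norm ?b"
      using inverse_perturb[OF has_inverse_alg_inverse[OF assms(3)]] by (metis less_imp_le)
    then show ?case using alg_inverse_eqI[OF d(1,2)] by (auto intro: has_inverseI)
  qed
qed

text \<open>Parameters with unbounded inverses would accumulate at a regular parameter, near which
  the inverses are bounded by twice the inverse there.\<close>

lemma inverse_bounded:
  assumes "\<And>l. l \<in> {0..1} \<Longrightarrow> regular n l x"
  shows "\<exists>K. \<forall>l\<in>{0..1}. norm (alg_inverse (res_denom l (ell1_exp n x))) \<le> K"
proof (rule ccontr)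
  assume "\<nexists>K. \<forall>l\<in>{0..1}. norm (alg_inverse (res_denom l (ell1_exp n x))) \<le> K"
  then have "\<forall>k :: nat. \<exists>l. l \<in> {0..1} \<and> norm (alg_inverse (res_denom l (ell1_exp n x))) > k"
    by (meson not_le)
  then obtain l :: "nat \<Rightarrow> real" where
    l: "\<And>k. l k \<in> {0..1}" "\<And>k. norm (alg_inverse (res_denom (l k) (ell1_exp n x))) > k"
    by metis
  obtain l0 r where r: "l0 \<in> {0..1}" "strict_mono (r :: nat \<Rightarrow> nat)" "(l \<circ> r) \<longlonglongrightarrow> l0"
    using compact_Icc[of 0 "1::real"] l(1) unfolding compact_def by metis
  define K where "K = 2 * norm (alg_inverse (res_denom l0 (ell1_exp n x)))"
  have "\<forall>\<^sub>F k in sequentially. norm (alg_inverse (res_denom ((l \<circ> r) k) (ell1_exp n x))) \<le> K"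
    using eventually_regular[OF r(3), of n "\<lambda>_. x" x] assms[OF r(1)]
    unfolding K_def by (auto elim: eventually_mono)
  moreover have "\<forall>\<^sub>F k in sequentially. real k > K"
    using filterlim_real_sequentially by (simp add: filterlim_at_top_dense)
  ultimately have "\<forall>\<^sub>F k in sequentially. False"
  proof eventually_elim
    case (elim k)
    have "real k \<le> real (r k)" using seq_suble[OF r(2), of k] by simp
    then show ?case using elim l(2)[of "r k"] by simp
  qed
  then show False by simp
qed

text \<open>The resolvent identity, as \<open>res_denom m a - res_denom l a\<close> is
  \<open>(l - m) *\<^sub>R (a - 1)\<close>. The bound yields finiteness of \<open>Gamma_sup\<close>;
  the Lipschitz estimate serves the divergence proof.\<close>

lemma resolvent_lipschitz:
  assumes "\<And>l. l \<in> {0..1} \<Longrightarrow> regular n l x"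
  shows "\<exists>K. (\<forall>l\<in>{0..1}. norm (resolvent_fn l (ell1_exp n x)) \<le> K) \<and>
    (\<forall>l\<in>{0..1}. \<forall>m\<in>{0..1}.
      norm (resolvent_fn l (ell1_exp n x) - resolvent_fn m (ell1_exp n x)) \<le> K * \<bar>l - m\<bar>)"
proof -
  let ?a = "ell1_exp n x"
  let ?d = "\<lambda>l. res_denom l ?a"
  let ?e = "\<lambda>l. alg_inverse (?d l)"
  obtain K where K: "\<And>l. l \<in> {0..1} \<Longrightarrow> norm (?e l) \<le> K"
    using inverse_bounded[of n x] assms by blast
  have K0: "0 \<le> K" using K[of 0] norm_ge_zero[of "?e 0"] by (metis atLeastAtMost_iff order_refl order_trans zero_le_one)
  let ?n = "norm (?a - 1)"
  define C where "C = max (?n * K) (?n * (K * (?n * K)))"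
  have 1: "norm (resolvent_fn l ?a) \<le> C" if "l \<in> {0..1}" for l
  proof -
    have "norm (resolvent_fn l ?a) \<le> ?n * norm (?e l)"
      unfolding resolvent_fn_res_denom by (rule norm_mult_ineq)
    also have "\<dots> \<le> ?n * K" using K[OF that] by (intro mult_left_mono) auto
    finally show ?thesis by (simp add: C_def)
  qed
  have 2: "norm (resolvent_fn l ?a - resolvent_fn m ?a) \<le> C * \<bar>l - m\<bar>" if lm: "l \<in> {0..1}" "m \<in> {0..1}" for l m
  proof -
    have "?e l - ?e m = ?e l * (?d m * ?e m) - ?e l * ?d l * ?e m"
      using has_inverse_alg_inverse[OF assms[OF lm(1)]] has_inverse_alg_inverse[OF assms[OF lm(2)]] by simp
    also have "\<dots> = ?e l * ((?d m - ?d l) * ?e m)" by (simp add: algebra_simps)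
    also have "?d m - ?d l = (l - m) *\<^sub>R (?a - 1)"
      by (simp add: res_denom_def of_real_def algebra_simps)
    finally have "?e l - ?e m = ?e l * ((l - m) *\<^sub>R (?a - 1) * ?e m)" .
    then have "norm (?e l - ?e m) \<le> norm (?e l) * norm ((l - m) *\<^sub>R (?a - 1) * ?e m)"
      by (simp only: norm_mult_ineq)
    also have "\<dots> \<le> K * (\<bar>l - m\<bar> * ?n * K)"
      using K[OF lm(1)] K[OF lm(2)] K0
      by (intro mult_mono order_trans[OF norm_mult_ineq]) auto
    finally have e: "norm (?e l - ?e m) \<le> K * (\<bar>l - m\<bar> * ?n * K)" .
    have "norm (resolvent_fn l ?a - resolvent_fn m ?a) = norm ((?a - 1) * (?e l - ?e m))"
      by (simp add: resolvent_fn_res_denom algebra_simps)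
    also have "\<dots> \<le> ?n * norm (?e l - ?e m)" by (rule norm_mult_ineq)
    also have "\<dots> \<le> ?n * (K * (\<bar>l - m\<bar> * ?n * K))" using e by (intro mult_left_mono) auto
    also have "\<dots> = ?n * (K * (?n * K)) * \<bar>l - m\<bar>" by simp
    also have "\<dots> \<le> C * \<bar>l - m\<bar>" by (intro mult_right_mono) (auto simp: C_def)
    finally show ?thesis .
  qed
  show ?thesis using 1 2 by (intro exI[of _ C]) auto
qed


section \<open>Evaluation in a Banach algebra\<close>

definition abs_conv :: "(nat \<Rightarrow> real) \<Rightarrow> nat ncps \<Rightarrow> bool"
  where "abs_conv x f \<longleftrightarrow> (\<exists>B. l1_bound (ncps_scale x f) B)"

lemma abs_convI: "series y = ncps_scale x f \<Longrightarrow> abs_conv x f"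
  unfolding abs_conv_def using l1_bound_norm by metis

lemma norm_prod_list_le:
  fixes X :: "nat \<Rightarrow> 'a::real_normed_algebra_1"
  assumes "\<And>i. i \<in> set w \<Longrightarrow> norm (X i) \<le> x i"
  shows "norm (prod_list (map X w)) \<le> prod_list (map x w)"
  using assms
proof (induction w)
  case (Cons i w)
  have "norm (X i * prod_list (map X w)) \<le> norm (X i) * norm (prod_list (map X w))"
    by (rule norm_mult_ineq)
  also have "\<dots> \<le> x i * prod_list (map x w)"
    using Cons by (intro mult_mono) (auto intro: order_trans[OF norm_ge_zero])
  finally show ?case by simp
qed simp

lemma norm_ev_le:
  fixes X :: "nat \<Rightarrow> 'a::real_normed_algebra_1"
  assumes "\<And>i. i \<in> {1..n} \<Longrightarrow> norm (X i) \<le> x i"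
  shows "norm (ev n X f k) \<le> (\<Sum>w\<in>words n k. \<bar>ncps_nth f w\<bar> * prod_list (map x w))"
  unfolding ev_def
proof (rule sum_norm_le)
  fix w assume "w \<in> words n k"
  then show "norm (ncps_nth f w *\<^sub>R prod_list (map X w)) \<le> \<bar>ncps_nth f w\<bar> * prod_list (map x w)"
    using assms by (auto simp: words_def intro!: mult_left_mono norm_prod_list_le)
qed

definition evs :: "nat \<Rightarrow> (nat \<Rightarrow> 'a::real_normed_algebra_1) \<Rightarrow> nat ncps \<Rightarrow> 'a"
  where "evs n X f = (\<Sum>k. ev n X f k)"

context
  fixes n :: nat and X :: "nat \<Rightarrow> 'a::{real_normed_algebra_1, banach}" and x :: "nat \<Rightarrow> real"
  assumes X: "\<And>i. i \<in> {1..n} \<Longrightarrow> norm (X i) \<le> x i"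
begin

lemma sum_words_le:
  assumes "l1_bound (ncps_scale x f) B"
  shows "(\<Sum>k<K. \<Sum>w\<in>words n k. \<bar>ncps_nth f w\<bar> * prod_list (map x w)) \<le> B"
proof -
  have pos: "0 \<le> prod_list (map x w)" if "w \<in> words n k" for w k
    using that order_trans[OF norm_ge_zero X] by (auto simp: words_def subset_iff intro!: prod_list_nonneg)
  have "(\<Sum>k<K. \<Sum>w\<in>words n k. \<bar>ncps_nth f w\<bar> * prod_list (map x w)) =
      (\<Sum>k<K. \<Sum>w\<in>words n k. \<bar>ncps_nth (ncps_scale x f) w\<bar>)"
    using pos by (auto simp: abs_mult intro!: sum.cong)
  also have "\<dots> = (\<Sum>w\<in>(\<Union>k<K. words n k). \<bar>ncps_nth (ncps_scale x f) w\<bar>)"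
    by (rule sum.UNION_disjoint[symmetric]) (simp, simp, auto simp: words_def)
  also have "\<dots> \<le> B"
    using assms unfolding l1_bound_def by (metis finite_UN_I finite_lessThan finite_words)
  finally show ?thesis .
qed

lemma summable_ev:
  assumes "abs_conv x f"
  shows "summable (\<lambda>k. norm (ev n X f k))"
proof -
  obtain B where B: "l1_bound (ncps_scale x f) B"
    using assms unfolding abs_conv_def by blast
  have "(\<Sum>k<K. norm (ev n X f k)) \<le> B" for K
    using sum_mono[OF norm_ev_le[OF X]] sum_words_le[OF B] by (rule order_trans)
  then show ?thesis by (intro summableI_nonneg_bounded) auto
qed

lemma evs_mult:
  assumes "abs_conv x f" "abs_conv x g"
  shows "evs n X (f * g) = evs n X f * evs n X g"
  unfolding evs_def ev_mult
  using Cauchy_product[OF summable_ev[OF assms(1)] summable_ev[OF assms(2)]] by simp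

lemma evs_one: "evs n X 1 = 1"
  unfolding evs_def ev_simps by (subst suminf_finite[of "{0}"]) auto

lemma evs_linear:
  assumes "abs_conv x f" "abs_conv x g"
  shows "evs n X (f + g) = evs n X f + evs n X g" "evs n X (f - g) = evs n X f - evs n X g"
  using summable_norm_cancel[OF summable_ev[OF assms(1)]] summable_norm_cancel[OF summable_ev[OF assms(2)]]
  by (simp_all add: evs_def ev_simps suminf_add suminf_diff)

lemma evs_scaleR: "abs_conv x f \<Longrightarrow> evs n X (r *\<^sub>R f) = r *\<^sub>R evs n X f"
  using summable_norm_cancel[OF summable_ev] by (simp add: evs_def ev_simps suminf_scaleR_right)

lemma evs_exp_var: "i \<in> {1..n} \<Longrightarrow> evs n X (ncps_exp (ncps_var i)) = exp (X i)"
  by (simp add: evs_def ev_exp_var exp_def inverse_eq_divide)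

lemma evs_exp_prod: "evs n X (ncps_exp_prod n) = exp_prod n X"
proof -
  have "evs n X (ncps_exp_prod m) = exp_prod m X" if "m \<le> n" for m
    using that
  proof (induction m)
    case (Suc m)
    have "abs_conv x (ncps_exp_prod m)" "abs_conv x (ncps_exp (ncps_var (Suc m)))"
      by (rule abs_convI[OF series_ell1_exp], rule abs_convI[OF series_exp_var])
    then show ?case using Suc by (simp add: evs_mult evs_exp_var)
  qed (simp add: evs_one)
  then show ?thesis by simp
qed

text \<open>\<open>evs n X\<close> respects products of absolutely convergent series, so it sends
  the formal inverse to an inverse. The summable series are thus the worst case among all Banach
  algebras with \<open>norm (X i) \<le> x i\<close>.\<close>

lemma resolvent_exp_prod:
  assumes "regular n l x"
  shows "has_inverse (res_denom l (exp_prod n X))"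
    and "resolvent_fn l (exp_prod n X) = (\<Sum>k. ev n X (resolvent_fn l (ncps_exp_prod n)) k)"
proof -
  let ?A = "ncps_exp_prod n"
  let ?E = "res_inv ?A l"
  have A: "abs_conv x ?A" by (rule abs_convI[OF series_ell1_exp])
  have E: "abs_conv x ?E" by (rule abs_convI[OF series_alg_inverse[OF assms]])
  have one: "abs_conv x 1" by (rule abs_convI[of 1]) (simp add: ncps_scale_simps)
  have D: "abs_conv x (res_denom l ?A)" by (rule abs_convI[OF series_res_denom])
  have A1: "abs_conv x (?A - 1)"
    by (rule abs_convI[of "ell1_exp n x - 1"]) (simp add: ncps_scale_simps series_ell1_exp)
  have s: "abs_conv x (r *\<^sub>R f)" if "abs_conv x f" for r f
    using that l1_bound_scaleR unfolding abs_conv_def ncps_scale_simps by blast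
  have "evs n X (res_denom l ?A) = res_denom l (exp_prod n X)"
    unfolding res_denom_def of_real_def
    by (simp add: evs_linear[OF s[OF one] s[OF A]] evs_scaleR[OF one] evs_scaleR[OF A] evs_one evs_exp_prod)
  then have inv: "res_denom l (exp_prod n X) * evs n X ?E = 1" "evs n X ?E * res_denom l (exp_prod n X) = 1"
    using res_inv[of ?A l] evs_mult[OF D E] evs_mult[OF E D] by (simp_all add: res_denom_def evs_one)
  then show "has_inverse (res_denom l (exp_prod n X))" by (rule has_inverseI)
  have "evs n X (resolvent_fn l ?A) = (exp_prod n X - 1) * evs n X ?E"
    by (simp add: resolvent_fn_eq_res_inv evs_mult[OF A1 E] evs_linear[OF A one] evs_one evs_exp_prod)
  then show "resolvent_fn l (exp_prod n X) = (\<Sum>k. ev n X (resolvent_fn l ?A) k)"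
    unfolding resolvent_fn_res_denom[of l "exp_prod n X"] alg_inverse_eqI[OF inv] by (simp add: evs_def)
qed

end


section \<open>Divergence at the singularities of the resolvent\<close>

text \<open>\<open>res_denom l (a * b)\<close> exceeds \<open>res_denom l a * res_denom l b\<close>
  by l(1 - l)(a - 1)(b - 1), and \<open>a - 1\<close> is \<open>res_denom l a\<close> times its
  resolvent.\<close>

lemma res_denom_mult:
  assumes "has_inverse (res_denom l a)" "has_inverse (res_denom l b)"
  shows "res_denom l (a * b) =
    res_denom l a * (1 + (l * (1 - l)) *\<^sub>R (resolvent_fn l a * resolvent_fn l b)) * res_denom l b"
proof -
  note a = has_inverse_alg_inverse[OF assms(1)] and b = has_inverse_alg_inverse[OF assms(2)]
  have "res_denom l a * resolvent_fn l a = (a - 1) * (res_denom l a * alg_inverse (res_denom l a))"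
    unfolding resolvent_fn_res_denom mult.assoc[symmetric]
    by (simp add: res_denom_def of_real_def algebra_simps)
  then have 1: "res_denom l a * resolvent_fn l a = a - 1" using a by simp
  have 2: "resolvent_fn l b * res_denom l b = b - 1"
    using b by (simp add: resolvent_fn_res_denom mult.assoc)
  have "res_denom l a * (1 + (l * (1 - l)) *\<^sub>R (resolvent_fn l a * resolvent_fn l b)) * res_denom l b =
      res_denom l a * res_denom l b + (l * (1 - l)) *\<^sub>R
        ((res_denom l a * resolvent_fn l a) * (resolvent_fn l b * res_denom l b))"
    by (simp add: algebra_simps)
  also have "\<dots> = res_denom l a * res_denom l b + (l * (1 - l)) *\<^sub>R ((a - 1) * (b - 1))"
    by (simp only: 1 2)
  also have "\<dots> = res_denom l (a * b)"
    by (simp add: res_denom_def of_real_def algebra_simps flip: scaleR_add_left)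
  finally show ?thesis by simp
qed

text \<open>Otherwise a Neumann series inverts the middle factor in \<open>res_denom_mult\<close>.
  The divergence at a singularity rests on this lower bound.\<close>

lemma singular_product:
  fixes a b :: "'a::{real_normed_algebra_1, banach}"
  assumes "has_inverse (res_denom l a)" "has_inverse (res_denom l b)" "\<not> has_inverse (res_denom l (a * b))"
  shows "1 \<le> \<bar>l * (1 - l)\<bar> * norm (resolvent_fn l a) * norm (resolvent_fn l b)"
proof (rule ccontr)
  let ?y = "(- (l * (1 - l))) *\<^sub>R (resolvent_fn l a * resolvent_fn l b)"
  assume "\<not> ?thesis"
  moreover have "norm ?y \<le> \<bar>l * (1 - l)\<bar> * (norm (resolvent_fn l a) * norm (resolvent_fn l b))"
    by (simp add: mult_left_mono norm_mult_ineq)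
  ultimately have "norm ?y < 1" by (simp add: mult.assoc)
  then obtain z where "(1 - ?y) * z = 1" "z * (1 - ?y) = 1" using neumann_series by blast
  then have "has_inverse (1 - ?y)" by (rule has_inverseI)
  then have "has_inverse (res_denom l (a * b))"
    unfolding res_denom_mult[OF assms(1,2)] using assms(1,2) by (auto intro!: has_inverse_mult)
  with assms(3) show False by simp
qed

section \<open>Words built from alternating blocks of letters\<close>

lemma prod_list_restrict:
  fixes x y :: "'b \<Rightarrow> 'a::semidom"
  assumes "prod_list (map x w) \<noteq> 0" "\<And>i. x i \<noteq> 0 \<Longrightarrow> P i \<and> x i = y i"
  shows "(\<forall>i\<in>set w. P i) \<and> prod_list (map x w) = prod_list (map y w)"
  using assms(1) by (induction w) (use assms(2) in auto)

text \<open>The closing \<open>j\<close> puts a descent after every \<open>v\<close>, including the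
  last, so all pairs contribute the same weights \<open>l\<close> and \<open>l - 1\<close>.\<close>

definition block_word :: "'x \<Rightarrow> ('x list \<times> 'x list) list \<Rightarrow> 'x list"
  where "block_word j ps = concat (map (\<lambda>(u, v). u @ v) ps) @ [j]"

lemma block_word_simps [simp]:
  "block_word j [] = [j]"
  "block_word j ((u, v) # ps) = u @ v @ block_word j ps"
  by (simp_all add: block_word_def)

definition block_pairs :: "nat \<Rightarrow> (nat list \<times> nat list) set"
  where "block_pairs j = {(u, v). u \<noteq> [] \<and> v \<noteq> [] \<and> (\<forall>i\<in>set u. i = j) \<and> (\<forall>i\<in>set v. j < i)}"

lemma hd_block_word:
  assumes "set ps \<subseteq> block_pairs j"
  shows "hd (block_word j ps) = j" "block_word j ps \<noteq> []"
  using assms by (cases ps; force simp: block_pairs_def hd_append)+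

lemma takeWhile_dropWhile_append:
  assumes "\<forall>i\<in>set u. P i" "w \<noteq> []" "\<not> P (hd w)"
  shows "takeWhile P (u @ w) = u" "dropWhile P (u @ w) = w"
  using assms by (simp_all add: takeWhile_append dropWhile_append) (cases w; simp)+

text \<open>The maximal runs of \<open>j\<close> delimit the pairs, so the word can be parsed. Hence
  different lists of pairs yield different words, and their terms may be added up.\<close>

lemma block_word_inj:
  assumes "set ps \<subseteq> block_pairs j" "set qs \<subseteq> block_pairs j" "block_word j ps = block_word j qs"
  shows "ps = qs"
  using assms
proof (induction ps arbitrary: qs)
  case Nil
  then show ?case
    by (cases qs) (auto simp: block_pairs_def Cons_eq_append_conv)
next
  case (Cons p ps)
  obtain u v where p: "p = (u, v)" by force
  show ?case
  proof (cases qs)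
    case Nil
    with Cons.prems p show ?thesis by (auto simp: block_pairs_def append_eq_Cons_conv)
  next
    case q: (Cons q qs')
    obtain u' v' where q': "q = (u', v')" by force
    have parse: "takeWhile (\<lambda>i. i = j) (block_word j ((a, b) # rs)) = a \<and>
        takeWhile (\<lambda>i. i \<noteq> j) (dropWhile (\<lambda>i. i = j) (block_word j ((a, b) # rs))) = b \<and>
        dropWhile (\<lambda>i. i \<noteq> j) (dropWhile (\<lambda>i. i = j) (block_word j ((a, b) # rs))) = block_word j rs"
      if "set ((a, b) # rs) \<subseteq> block_pairs j" for a b rs
    proof -
      have ab: "a \<noteq> []" "b \<noteq> []" "\<forall>i\<in>set a. i = j" "\<forall>i\<in>set b. i \<noteq> j" "set rs \<subseteq> block_pairs j"
        using that by (auto simp: block_pairs_def)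
      have "hd b \<noteq> j" using ab by simp
      then show ?thesis
        using takeWhile_dropWhile_append[of a "\<lambda>i. i = j" "b @ block_word j rs"]
          takeWhile_dropWhile_append[of b "\<lambda>i. i \<noteq> j" "block_word j rs"] ab hd_block_word[OF ab(5)]
        by (simp add: hd_append)
    qed
    have "u = u' \<and> v = v' \<and> block_word j ps = block_word j qs'"
      using parse[of u v ps] parse[of u' v' qs'] Cons.prems unfolding p q q' by metis
    then show ?thesis
      using Cons.IH[of qs'] Cons.prems unfolding p q q' by simp
  qed
qed

lemma res_coeff_single:
  assumes "j \<in> {1..n}"
  shows "res_coeff n l [j] = 1"
proof -
  have "ncps_nth (ncps_exp_prod n) [j] = (\<Prod>i = 1..n. 1 / fact (count_list [j] i))"
    using assms by (simp add: ncps_nth_exp_prod)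
  also have "\<dots> = (\<Prod>i = 1..n. 1)" by (intro prod.cong) auto
  finally show ?thesis
    using ncps_nth_resolvent_fn_rec[of "ncps_exp_prod n" "[j]" l] by simp
qed

text \<open>Each pair takes two applications of \<open>res_coeff_append\<close>: an ascent from
  \<open>u\<close> to \<open>v\<close>, and a descent from \<open>v\<close> to what follows.\<close>

lemma res_coeff_block_word:
  assumes "j \<in> {1..n}" "set ps \<subseteq> block_pairs j"
  shows "res_coeff n l (block_word j ps) =
    prod_list (map (\<lambda>(u, v). l * (l - 1) * res_coeff n l u * res_coeff n l v) ps)"
  using assms(2)
proof (induction ps)
  case Nil
  then show ?case using res_coeff_single[OF assms(1)] by simp
next
  case (Cons p ps)
  obtain u v where p: "p = (u, v)" by force
  have uv: "u \<noteq> []" "v \<noteq> []" "\<forall>i\<in>set u. i = j" "\<forall>i\<in>set v. j < i" "set ps \<subseteq> block_pairs j"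
    using Cons.prems by (auto simp: block_pairs_def p)
  have lv: "last u = j" "j < hd v" "j < last v" using uv by simp_all
  have "res_coeff n l (v @ block_word j ps) = (l - 1) * res_coeff n l v * res_coeff n l (block_word j ps)"
    using res_coeff_append[OF uv(2), of "block_word j ps"] hd_block_word[OF uv(5)] lv by simp
  moreover have "res_coeff n l (u @ v @ block_word j ps) = l * res_coeff n l u * res_coeff n l (v @ block_word j ps)"
    using res_coeff_append[OF uv(1), of "v @ block_word j ps"] lv uv by (simp add: hd_append)
  ultimately show ?case using Cons.IH uv by (simp add: p)
qed

lemma sum_lists_prod_list:
  fixes h :: "'b \<Rightarrow> 'a::comm_semiring_1"
  assumes "finite P"
  shows "(\<Sum>ps | set ps \<subseteq> P \<and> length ps = m. prod_list (map h ps)) = (\<Sum>p\<in>P. h p) ^ m"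
proof (induction m)
  case 0
  have "{ps. set ps \<subseteq> P \<and> length ps = 0} = {[]}" by auto
  then show ?case by simp
next
  case (Suc m)
  have "(\<Sum>ps | set ps \<subseteq> P \<and> length ps = Suc m. prod_list (map h ps)) =
      (\<Sum>(p, ps)\<in>P \<times> {ps. set ps \<subseteq> P \<and> length ps = m}. h p * prod_list (map h ps))"
    by (rule sum.reindex_bij_witness[of _ "\<lambda>(p, ps). p # ps" "\<lambda>ps. (hd ps, tl ps)"])
      (auto simp: length_Suc_conv)
  also have "\<dots> = (\<Sum>p\<in>P. h p) * (\<Sum>ps | set ps \<subseteq> P \<and> length ps = m. prod_list (map h ps))"
    using assms by (simp add: sum_product sum.cartesian_product)
  finally show ?case by (simp add: Suc)
qed

text \<open>Zero coefficients are discarded so that, for the resolvents considered below, all words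
  of \<open>U\<close> are nonempty and use only letters with a nonzero coordinate.\<close>

lemma norm_ell1_approx:
  assumes "c < norm (y :: 'x ell1)"
  shows "\<exists>U. finite U \<and> c < (\<Sum>u\<in>U. \<bar>ncps_nth (series y) u\<bar>) \<and> (\<forall>u\<in>U. ncps_nth (series y) u \<noteq> 0)"
proof -
  have "\<not> l1_bound (series y) c" using norm_ell1_le[of y c] assms by linarith
  then obtain W where W: "finite W" "c < (\<Sum>u\<in>W. \<bar>ncps_nth (series y) u\<bar>)"
    by (auto simp: l1_bound_def not_le)
  have eq: "(\<Sum>u\<in>W. \<bar>ncps_nth (series y) u\<bar>) = (\<Sum>u\<in>{u \<in> W. ncps_nth (series y) u \<noteq> 0}. \<bar>ncps_nth (series y) u\<bar>)"
    using W(1) by (intro sum.mono_neutral_right) auto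
  show ?thesis
    using W eq by (intro exI[of _ "{u \<in> W. ncps_nth (series y) u \<noteq> 0}"]) simp
qed

text \<open>A finite sum of coefficients with weights in [-1, 1] is a functional of norm at most 1,
  so it inherits the Lipschitz bound of the resolvent.\<close>

lemma signed_sum_diff_le:
  assumes "finite U" "\<And>u. u \<in> U \<Longrightarrow> \<bar>s u\<bar> \<le> 1"
  shows "\<bar>(\<Sum>u\<in>U. s u * ncps_nth (series y) u) - (\<Sum>u\<in>U. s u * ncps_nth (series z) u)\<bar> \<le> norm (y - z)"
proof -
  have "\<bar>(\<Sum>u\<in>U. s u * ncps_nth (series y) u) - (\<Sum>u\<in>U. s u * ncps_nth (series z) u)\<bar> =
      \<bar>\<Sum>u\<in>U. s u * ncps_nth (series (y - z)) u\<bar>"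
    by (simp add: sum_subtractf algebra_simps)
  also have "\<dots> \<le> (\<Sum>u\<in>U. \<bar>ncps_nth (series (y - z)) u\<bar>)"
    using assms(2) by (intro order_trans[OF sum_abs] sum_mono) (auto simp: abs_mult intro!: mult_left_le_one_le)
  also have "\<dots> \<le> norm (y - z)"
    using l1_bound_norm[of "y - z"] assms(1) unfolding l1_bound_def by blast
  finally show ?thesis .
qed

text \<open>
  The words \<open>block_word j ps\<close> are distinct, and their coefficients in the logarithm are integrals of
  products. With the signs frozen at a singular \<open>l0\<close>, the sum over those with \<open>2 * k\<close> pairs is at least
  the integral of \<open>f l ^ (2 * k)\<close>, where \<open>f\<close> is Lipschitz and \<open>f l0\<close> is arbitrarily close to 1;
  this integral is at least of order \<open>1 / k\<close>.
\<close>

lemma log_coefficients_diverge: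
  fixes x :: "nat \<Rightarrow> real"
  assumes j: "j \<in> {1..n}" "0 < x j" and x: "\<And>i. 0 \<le> x i" and low: "\<And>i. 1 \<le> i \<Longrightarrow> i < j \<Longrightarrow> x i = 0"
    and reg1: "\<And>l. l \<in> {0..1} \<Longrightarrow> regular n l (\<lambda>i. if i = j then x i else 0)"
    and reg2: "\<And>l. l \<in> {0..1} \<Longrightarrow> regular n l (\<lambda>i. if j < i then x i else 0)"
    and l0: "l0 \<in> {0..1}" and sing: "\<not> regular n l0 x"
  shows "\<not> l1_bound (ncps_scale x (ncps_log (ncps_exp_prod n))) B"
proof
  assume B: "l1_bound (ncps_scale x (ncps_log (ncps_exp_prod n))) B"
  let ?x1 = "\<lambda>i. if i = j then x i else 0" and ?x2 = "\<lambda>i. if j < i then x i else 0"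
  let ?F = "res_coeff n"
  define r1 where "r1 l = resolvent_fn l (ell1_exp n ?x1)" for l
  define r2 where "r2 l = resolvent_fn l (ell1_exp n ?x2)" for l
  \<comment> \<open>Letters before \<open>j\<close> have coordinate 0 and contribute exp 0 = 1, so
    the exponential of \<open>j\<close> stands to the left of all other factors.\<close>
  have "ell1_exp m x = ell1_exp m ?x1 * ell1_exp m ?x2 \<and> (m \<le> j \<longrightarrow> ell1_exp m ?x2 = 1)" for m
    unfolding ell1_exp_def
  proof (induction m)
    case (Suc m)
    then show ?case using low[of "Suc m"]
      by (cases "Suc m" j rule: linorder_cases) (auto simp: mult.assoc)
  qed simp
  then have split: "ell1_exp n x = ell1_exp n ?x1 * ell1_exp n ?x2" by blast
  have q1: "1 \<le> l0 * (1 - l0) * norm (r1 l0) * norm (r2 l0)"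
    using singular_product[OF reg1[OF l0] reg2[OF l0]] sing l0 unfolding split r1_def r2_def
    by (simp add: abs_mult)
  obtain K1 where "\<forall>l\<in>{0..1}. norm (r1 l) \<le> K1"
    "\<forall>l\<in>{0..1}. \<forall>m\<in>{0..1}. norm (r1 l - r1 m) \<le> K1 * \<bar>l - m\<bar>"
    using resolvent_lipschitz[OF reg1] unfolding r1_def by blast
  then have K1: "\<And>l. l \<in> {0..1} \<Longrightarrow> norm (r1 l) \<le> K1"
    "\<And>l m. l \<in> {0..1} \<Longrightarrow> m \<in> {0..1} \<Longrightarrow> norm (r1 l - r1 m) \<le> K1 * \<bar>l - m\<bar>"
    by blast+
  obtain K2 where "\<forall>l\<in>{0..1}. norm (r2 l) \<le> K2"
    "\<forall>l\<in>{0..1}. \<forall>m\<in>{0..1}. norm (r2 l - r2 m) \<le> K2 * \<bar>l - m\<bar>"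
    using resolvent_lipschitz[OF reg2] unfolding r2_def by blast
  then have K2: "\<And>l. l \<in> {0..1} \<Longrightarrow> norm (r2 l) \<le> K2"
    "\<And>l m. l \<in> {0..1} \<Longrightarrow> m \<in> {0..1} \<Longrightarrow> norm (r2 l - r2 m) \<le> K2 * \<bar>l - m\<bar>"
    by blast+
  have K0: "0 \<le> K1" "0 \<le> K2"
    using K1(1)[OF l0] K2(1)[OF l0] norm_ge_zero order_trans by blast+
  \<comment> \<open>A Lipschitz constant for \<open>f\<close> below, whose difference splits into
    three terms of size \<open>K1 * K2\<close>; the added 1 gives \<open>1 \<le> C\<close>, so that
    \<open>\<delta>\<close> is at most 1/8.\<close>
  define C where "C = 3 * K1 * K2 + 1"
  have C: "1 \<le> C" using K0 by (simp add: C_def)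
  have ser1: "ncps_nth (series (r1 l)) w = ?F l w * prod_list (map ?x1 w)" if "l \<in> {0..1}" for l w
    using series_resolvent_fn[OF reg1[OF that]] by (simp add: r1_def)
  have ser2: "ncps_nth (series (r2 l)) w = ?F l w * prod_list (map ?x2 w)" if "l \<in> {0..1}" for l w
    using series_resolvent_fn[OF reg2[OF that]] by (simp add: r2_def)
  \<comment> \<open>The finite sets of words chosen below depend on \<open>K\<close>, but
    \<open>C\<close> does not; so all these partial sums of a harmonic series obey the same bound
    \<open>B\<close>.\<close>
  have main: "(\<Sum>k = 1..K. x j * (1 / (16 * C * k))) \<le> B" if K: "1 \<le> K" for K :: nat
  proof -
    \<comment> \<open>The loss allowed at \<open>l0\<close>: for every \<open>k \<le> K\<close> it
      is at most half of the total loss \<open>1 / (4 * k)\<close> tolerated below. The other half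
      is the Lipschitz variation \<open>C * \<delta>\<close>.\<close>
    let ?e = "1 / (8 * real K)"
    have e: "0 < ?e" "?e < 1" using K by auto
    \<comment> \<open>By continuity both norms can be lowered by some \<open>d > 0\<close> with the
      product still above \<open>1 - ?e\<close>, which leaves room to replace them by finite
      sums.\<close>
    have "((\<lambda>d. l0 * (1 - l0) * (norm (r1 l0) - d) * (norm (r2 l0) - d)) \<longlongrightarrow>
        l0 * (1 - l0) * (norm (r1 l0) - 0) * (norm (r2 l0) - 0)) (at_right 0)"
      by (intro tendsto_intros)
    moreover have "1 - ?e < l0 * (1 - l0) * (norm (r1 l0) - 0) * (norm (r2 l0) - 0)"
      using q1 e(1) unfolding diff_zero by linarith
    ultimately have "\<forall>\<^sub>F d in at_right 0. 1 - ?e < l0 * (1 - l0) * (norm (r1 l0) - d) * (norm (r2 l0) - d)"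
      by (rule order_tendstoD(1))
    moreover have pos: "0 < norm (r1 l0)" "0 < norm (r2 l0)" using q1 by (auto simp: zero_less_norm_iff)
    then have "\<forall>\<^sub>F d in at_right 0. d < norm (r1 l0)" "\<forall>\<^sub>F d in at_right 0. d < norm (r2 l0)"
      by (auto intro!: eventually_at_right_less order_tendstoD(2)[OF tendsto_ident_at])
    moreover have "\<forall>\<^sub>F d in at_right (0 :: real). 0 < d" by (rule eventually_at_right_less)
    ultimately have "\<forall>\<^sub>F d in at_right 0. 0 < d \<and> d < norm (r1 l0) \<and> d < norm (r2 l0) \<and>
        1 - ?e < l0 * (1 - l0) * (norm (r1 l0) - d) * (norm (r2 l0) - d)"
      by eventually_elim auto
    then obtain d where d: "0 < d" "d < norm (r1 l0)" "d < norm (r2 l0)"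
      "1 - ?e < l0 * (1 - l0) * (norm (r1 l0) - d) * (norm (r2 l0) - d)"
      using eventually_happens'[OF trivial_limit_at_right_real] by blast
    have lt: "norm (r1 l0) - d < norm (r1 l0)" "norm (r2 l0) - d < norm (r2 l0)" using d(1) by simp_all
    obtain U where U: "finite U" "norm (r1 l0) - d < (\<Sum>u\<in>U. \<bar>ncps_nth (series (r1 l0)) u\<bar>)"
      "\<forall>u\<in>U. ncps_nth (series (r1 l0)) u \<noteq> 0"
      using norm_ell1_approx[OF lt(1)] by blast
    obtain V where V: "finite V" "norm (r2 l0) - d < (\<Sum>u\<in>V. \<bar>ncps_nth (series (r2 l0)) u\<bar>)"
      "\<forall>u\<in>V. ncps_nth (series (r2 l0)) u \<noteq> 0"
      using norm_ell1_approx[OF lt(2)] by blast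
    have u: "u \<noteq> [] \<and> (\<forall>i\<in>set u. i = j) \<and> prod_list (map ?x1 u) = prod_list (map x u)" if "u \<in> U" for u
    proof -
      have nz: "?F l0 u \<noteq> 0" "prod_list (map ?x1 u) \<noteq> 0"
        using bspec[OF U(3) that] unfolding ser1[OF l0] mult_eq_0_iff by blast+
      have "(\<forall>i\<in>set u. i = j) \<and> prod_list (map ?x1 u) = prod_list (map x u)"
        by (rule prod_list_restrict[OF nz(2)]) (metis (full_types))
      then show ?thesis using nz(1) res_coeff_Nil by metis
    qed
    have v: "v \<noteq> [] \<and> (\<forall>i\<in>set v. j < i) \<and> prod_list (map ?x2 v) = prod_list (map x v)" if "v \<in> V" for v
    proof -
      have nz: "?F l0 v \<noteq> 0" "prod_list (map ?x2 v) \<noteq> 0"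
        using bspec[OF V(3) that] unfolding ser2[OF l0] mult_eq_0_iff by blast+
      have "(\<forall>i\<in>set v. j < i) \<and> prod_list (map ?x2 v) = prod_list (map x v)"
        by (rule prod_list_restrict[OF nz(2)]) (metis (full_types))
      then show ?thesis using nz(1) res_coeff_Nil by metis
    qed
    define P where "P = U \<times> V"
    have P: "finite P" "P \<subseteq> block_pairs j" using U(1) V(1) u v by (auto simp: P_def block_pairs_def)
    \<comment> \<open>The signs are those at \<open>l0\<close> and are kept for all
      \<open>l\<close>. So \<open>\<tau>\<close> and \<open>\<gamma>\<close> are polynomials in
      \<open>l\<close>, and at \<open>l0\<close> they nearly attain the norms of the
      resolvents.\<close>
    define s where "s w = sgn (?F l0 w)" for w
    have s: "\<bar>s w\<bar> \<le> 1" "s w * ?F l0 w = \<bar>?F l0 w\<bar>" for w by (auto simp: s_def sgn_if)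
    define \<tau> where "\<tau> l = (\<Sum>u\<in>U. s u * ?F l u * prod_list (map x u))" for l
    define \<gamma> where "\<gamma> l = (\<Sum>v\<in>V. s v * ?F l v * prod_list (map x v))" for l
    define f where "f l = l * (1 - l) * \<tau> l * \<gamma> l" for l
    have \<tau>: "\<tau> l = (\<Sum>u\<in>U. s u * ncps_nth (series (r1 l)) u)" if "l \<in> {0..1}" for l
      using u ser1[OF that] by (auto simp: \<tau>_def intro!: sum.cong)
    have \<gamma>: "\<gamma> l = (\<Sum>u\<in>V. s u * ncps_nth (series (r2 l)) u)" if "l \<in> {0..1}" for l
      using v ser2[OF that] by (auto simp: \<gamma>_def intro!: sum.cong)
    have "prod_list (map x u) \<ge> 0" for u using x by (auto intro!: prod_list_nonneg)
    then have l0_sums: "\<tau> l0 = (\<Sum>u\<in>U. \<bar>ncps_nth (series (r1 l0)) u\<bar>)" "\<gamma> l0 = (\<Sum>u\<in>V. \<bar>ncps_nth (series (r2 l0)) u\<bar>)"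
      using u v s(2) by (auto simp: \<tau>_def \<gamma>_def ser1[OF l0] ser2[OF l0] abs_mult intro!: sum.cong)
    have f0: "1 - ?e \<le> f l0"
    proof -
      have "l0 * (1 - l0) * (norm (r1 l0) - d) * (norm (r2 l0) - d) \<le> f l0"
        unfolding f_def using U(2) V(2) l0 d by (intro mult_mono) (auto simp: l0_sums intro!: sum_nonneg)
      with d(4) show ?thesis by linarith
    qed
    have \<tau>1: "\<bar>\<tau> l\<bar> \<le> K1" "\<bar>\<tau> l - \<tau> l0\<bar> \<le> K1 * \<bar>l - l0\<bar>" if "l \<in> {0..1}" for l
      using signed_sum_diff_le[OF U(1), of s "r1 l" 0] signed_sum_diff_le[OF U(1), of s "r1 l" "r1 l0"] s(1)
        K1(1)[OF that] K1(2)[OF that l0] \<tau>[OF that] \<tau>[OF l0] by simp_all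
    have \<gamma>1: "\<bar>\<gamma> l\<bar> \<le> K2" "\<bar>\<gamma> l - \<gamma> l0\<bar> \<le> K2 * \<bar>l - l0\<bar>" if "l \<in> {0..1}" for l
      using signed_sum_diff_le[OF V(1), of s "r2 l" 0] signed_sum_diff_le[OF V(1), of s "r2 l" "r2 l0"] s(1)
        K2(1)[OF that] K2(2)[OF that l0] \<gamma>[OF that] \<gamma>[OF l0] by simp_all
    have lip: "\<bar>f l - f l0\<bar> \<le> C * \<bar>l - l0\<bar>" if l: "l \<in> {0..1}" for l
    proof -
      have "f l - f l0 = (l - l0) * (1 - l - l0) * (\<tau> l * \<gamma> l) + l0 * (1 - l0) * ((\<tau> l - \<tau> l0) * \<gamma> l) +
          l0 * (1 - l0) * (\<tau> l0 * (\<gamma> l - \<gamma> l0))"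
        by (simp add: f_def algebra_simps)
      also have "\<bar>\<dots>\<bar> \<le> \<bar>(l - l0) * (1 - l - l0) * (\<tau> l * \<gamma> l)\<bar> + \<bar>l0 * (1 - l0) * ((\<tau> l - \<tau> l0) * \<gamma> l)\<bar> +
          \<bar>l0 * (1 - l0) * (\<tau> l0 * (\<gamma> l - \<gamma> l0))\<bar>"
        by (intro order_trans[OF abs_triangle_ineq] add_mono) auto
      also have "\<dots> \<le> \<bar>l - l0\<bar> * 1 * (K1 * K2) + 1 * 1 * ((K1 * \<bar>l - l0\<bar>) * K2) + 1 * 1 * (K1 * (K2 * \<bar>l - l0\<bar>))"
        unfolding abs_mult using l l0 K0 \<tau>1[OF l] \<gamma>1[OF l] \<tau>1[OF l0]
        by (intro add_mono mult_mono) auto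
      also have "\<dots> \<le> C * \<bar>l - l0\<bar>" by (simp add: C_def algebra_simps)
      finally show ?thesis .
    qed
    have cont: "continuous_on A f" for A
      unfolding f_def \<tau>_def \<gamma>_def by (intro continuous_intros)
    have int_lower: "1 / (16 * C * k) \<le> integral {0..1} (\<lambda>l. f l ^ (2 * k))" if k: "k \<in> {1..K}" for k
    proof -
      \<comment> \<open>Within this distance of \<open>l0\<close>, \<open>f\<close> varies by at
        most \<open>C * \<delta> = 1 / (8 * k)\<close>.\<close>
      define \<delta> where "\<delta> = 1 / (8 * C * k)"
      have k1: "1 \<le> real k" using k by simp
      have "1 \<le> C * k" using mult_mono[OF C k1] C by simp
      then have \<delta>: "0 < \<delta>" "\<delta> \<le> 1 / 8" by (auto simp: \<delta>_def field_simps)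
      \<comment> \<open>The interval extends to the side of \<open>l0\<close> on which [0, 1] has
        more room.\<close>
      define a where "a = (if l0 \<le> 1 / 2 then l0 else l0 - \<delta>)"
      have a: "{a..a + \<delta>} \<subseteq> {0..1}" "{a..a + \<delta>} \<subseteq> {l0 - \<delta>..l0 + \<delta>}"
        using l0 \<delta> by (auto simp: a_def split: if_splits)
      have "1 / 2 \<le> f l ^ (2 * k)" if "l \<in> {a..a + \<delta>}" for l
      proof -
        have l: "l \<in> {0..1}" "\<bar>l - l0\<bar> \<le> \<delta>" using a that by (auto simp: subset_iff abs_le_iff)
        have "f l0 - f l \<le> C * \<delta>" using lip[OF l(1)] mult_left_mono[OF l(2), of C] C by linarith
        moreover have "C * \<delta> = 1 / (8 * real k)" using C by (simp add: \<delta>_def)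
        moreover have "1 / (8 * real K) \<le> 1 / (8 * real k)" using k by (intro divide_left_mono) auto
        ultimately have low: "1 + (- 1 / (4 * real k)) \<le> f l" using f0 by simp
        have t: "- 1 \<le> - 1 / (4 * real k)" "0 \<le> 1 + (- 1 / (4 * real k))" using k1 by (auto simp: field_simps)
        \<comment> \<open>The left side is 1 - 1/2, whatever \<open>k\<close> is.\<close>
        have "1 + real (2 * k) * (- 1 / (4 * real k)) \<le> (1 + (- 1 / (4 * real k))) ^ (2 * k)"
          by (rule Bernoulli_inequality[OF t(1)])
        also have "\<dots> \<le> f l ^ (2 * k)" by (rule power_mono[OF low t(2)])
        finally have "1 + real (2 * k) * (- 1 / (4 * real k)) \<le> f l ^ (2 * k)" .
        then show ?thesis using k1 by simp
      qed
      then have "integral {a..a + \<delta>} (\<lambda>l. 1 / 2) \<le> integral {a..a + \<delta>} (\<lambda>l. f l ^ (2 * k))"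
        by (intro integral_le integrable_continuous_interval continuous_intros cont) auto
      \<comment> \<open>The exponent is even, so the integrand is nonnegative outside the small
        interval as well.\<close>
      also have "\<dots> \<le> integral {0..1} (\<lambda>l. f l ^ (2 * k))"
        by (intro integral_subset_le a integrable_continuous_interval continuous_intros cont) auto
      finally show ?thesis using \<delta>(1) by (simp add: \<delta>_def field_simps)
    qed
    let ?L = "\<lambda>m. {ps. set ps \<subseteq> P \<and> length ps = m}"
    let ?h = "\<lambda>l (u, v). l * (l - 1) * ?F l u * ?F l v"
    let ?c = "\<lambda>(u, v). s u * s v * prod_list (map x u) * prod_list (map x v)"
    let ?log = "\<lambda>w. ncps_nth (ncps_log (ncps_exp_prod n)) w * prod_list (map x w)"
    have xw: "prod_list (map x (block_word j ps)) = prod_list (map (\<lambda>(u, v). prod_list (map x u) * prod_list (map x v)) ps) * x j" for ps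
      by (induction ps) auto
    have abs_c: "prod_list (map ?c ps) = prod_list (map (\<lambda>(u, v). s u * s v) ps) *
        prod_list (map (\<lambda>(u, v). prod_list (map x u) * prod_list (map x v)) ps)" for ps
      by (induction ps) (auto simp: mult_ac)
    have sps: "\<bar>prod_list (map (\<lambda>(u, v). s u * s v) ps)\<bar> \<le> 1" for ps
    proof (induction ps)
      case (Cons p ps)
      have "\<bar>s u * s v\<bar> \<le> 1" for u v
        unfolding abs_mult using s(1) by (intro mult_le_one) auto
      then show ?case using Cons by (auto simp: abs_mult[of "case p of (u, v) \<Rightarrow> s u * s v"] intro!: mult_le_one split: prod.splits)
    qed simp
    have fin: "finite (?L m)" for m by (rule finite_lists_length_eq[OF P(1)])
    have step: "x j * integral {0..1} (\<lambda>l. f l ^ (2 * k)) \<le> (\<Sum>ps\<in>?L (2 * k). \<bar>?log (block_word j ps)\<bar>)" for k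
    proof -
      have I: "((\<lambda>l. \<Sum>ps\<in>?L (2 * k). ?F l (block_word j ps) * (prod_list (map ?c ps) * x j)) has_integral
          (\<Sum>ps\<in>?L (2 * k). ncps_nth (ncps_log (ncps_exp_prod n)) (block_word j ps) * (prod_list (map ?c ps) * x j))) {0..1}"
        by (intro has_integral_sum fin has_integral_mult_left ncps_log_has_integral) simp
      have "(\<Sum>ps\<in>?L (2 * k). ?F l (block_word j ps) * (prod_list (map ?c ps) * x j)) = x j * f l ^ (2 * k)" for l
      proof -
        have 1: "prod_list (map (?h l) ps) * prod_list (map ?c ps) = prod_list (map (\<lambda>p. ?h l p * ?c p) ps)" for ps
          by (induction ps) (auto simp: mult_ac)
        have "(\<Sum>ps\<in>?L (2 * k). ?F l (block_word j ps) * (prod_list (map ?c ps) * x j)) =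
            (\<Sum>ps\<in>?L (2 * k). x j * prod_list (map (\<lambda>p. ?h l p * ?c p) ps))"
        proof (rule sum.cong[OF refl])
          fix ps assume "ps \<in> ?L (2 * k)"
          then have "set ps \<subseteq> block_pairs j" using P by auto
          then show "?F l (block_word j ps) * (prod_list (map ?c ps) * x j) = x j * prod_list (map (\<lambda>p. ?h l p * ?c p) ps)"
            using res_coeff_block_word[OF j(1), of ps l] 1[of ps] by (simp add: mult_ac)
        qed
        also have "\<dots> = x j * (\<Sum>p\<in>P. ?h l p * ?c p) ^ (2 * k)"
          by (simp only: sum_distrib_left[symmetric] sum_lists_prod_list[OF P(1)])
        \<comment> \<open>The sign comes from l(l - 1) = -l(1 - l) and disappears in the even
          power.\<close>
        also have "(\<Sum>p\<in>P. ?h l p * ?c p) = - f l"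
        proof -
          have "(\<Sum>p\<in>P. ?h l p * ?c p) = (\<Sum>u\<in>U. \<Sum>v\<in>V. ?h l (u, v) * ?c (u, v))"
            by (simp add: P_def sum.cartesian_product case_prod_unfold)
          also have "\<dots> = (\<Sum>u\<in>U. \<Sum>v\<in>V. - (l * (1 - l)) *
              ((s u * ?F l u * prod_list (map x u)) * (s v * ?F l v * prod_list (map x v))))"
            by (intro sum.cong refl) (simp add: algebra_simps)
          also have "\<dots> = - (l * (1 - l)) * (\<tau> l * \<gamma> l)"
            unfolding \<tau>_def \<gamma>_def by (simp only: sum_product) (simp only: sum_distrib_left)
          finally show ?thesis by (simp add: f_def)
        qed
        finally show ?thesis by simp
      qed
      then have "x j * integral {0..1} (\<lambda>l. f l ^ (2 * k)) =
          (\<Sum>ps\<in>?L (2 * k). ncps_nth (ncps_log (ncps_exp_prod n)) (block_word j ps) * (prod_list (map ?c ps) * x j))"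
        using integral_unique[OF I] by simp
      also have "\<dots> \<le> (\<Sum>ps\<in>?L (2 * k). \<bar>?log (block_word j ps)\<bar>)"
      proof (rule sum_mono)
        fix ps
        have "ncps_nth (ncps_log (ncps_exp_prod n)) (block_word j ps) * (prod_list (map ?c ps) * x j) =
            prod_list (map (\<lambda>(u, v). s u * s v) ps) * ?log (block_word j ps)"
          by (simp add: abs_c xw)
        also have "\<dots> \<le> \<bar>prod_list (map (\<lambda>(u, v). s u * s v) ps)\<bar> * \<bar>?log (block_word j ps)\<bar>"
          by (simp flip: abs_mult)
        also have "\<dots> \<le> \<bar>?log (block_word j ps)\<bar>"
          using sps[of ps] by (intro mult_left_le_one_le) auto
        finally show "ncps_nth (ncps_log (ncps_exp_prod n)) (block_word j ps) * (prod_list (map ?c ps) * x j) \<le>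
          \<bar>?log (block_word j ps)\<bar>" .
      qed
      finally show ?thesis .
    qed
    have "(\<Sum>k = 1..K. x j * (1 / (16 * C * k))) \<le> (\<Sum>k = 1..K. \<Sum>ps\<in>?L (2 * k). \<bar>?log (block_word j ps)\<bar>)"
      using int_lower j(2) by (intro sum_mono order_trans[OF mult_left_mono step]) auto
    also have "\<dots> = (\<Sum>ps\<in>(\<Union>k\<in>{1..K}. ?L (2 * k)). \<bar>?log (block_word j ps)\<bar>)"
      by (rule sum.UNION_disjoint[symmetric]) (use fin in auto)
    also have "\<dots> = (\<Sum>w\<in>block_word j ` (\<Union>k\<in>{1..K}. ?L (2 * k)). \<bar>?log w\<bar>)"
      by (rule sum.reindex_cong[OF _ refl refl, symmetric])
        (use P in \<open>auto intro!: inj_onI block_word_inj[of _ j]\<close>)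
    also have "\<dots> \<le> B"
      using B fin unfolding l1_bound_def by (simp add: finite_UN_I)
    finally show ?thesis .
  qed
  have harm: "summable (\<lambda>k. 1 / real (Suc k))"
  proof (rule summableI_nonneg_bounded)
    fix K :: nat
    have "(\<Sum>k = 1..Suc K. x j * (1 / (16 * C * k))) = x j / (16 * C) * (\<Sum>k = 1..Suc K. 1 / real k)"
      unfolding sum_distrib_left by (intro sum.cong) simp_all
    then have "x j / (16 * C) * (\<Sum>k = 1..Suc K. 1 / real k) \<le> B" using main[of "Suc K"] by simp
    moreover have "S \<le> B * (16 * C) / x j" if "x j / (16 * C) * S \<le> B" for S
      using j(2) C that by (simp add: field_simps)
    ultimately have le: "(\<Sum>k = 1..Suc K. 1 / real k) \<le> B * (16 * C) / x j" by blast
    have "(\<Sum>k<K. 1 / real (Suc k)) = (\<Sum>k = 1..K. 1 / real k)"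
      by (rule sum.reindex_bij_witness[of _ "\<lambda>k. k - 1" Suc]) auto
    also have "\<dots> \<le> (\<Sum>k = 1..Suc K. 1 / real k)" by (rule sum_mono2) auto
    finally show "(\<Sum>k<K. 1 / real (Suc k)) \<le> B * (16 * C) / x j" using le by simp
  qed auto
  show False
    using iffD1[OF summable_Suc_iff[of "\<lambda>k. 1 / real k"] harm] not_summable_harmonic[where 'a = real]
    by (simp add: inverse_eq_divide)
qed


section \<open>The constant \<open>C_n\<close>\<close>

lemma exp_prod_single:
  assumes "j \<in> {1..n}" "\<And>i. i \<in> {1..n} \<Longrightarrow> i \<noteq> j \<Longrightarrow> X i = 0"
  shows "exp_prod n X = exp (X j)"
proof -
  have "exp_prod m X = (if j \<le> m then exp (X j) else 1)" if "m \<le> n" for m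
    using that
  proof (induction m)
    case (Suc m)
    then show ?case using assms by (cases "Suc m = j") auto
  qed (use assms in simp)
  then show ?thesis using assms(1) by simp
qed

lemma exp_prod_pair:
  assumes "2 \<le> n" "\<And>i. 2 < i \<Longrightarrow> X i = 0"
  shows "exp_prod n X = exp (X 1) * exp (X 2)"
  using assms(1)
proof (induction n rule: dec_induct)
  case base
  show ?case by (simp add: numeral_2_eq_2)
qed (use assms(2) in simp)

text \<open>In the complex numbers the element i pi has norm \<open>pi\<close> and exponential -1,
  and 1/2 + (1/2)(-1) = 0. This ensures that the minimum is taken over a nonempty set.\<close>

lemma singular_single:
  assumes "1 \<le> n"
  shows "\<not> regular n (1 / 2) (\<lambda>i. if i = 1 then pi else 0)"
proof
  let ?x = "\<lambda>i :: nat. if i = 1 then pi else 0"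
  let ?X = "\<lambda>i :: nat. if i = 1 then \<i> * pi else 0"
  assume "regular n (1 / 2) ?x"
  then have "has_inverse (res_denom (1 / 2) (exp_prod n ?X))"
    by (rule resolvent_exp_prod(1)[rotated]) (simp add: norm_mult)
  moreover have "exp_prod n ?X = - 1"
    using exp_prod_single[of 1 n ?X] assms by (simp add: mult.commute)
  ultimately show False by (simp add: res_denom_def of_real_def has_inverse_def)
qed

lemma bounded_convergent_subsequence:
  fixes x :: "nat \<Rightarrow> 'b \<Rightarrow> real"
  assumes "finite I" "\<And>k i. i \<in> I \<Longrightarrow> \<bar>x k i\<bar> \<le> c"
  shows "\<exists>r y. strict_mono r \<and> (\<forall>i\<in>I. (\<lambda>k. x (r k) i) \<longlonglongrightarrow> y i)"
  using assms
proof (induction I rule: finite_induct)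
  case empty
  show ?case by (intro exI[of _ id]) (auto simp: strict_mono_def)
next
  case (insert a I)
  then obtain r y where r: "strict_mono r" "\<forall>i\<in>I. (\<lambda>k. x (r k) i) \<longlonglongrightarrow> y i" by blast
  have "bounded (range (\<lambda>k. x (r k) a))"
    using insert.prems[of a] by (auto intro!: boundedI)
  then obtain l s where s: "strict_mono s" "((\<lambda>k. x (r k) a) \<circ> s) \<longlonglongrightarrow> l"
    using bounded_imp_convergent_subsequence by blast
  show ?case
  proof (intro exI conjI ballI)
    show "strict_mono (r \<circ> s)" using r(1) s(1) by (rule strict_mono_o)
    fix i assume "i \<in> insert a I"
    then show "(\<lambda>k. x ((r \<circ> s) k) i) \<longlonglongrightarrow> (y(a := l)) i"
      using s LIMSEQ_subseq_LIMSEQ[OF bspec[OF r(2)] s(1), of i] insert.hyps by (auto simp: o_def)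
  qed
qed

section \<open>A singular pair of minimal sum\<close>

definition singular :: "nat \<Rightarrow> real \<Rightarrow> (nat \<Rightarrow> real) \<Rightarrow> bool"
  where "singular n l x \<longleftrightarrow> l \<in> {0..1} \<and> (\<forall>i. 0 \<le> x i) \<and> \<not> regular n l x"

lemma ell1_exp_cong: "(\<And>i. i \<in> {1..n} \<Longrightarrow> x i = y i) \<Longrightarrow> ell1_exp n x = ell1_exp n y"
  unfolding ell1_exp_def by (induction n) auto

lemma singular_minimal_exists:
  assumes "1 \<le> n"
  shows "\<exists>l x. singular n l x \<and> (\<forall>m y. singular n m y \<longrightarrow> (\<Sum>i = 1..n. x i) \<le> (\<Sum>i = 1..n. y i))"
proof -
  define S where "S = {\<Sum>i = 1..n. x i | l x. singular n l x}"
  have "singular n (1 / 2) (\<lambda>i. if i = 1 then pi else 0)"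
    using singular_single[OF assms] by (simp add: singular_def)
  then have S: "S \<noteq> {}" "bdd_below S"
    unfolding S_def by (blast, auto simp: singular_def intro!: bdd_belowI[of _ 0] sum_nonneg)
  define c where "c = Inf S"
  have "\<exists>l x. singular n l x \<and> (\<Sum>i = 1..n. x i) < c + 1 / Suc k" for k
  proof -
    have "Inf S < c + 1 / Suc k" by (simp add: c_def)
    then obtain t where "t \<in> S" "t < c + 1 / Suc k" using cInf_lessD[OF S(1)] by blast
    then show ?thesis unfolding S_def by blast
  qed
  then obtain l x where lx: "\<And>k. singular n (l k) (x k)" "\<And>k. (\<Sum>i = 1..n. x k i) < c + 1 / Suc k"
    by metis
  \<comment> \<open>The parameter is stored at index 0, so that one extraction makes it converge
    along with the coordinates.\<close>
  define z where "z k i = (if i = 0 then l k else x k i)" for k i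
  have "\<bar>z k i\<bar> \<le> max 1 (c + 1)" if "i \<in> {0..n}" for k i
  proof (cases "i = 0")
    case False
    then have "x k i \<le> (\<Sum>i = 1..n. x k i)"
      using that lx(1)[of k] by (intro member_le_sum) (auto simp: singular_def)
    also have "\<dots> \<le> c + 1" using lx(2)[of k] by (rule order_trans[OF less_imp_le]) simp
    finally show ?thesis using lx(1)[of k] False by (simp add: z_def singular_def)
  qed (use lx(1)[of k] in \<open>auto simp: z_def singular_def\<close>)
  then obtain r y where r: "strict_mono r" "\<forall>i\<in>{0..n}. (\<lambda>k. z (r k) i) \<longlonglongrightarrow> y i"
    using bounded_convergent_subsequence[of "{0..n}" z "max 1 (c + 1)"] by blast
  define x0 where "x0 i = (if i \<in> {1..n} then y i else 0)" for i
  have l: "(\<lambda>k. l (r k)) \<longlonglongrightarrow> y 0" using bspec[OF r(2), of 0] by (simp add: z_def)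
  have x: "(\<lambda>k. x (r k) i) \<longlonglongrightarrow> x0 i" if "i \<in> {1..n}" for i
    using bspec[OF r(2), of i] that by (simp add: z_def x0_def)
  have "singular n (y 0) x0"
    unfolding singular_def
  proof (intro conjI allI notI)
    show "y 0 \<in> {0..1}"
      using closed_sequentially[OF closed_atLeastAtMost _ l, of 0 1] lx(1) by (auto simp: singular_def)
    show "0 \<le> x0 i" for i
      using LIMSEQ_le_const[OF x, of i 0] lx(1) by (auto simp: singular_def x0_def)
    assume "regular n (y 0) x0"
    then have "\<forall>\<^sub>F k in sequentially. regular n (l (r k)) (x (r k)) \<and>
        norm (alg_inverse (res_denom (l (r k)) (ell1_exp n (x (r k))))) \<le>
          2 * norm (alg_inverse (res_denom (y 0) (ell1_exp n x0)))"
      by (intro eventually_regular l x)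
    then show False using lx(1) by (auto simp: singular_def)
  qed
  moreover have "(\<Sum>i = 1..n. x0 i) \<le> c"
  proof (rule LIMSEQ_le)
    show "(\<lambda>k. \<Sum>i = 1..n. x (r k) i) \<longlonglongrightarrow> (\<Sum>i = 1..n. x0 i)" by (intro tendsto_sum x)
    have "(\<lambda>k. c + 1 / Suc k) \<longlonglongrightarrow> c + 0" by (intro tendsto_intros LIMSEQ_Suc lim_1_over_n)
    then show "(\<lambda>k. c + 1 / Suc (r k)) \<longlonglongrightarrow> c" using LIMSEQ_subseq_LIMSEQ[OF _ r(1)] by (force simp: o_def)
    show "\<exists>N. \<forall>k\<ge>N. (\<Sum>i = 1..n. x (r k) i) \<le> c + 1 / Suc (r k)" using lx(2) by (auto intro: less_imp_le)
  qed
  moreover have "c \<le> (\<Sum>i = 1..n. y i)" if "singular n m y" for m y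
    unfolding c_def using that S(2) by (intro cInf_lower) (auto simp: S_def)
  ultimately show ?thesis by (meson order_trans)
qed

text \<open>
  A singular point with a single nonzero coordinate can be replaced by one with two nonzero
  coordinates and the same sum, as the series in two variables specialises to that in one.
\<close>

lemma singular_minimal_log:
  assumes "2 \<le> n"
  obtains l x where "singular n l x" "\<And>m y. singular n m y \<Longrightarrow> (\<Sum>i = 1..n. x i) \<le> (\<Sum>i = 1..n. y i)"
    "\<And>B. \<not> l1_bound (ncps_scale x (ncps_log (ncps_exp_prod n))) B"
proof -
  obtain l x0 where x0: "singular n l x0" "\<And>m y. singular n m y \<Longrightarrow> (\<Sum>i = 1..n. x0 i) \<le> (\<Sum>i = 1..n. y i)"
    using singular_minimal_exists[of n] assms by auto
  have "\<exists>x. singular n l x \<and> (\<Sum>i = 1..n. x i) = (\<Sum>i = 1..n. x0 i) \<and>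
      (\<exists>a\<in>{1..n}. \<exists>b\<in>{1..n}. a \<noteq> b \<and> 0 < x a \<and> 0 < x b)"
  proof (cases "\<exists>a\<in>{1..n}. \<exists>b\<in>{1..n}. a \<noteq> b \<and> 0 < x0 a \<and> 0 < x0 b")
    case True
    then show ?thesis using x0 by blast
  next
    case False
    have "\<exists>a\<in>{1..n}. 0 < x0 a"
    proof (rule ccontr)
      assume "\<not> ?thesis"
      then have "ell1_exp n x0 = ell1_exp n (\<lambda>_. 0)"
        using x0(1) by (intro ell1_exp_cong) (auto simp: singular_def not_less intro: antisym)
      also have "\<dots> = 1" unfolding ell1_exp_def by (induction n) auto
      finally have "res_denom l (ell1_exp n x0) = 1"
        by (simp add: res_denom_def of_real_def flip: scaleR_add_left)
      then show False using x0(1) by (simp add: singular_def has_inverse_def)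
    qed
    then obtain a where a: "a \<in> {1..n}" "0 < x0 a" by blast
    have za: "x0 i = 0" if "i \<in> {1..n}" "i \<noteq> a" for i
      using False a that x0(1) unfolding singular_def by (metis less_eq_real_def)
    \<comment> \<open>The mass at \<open>a\<close> is split evenly over the letters 1 and 2. At
      \<open>X\<close> both letters become multiples of one generator, so the two exponentials
      commute and give back the one-letter product; regularity at \<open>x\<close> would therefore
      imply regularity at \<open>x0\<close>.\<close>
    define x where "x i = (if i = 1 \<or> i = 2 then x0 a / 2 else 0)" for i :: nat
    define X :: "nat \<Rightarrow> nat ell1" where "X i = (if i = 1 \<or> i = 2 then (x0 a / 2) *\<^sub>R ell1_var a else 0)" for i
    have "exp_prod n X = exp ((x0 a / 2) *\<^sub>R ell1_var a) * exp ((x0 a / 2) *\<^sub>R ell1_var a)"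
      using exp_prod_pair[OF assms, of X] by (simp add: X_def)
    also have "\<dots> = exp (x0 a *\<^sub>R ell1_var a)"
      by (subst exp_add_commuting[symmetric]) (auto simp flip: scaleR_add_left)
    also have "\<dots> = ell1_exp n x0"
      unfolding ell1_exp_def using exp_prod_single[OF a(1), of "\<lambda>i. x0 i *\<^sub>R ell1_var i"] za by simp
    finally have "exp_prod n X = ell1_exp n x0" .
    moreover have "norm (X i) \<le> x i" for i using a by (simp add: X_def x_def)
    ultimately have "\<not> regular n l x"
      using resolvent_exp_prod(1)[of n X x l] x0(1) by (metis singular_def)
    then have "singular n l x" using x0(1) a by (simp add: singular_def x_def)
    moreover have "(\<Sum>i = 1..n. x i) = (\<Sum>i\<in>{1, 2}. x i)"
      by (rule sum.mono_neutral_right) (use assms in \<open>auto simp: x_def\<close>)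
    moreover have "(\<Sum>i = 1..n. x0 i) = (\<Sum>i\<in>{a}. x0 i)"
      by (rule sum.mono_neutral_right) (use a za in auto)
    moreover have "0 < x 1" "0 < x 2" "1 \<in> {1..n}" "2 \<in> {1..n}" using a assms by (auto simp: x_def)
    ultimately show ?thesis by (intro exI[of _ x] conjI bexI[of _ 1] bexI[of _ 2]) (auto simp: x_def)
  qed
  then obtain x a b where x: "singular n l x" "(\<Sum>i = 1..n. x i) = (\<Sum>i = 1..n. x0 i)"
    and ab: "a \<in> {1..n}" "b \<in> {1..n}" "a \<noteq> b" "0 < x a" "0 < x b" by blast
  have min: "(\<Sum>i = 1..n. x i) \<le> (\<Sum>i = 1..n. y i)" if "singular n m y" for m y
    using x0(2)[OF that] x(2) by simp
  define j where "j = (LEAST i. i \<in> {1..n} \<and> 0 < x i)"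
  have j: "j \<in> {1..n}" "0 < x j"
    using LeastI[of "\<lambda>i. i \<in> {1..n} \<and> 0 < x i" a] ab unfolding j_def by auto
  have low: "x i = 0" if "1 \<le> i" "i < j" for i
    using not_less_Least[of i "\<lambda>i. i \<in> {1..n} \<and> 0 < x i"] that j x(1)
    unfolding j_def[symmetric] singular_def by (metis atLeastAtMost_iff less_eq_real_def less_imp_le order_trans)
  \<comment> \<open>Lowering one coordinate and raising none pushes the sum below the minimum, where
    nothing is singular.\<close>
  have reg: "regular n m y" if "\<And>i. 0 \<le> y i" "\<And>i. y i \<le> x i" "k \<in> {1..n}" "y k < x k" "m \<in> {0..1}" for m y k
  proof (rule ccontr)
    assume "\<not> ?thesis"
    then have "(\<Sum>i = 1..n. x i) \<le> (\<Sum>i = 1..n. y i)" using that by (intro min) (auto simp: singular_def)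
    moreover have "(\<Sum>i = 1..n. y i) < (\<Sum>i = 1..n. x i)" using that by (intro sum_strict_mono_ex1) auto
    ultimately show False by simp
  qed
  \<comment> \<open>A second positive coordinate: losing \<open>k\<close> makes the point supported
    on \<open>j\<close> regular, and losing \<open>j\<close> does so for the point supported on
    larger letters.\<close>
  obtain k where k: "k \<in> {1..n}" "k \<noteq> j" "0 < x k" using ab by metis
  have nonneg: "\<And>i. 0 \<le> x i" using x(1) by (simp add: singular_def)
  have "\<not> l1_bound (ncps_scale x (ncps_log (ncps_exp_prod n))) B" for B
  proof (rule log_coefficients_diverge[where x = x and n = n and j = j and ?l0.0 = l, OF j nonneg low])
    show "regular n m (\<lambda>i. if i = j then x i else 0)" if "m \<in> {0..1}" for m
      using k nonneg that by (intro reg[of _ k]) auto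
    show "regular n m (\<lambda>i. if j < i then x i else 0)" if "m \<in> {0..1}" for m
      using j nonneg that by (intro reg[of _ j]) auto
  qed (use x(1) in \<open>auto simp: singular_def\<close>)
  with x(1) min show ?thesis by (rule that)
qed

section \<open>Values in [0, \<infinity>] and bounds on finite sums\<close>

lemma ncps_log_support: "w \<notin> lists {1..n} \<Longrightarrow> ncps_nth (ncps_log (ncps_exp_prod n)) w = 0"
  using ncps_log_has_integral[of "ncps_exp_prod n" w] by (auto simp: res_coeff_support has_integral_0_eq simp del: in_lists_conv_set)

lemma abs_value_eq_SUP:
  "abs_value n f x = (SUP F\<in>{F. finite F \<and> F \<subseteq> lists {1..n}}. \<Sum>w\<in>F. ennreal \<bar>ncps_nth f w\<bar> * prod_list (map x w))"
  unfolding abs_value_def by (rule nonneg_infsum_complete) simp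

lemma prod_list_ennreal:
  "(\<And>i. i \<in> set w \<Longrightarrow> 0 \<le> x i) \<Longrightarrow> prod_list (map (\<lambda>i. ennreal (x i)) w) = ennreal (prod_list (map x w))"
  by (induction w) (auto simp: ennreal_mult')

lemma abs_value_finite_sum:
  assumes "F \<subseteq> lists {1..n}" "\<And>i. i \<in> {1..n} \<Longrightarrow> 0 \<le> x i"
  shows "(\<Sum>w\<in>F. ennreal \<bar>ncps_nth f w\<bar> * prod_list (map (\<lambda>i. ennreal (x i)) w)) =
    ennreal (\<Sum>w\<in>F. \<bar>ncps_nth (ncps_scale x f) w\<bar>)"
proof -
  have "ennreal \<bar>ncps_nth f w\<bar> * prod_list (map (\<lambda>i. ennreal (x i)) w) = ennreal \<bar>ncps_nth (ncps_scale x f) w\<bar>"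
    if "w \<in> F" for w
  proof -
    have "\<And>i. i \<in> set w \<Longrightarrow> 0 \<le> x i" using that assms by auto
    moreover from this have "0 \<le> prod_list (map x w)" by (auto intro!: prod_list_nonneg)
    ultimately show ?thesis by (simp add: prod_list_ennreal abs_mult ennreal_mult')
  qed
  then show ?thesis by simp
qed

lemma abs_value_le:
  assumes "l1_bound (ncps_scale x f) B" "\<And>i. i \<in> {1..n} \<Longrightarrow> 0 \<le> x i"
  shows "abs_value n f (\<lambda>i. ennreal (x i)) \<le> ennreal B"
  unfolding abs_value_eq_SUP
proof (rule SUP_least)
  fix F :: "nat list set" assume F: "F \<in> {F. finite F \<and> F \<subseteq> lists {1..n}}"
  then have "(\<Sum>w\<in>F. \<bar>ncps_nth (ncps_scale x f) w\<bar>) \<le> B" using assms(1) unfolding l1_bound_def by blast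
  then show "(\<Sum>w\<in>F. ennreal \<bar>ncps_nth f w\<bar> * prod_list (map (\<lambda>i. ennreal (x i)) w)) \<le> ennreal B"
    using abs_value_finite_sum[of F n x f] assms(2) F by (simp add: ennreal_leI)
qed

lemma l1_bound_of_abs_value:
  assumes "abs_value n f (\<lambda>i. ennreal (x i)) \<noteq> \<infinity>" "\<And>i. i \<in> {1..n} \<Longrightarrow> 0 \<le> x i"
    "\<And>w. w \<notin> lists {1..n} \<Longrightarrow> ncps_nth f w = 0"
  shows "l1_bound (ncps_scale x f) (enn2real (abs_value n f (\<lambda>i. ennreal (x i))))"
  unfolding l1_bound_def
proof (intro allI impI)
  fix W :: "nat list set" assume W: "finite W"
  let ?v = "abs_value n f (\<lambda>i. ennreal (x i))"
  let ?F = "W \<inter> lists {1..n}"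
  have "(\<Sum>w\<in>W. \<bar>ncps_nth (ncps_scale x f) w\<bar>) = (\<Sum>w\<in>?F. \<bar>ncps_nth (ncps_scale x f) w\<bar>)"
    using W assms(3) by (intro sum.mono_neutral_right) (auto simp del: in_lists_conv_set)
  moreover have "ennreal (\<Sum>w\<in>?F. \<bar>ncps_nth (ncps_scale x f) w\<bar>) \<le> ?v"
    unfolding abs_value_eq_SUP using W
    by (subst abs_value_finite_sum[OF _ assms(2), symmetric]) (auto intro!: SUP_upper)
  then have "enn2real (ennreal (\<Sum>w\<in>?F. \<bar>ncps_nth (ncps_scale x f) w\<bar>)) \<le> enn2real ?v"
    using assms(1) by (intro enn2real_mono) (auto simp: less_top)
  ultimately show "(\<Sum>w\<in>W. \<bar>ncps_nth (ncps_scale x f) w\<bar>) \<le> enn2real ?v"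
    by (simp add: sum_nonneg)
qed

lemma l1_bound_resolvent:
  assumes "regular n l x"
  shows "l1_bound (ncps_scale x (resolvent_fn l (ncps_exp_prod n))) (norm (resolvent_fn l (ell1_exp n x)))"
  using l1_bound_norm[of "resolvent_fn l (ell1_exp n x)"] by (simp add: series_resolvent_fn[OF assms])

text \<open>The signs of the logarithm's coefficients are fixed before integrating; the signed sum
  of resolvent coefficients is then at most \<open>K\<close> for every \<open>l\<close>.\<close>

lemma l1_bound_log:
  assumes "\<And>l. l \<in> {0..1} \<Longrightarrow> l1_bound (ncps_scale x (resolvent_fn l (ncps_exp_prod n))) K"
  shows "l1_bound (ncps_scale x (ncps_log (ncps_exp_prod n))) K"
  unfolding l1_bound_def
proof (intro allI impI)
  fix W :: "nat list set" assume W: "finite W"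
  let ?a = "\<lambda>w. ncps_nth (ncps_log (ncps_exp_prod n)) w * prod_list (map x w)"
  have "((\<lambda>l. \<Sum>w\<in>W. sgn (?a w) * (res_coeff n l w * prod_list (map x w))) has_integral (\<Sum>w\<in>W. sgn (?a w) * ?a w)) {0..1}"
    by (intro has_integral_sum W has_integral_mult_right has_integral_mult_left ncps_log_has_integral) simp
  moreover have "((\<lambda>l. K) has_integral K) {0..1::real}"
    using has_integral_const_real[of K 0 1] by simp
  moreover have "(\<Sum>w\<in>W. sgn (?a w) * (res_coeff n l w * prod_list (map x w))) \<le> K" if "l \<in> {0..1}" for l
  proof -
    have "sgn a * b \<le> \<bar>b\<bar>" for a b :: real by (auto simp: sgn_if abs_if)
    then have "(\<Sum>w\<in>W. sgn (?a w) * (res_coeff n l w * prod_list (map x w))) \<le> (\<Sum>w\<in>W. \<bar>res_coeff n l w * prod_list (map x w)\<bar>)"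
      by (intro sum_mono)
    also have "\<dots> \<le> K" using assms[OF that] W unfolding l1_bound_def by simp
    finally show ?thesis .
  qed
  ultimately have "(\<Sum>w\<in>W. sgn (?a w) * ?a w) \<le> K" by (rule has_integral_le)
  then show "(\<Sum>w\<in>W. \<bar>ncps_nth (ncps_scale x (ncps_log (ncps_exp_prod n))) w\<bar>) \<le> K"
    by (simp add: abs_sgn mult.commute)
qed

lemma resolvent_uniform_bound:
  assumes "\<And>l. l \<in> {0..1} \<Longrightarrow> regular n l x"
  shows "\<exists>K. \<forall>l\<in>{0..1}. l1_bound (ncps_scale x (resolvent_fn l (ncps_exp_prod n))) K"
proof -
  obtain K where K: "\<forall>l\<in>{0..1}. norm (resolvent_fn l (ell1_exp n x)) \<le> K"
    using resolvent_lipschitz[OF assms] by blast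
  have "l1_bound (ncps_scale x (resolvent_fn l (ncps_exp_prod n))) K" if "l \<in> {0..1}" for l
    using l1_bound_resolvent[OF assms[OF that]] bspec[OF K that] unfolding l1_bound_def by (meson order_trans)
  then show ?thesis by blast
qed

text \<open>\<open>C_const n\<close> is identified with the least sum over singular pairs: there the
  logarithm diverges, and below it the bound uniform in \<open>l\<close> passes to the
  logarithm.\<close>

lemma C_const_properties:
  assumes "2 \<le> n"
  shows "\<exists>x. (\<forall>i. 0 \<le> x i) \<and> (\<Sum>i = 1..n. x i) = C_const n \<and>
      (\<forall>B. \<not> l1_bound (ncps_scale x (ncps_log (ncps_exp_prod n))) B)"
    and "\<And>y l. (\<And>i. i \<in> {1..n} \<Longrightarrow> 0 \<le> y i) \<Longrightarrow> (\<Sum>i = 1..n. y i) < C_const n \<Longrightarrow> l \<in> {0..1} \<Longrightarrow> regular n l y"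
proof -
  obtain l x where x: "singular n l x"
    "\<And>m y. singular n m y \<Longrightarrow> (\<Sum>i = 1..n. x i) \<le> (\<Sum>i = 1..n. y i)"
    "\<And>B. \<not> l1_bound (ncps_scale x (ncps_log (ncps_exp_prod n))) B"
    using singular_minimal_log[OF assms] by blast
  have nonneg: "0 \<le> x i" for i using x(1) by (simp add: singular_def)
  have reg: "regular n m y" if y: "\<And>i. i \<in> {1..n} \<Longrightarrow> 0 \<le> y i" and less: "(\<Sum>i = 1..n. y i) < (\<Sum>i = 1..n. x i)"
    and m: "m \<in> {0..1}" for m y
  proof (rule ccontr)
    \<comment> \<open>\<open>singular\<close> demands nonnegativity at every index, while
      \<open>y\<close> is controlled only on \<open>{1..n}\<close>.\<close>
    let ?y = "\<lambda>i. if i \<in> {1..n} then y i else 0"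
    have "ell1_exp n ?y = ell1_exp n y" by (rule ell1_exp_cong) simp
    moreover assume "\<not> ?thesis"
    ultimately have "singular n m ?y" using y m by (simp add: singular_def)
    from x(2)[OF this] less show False by simp
  qed
  have "C_const n = (\<Sum>i = 1..n. x i)"
    unfolding C_const_def
  proof (rule Least_equality)
    have "Gamma_log n (\<lambda>i. ennreal (x i)) = \<infinity>"
      using l1_bound_of_abs_value[of n "ncps_log (ncps_exp_prod n)" x] x(3) nonneg ncps_log_support
      unfolding Gamma_log_def by blast
    then show "\<exists>y :: nat \<Rightarrow> real. (\<forall>i\<in>{1..n}. 0 \<le> y i) \<and> Gamma_log n (\<lambda>i. ennreal (y i)) = \<infinity> \<and>
        (\<Sum>i = 1..n. x i) = (\<Sum>i = 1..n. y i)"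
      using nonneg by blast
  next
    fix c assume "\<exists>y :: nat \<Rightarrow> real. (\<forall>i\<in>{1..n}. 0 \<le> y i) \<and> Gamma_log n (\<lambda>i. ennreal (y i)) = \<infinity> \<and>
        c = (\<Sum>i = 1..n. y i)"
    then obtain y where y: "\<And>i. i \<in> {1..n} \<Longrightarrow> 0 \<le> y i" "Gamma_log n (\<lambda>i. ennreal (y i)) = \<infinity>"
      "c = (\<Sum>i = 1..n. y i)" by blast
    show "(\<Sum>i = 1..n. x i) \<le> c"
    proof (rule ccontr)
      assume "\<not> ?thesis"
      then have "\<And>m. m \<in> {0..1} \<Longrightarrow> regular n m y" using reg[OF y(1)] y(3) by simp
      then obtain K where K: "\<forall>m\<in>{0..1}. l1_bound (ncps_scale y (resolvent_fn m (ncps_exp_prod n))) K"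
        using resolvent_uniform_bound by blast
      have "l1_bound (ncps_scale y (ncps_log (ncps_exp_prod n))) K" by (rule l1_bound_log) (rule bspec[OF K])
      then have "Gamma_log n (\<lambda>i. ennreal (y i)) \<le> ennreal K"
        unfolding Gamma_log_def using y(1) by (rule abs_value_le)
      then show False using y(2) by (simp add: top_unique)
    qed
  qed
  then show "\<exists>x. (\<forall>i. 0 \<le> x i) \<and> (\<Sum>i = 1..n. x i) = C_const n \<and>
      (\<forall>B. \<not> l1_bound (ncps_scale x (ncps_log (ncps_exp_prod n))) B)"
    and "\<And>y l. (\<And>i. i \<in> {1..n} \<Longrightarrow> 0 \<le> y i) \<Longrightarrow> (\<Sum>i = 1..n. y i) < C_const n \<Longrightarrow> l \<in> {0..1} \<Longrightarrow> regular n l y"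
    using nonneg x(3) reg by auto
qed


section \<open>Ordered integrals of block densities\<close>

text \<open>A block \<open>X\<^sub>i\<close> repeated \<open>j\<close> times contributes the volume \<open>1 / fact j\<close> of a simplex.\<close>

fun block_sum :: "nat \<Rightarrow> (nat \<Rightarrow> 'b) \<Rightarrow> nat \<Rightarrow> ('b list \<Rightarrow> 'a) \<Rightarrow> 'a::real_vector"
  where
    "block_sum 0 X k F = (if k = 0 then F [] else 0)"
  | "block_sum (Suc i) X k F =
       (\<Sum>j\<le>k. (1 / fact j) *\<^sub>R block_sum i X (k - j) (\<lambda>Ys. F (Ys @ replicate j (X (Suc i)))))"

lemma block_sum_0 [simp]: "block_sum n X 0 F = F []"
  by (induction n arbitrary: F) simp_all

lemma block_sum_cong: "(\<And>Ys. length Ys = k \<Longrightarrow> F Ys = G Ys) \<Longrightarrow> block_sum n X k F = block_sum n X k G"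
proof (induction n arbitrary: k F G)
  case (Suc n)
  show ?case
    unfolding block_sum.simps
    by (intro sum.cong refl arg_cong2[where f = scaleR] Suc.IH) (auto intro!: Suc.prems)
qed simp

lemma block_sum_add: "block_sum n X k (\<lambda>Ys. F Ys + G Ys) = block_sum n X k F + block_sum n X k G"
  by (induction n arbitrary: k F G) (simp_all add: scaleR_right_distrib sum.distrib)

lemma block_sum_scaleR: "block_sum n X k (\<lambda>Ys. r *\<^sub>R F Ys) = r *\<^sub>R block_sum n X k F"
  by (induction n arbitrary: k F) (simp_all add: scaleR_sum_right mult.commute)

lemma block_sum_zero: "block_sum n X k (\<lambda>_. 0) = 0"
  using block_sum_scaleR[of n X k 0 "\<lambda>_. 0"] by simp

lemma block_sum_sum: "block_sum n X k (\<lambda>Ys. \<Sum>i\<in>A. F i Ys) = (\<Sum>i\<in>A. block_sum n X k (F i))"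
  by (induction A rule: infinite_finite_induct) (simp_all add: block_sum_zero block_sum_add)

lemma block_sum_mult_right:
  fixes F :: "'b list \<Rightarrow> 'a::real_algebra_1"
  shows "block_sum n X k (\<lambda>Ys. F Ys * c) = block_sum n X k F * c"
  by (induction n arbitrary: k F) (simp_all add: sum_distrib_right)

lemma block_sum_has_integral:
  fixes F :: "real \<Rightarrow> 'b list \<Rightarrow> 'a::real_normed_vector"
  assumes "\<And>Ys. ((\<lambda>l. F l Ys) has_integral G Ys) A"
  shows "((\<lambda>l. block_sum n X k (F l)) has_integral block_sum n X k G) A"
  using assms
proof (induction n arbitrary: k F G)
  case (Suc n)
  show ?case
    unfolding block_sum.simps
    by (intro has_integral_sum has_integral_cmul Suc.IH Suc.prems) simp
qed auto

section \<open>Iterated integrals over concatenated blocks\<close>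

lemma has_integral_monomial:
  fixes c :: "'a::banach"
  assumes "0 \<le> u"
  shows "((\<lambda>t. ((t - a) ^ j / fact j) *\<^sub>R c) has_integral (u ^ Suc j / fact (Suc j)) *\<^sub>R c) {a..a + u}"
proof -
  have "((\<lambda>t. (t - a) ^ Suc j / fact (Suc j)) has_real_derivative (t - a) ^ j / fact j) (at t within {a..a + u})" for t
  proof -
    have "((\<lambda>t. (t - a) ^ Suc j / fact (Suc j)) has_real_derivative (real (Suc j) * (t - a) ^ j * 1) / fact (Suc j))
        (at t within {a..a + u})"
      by (rule derivative_eq_intros refl | simp)+
    moreover have "(real (Suc j) * (t - a) ^ j * 1) / fact (Suc j) = (t - a) ^ j / fact j"
      by (simp add: fact_Suc del: of_nat_Suc)
    ultimately show ?thesis by (simp only:)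
  qed
  then have "((\<lambda>t. (t - a) ^ j / fact j) has_integral ((a + u - a) ^ Suc j / fact (Suc j) - (a - a) ^ Suc j / fact (Suc j))) {a..a + u}"
    using assms by (intro fundamental_theorem_of_calculus) (auto simp flip: has_real_derivative_iff_has_vector_derivative)
  then show ?thesis
    by (intro has_integral_scaleR_left) simp
qed

lemma block_sum_Suc_split:
  "(\<Sum>j\<le>Suc k. (u ^ j / fact j) *\<^sub>R block_sum m X (Suc k - j) (\<lambda>Ys. F (Ys @ replicate j y))) =
    block_sum m X (Suc k) F + (\<Sum>j\<le>k. (u ^ Suc j / fact (Suc j)) *\<^sub>R
      block_sum m X (k - j) (\<lambda>Ys. F (Ys @ replicate j y @ [y])))"
  by (subst sum.atMost_Suc_shift) (simp add: replicate_append_same)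

context
  fixes n :: nat and X :: "nat \<Rightarrow> 'b::real_vector" and k :: nat
  assumes IH: "\<And>(F :: 'b list \<Rightarrow> 'a::banach) m u. m < n \<Longrightarrow> 0 \<le> u \<Longrightarrow> u < 1 \<Longrightarrow>
    ordered_integral {0..real m + u} k (\<lambda>ts. F (map (concat_density n X) ts)) =
    (\<Sum>j\<le>k. (u ^ j / fact j) *\<^sub>R block_sum m X (k - j) (\<lambda>Ys. F (Ys @ replicate j (X (Suc m)))))"
begin

text \<open>On this block the outermost entry is constantly \<open>X (Suc m)\<close>, so the
  integrand is a polynomial in the distance from \<open>m\<close>, and integration raises each power
  by one.\<close>

lemma ordered_integrand_block:
  fixes F :: "'b list \<Rightarrow> 'a"
  assumes "m < n" "0 \<le> u" "u \<le> 1"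
  shows "((\<lambda>t. ordered_integral {0..t} k (\<lambda>ts. F (map (concat_density n X) (ts @ [t])))) has_integral
    (\<Sum>j\<le>k. (u ^ Suc j / fact (Suc j)) *\<^sub>R block_sum m X (k - j) (\<lambda>Ys. F (Ys @ replicate j (X (Suc m)) @ [X (Suc m)]))))
    {real m..real m + u}"
\<comment> \<open>The right endpoint is left out: for \<open>u = 1\<close> the density has already
  jumped there.\<close>
proof (rule has_integral_spike_finite[of "{real m + u}"])
  show "((\<lambda>t. \<Sum>j\<le>k. ((t - real m) ^ j / fact j) *\<^sub>R
      block_sum m X (k - j) (\<lambda>Ys. F (Ys @ replicate j (X (Suc m)) @ [X (Suc m)]))) has_integral
    (\<Sum>j\<le>k. (u ^ Suc j / fact (Suc j)) *\<^sub>R block_sum m X (k - j) (\<lambda>Ys. F (Ys @ replicate j (X (Suc m)) @ [X (Suc m)]))))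
    {real m..real m + u}"
    by (intro has_integral_sum has_integral_monomial assms) simp
  fix t assume t: "t \<in> {real m..real m + u} - {real m + u}"
  have "concat_density n X t = X (Suc m)"
    using t assms by (intro concat_density_eq) auto
  then show "ordered_integral {0..t} k (\<lambda>ts. F (map (concat_density n X) (ts @ [t]))) =
      (\<Sum>j\<le>k. ((t - real m) ^ j / fact j) *\<^sub>R
        block_sum m X (k - j) (\<lambda>Ys. F (Ys @ replicate j (X (Suc m)) @ [X (Suc m)])))"
    using IH[of m "t - real m" "\<lambda>Ys. F (Ys @ [X (Suc m)])"] t assms by simp
qed simp

lemma ordered_integrand_total:
  fixes F :: "'b list \<Rightarrow> 'a"
  assumes "m \<le> n"
  shows "((\<lambda>t. ordered_integral {0..t} k (\<lambda>ts. F (map (concat_density n X) (ts @ [t])))) has_integral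
    block_sum m X (Suc k) F) {0..real m}"
  using assms
proof (induction m)
  case 0
  show ?case unfolding block_sum.simps of_nat_0 by (simp add: has_integral_refl)
next
  case (Suc m)
  have "((\<lambda>t. ordered_integral {0..t} k (\<lambda>ts. F (map (concat_density n X) (ts @ [t])))) has_integral
    block_sum m X (Suc k) F + (\<Sum>j\<le>k. (1 ^ Suc j / fact (Suc j)) *\<^sub>R
      block_sum m X (k - j) (\<lambda>Ys. F (Ys @ replicate j (X (Suc m)) @ [X (Suc m)])))) {0..real m + 1}"
    using Suc by (intro has_integral_combine[of 0 "real m"] ordered_integrand_block) auto
  moreover have "block_sum m X (Suc k) F + (\<Sum>j\<le>k. (1 ^ Suc j / fact (Suc j)) *\<^sub>R
      block_sum m X (k - j) (\<lambda>Ys. F (Ys @ replicate j (X (Suc m)) @ [X (Suc m)]))) = block_sum (Suc m) X (Suc k) F"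
    unfolding block_sum_Suc_split[symmetric] by simp
  ultimately show ?case by (simp add: add.commute)
qed

end

text \<open>Stated for an endpoint inside a block, because the inner integrals of the recursion stop
  at an arbitrary time. The full blocks passed and the current partial one are integrated
  separately.\<close>

lemma ordered_integral_block:
  fixes F :: "'b::real_vector list \<Rightarrow> 'a::banach"
  assumes "m < n" "0 \<le> u" "u < 1"
  shows "ordered_integral {0..real m + u} k (\<lambda>ts. F (map (concat_density n X) ts)) =
    (\<Sum>j\<le>k. (u ^ j / fact j) *\<^sub>R block_sum m X (k - j) (\<lambda>Ys. F (Ys @ replicate j (X (Suc m)))))"
  using assms
proof (induction k arbitrary: F m u)
  case 0
  then show ?case by simp
next
  case (Suc k)
  let ?g = "\<lambda>t. ordered_integral {0..t} k (\<lambda>ts. F (map (concat_density n X) (ts @ [t])))"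
  have "(?g has_integral block_sum m X (Suc k) F + (\<Sum>j\<le>k. (u ^ Suc j / fact (Suc j)) *\<^sub>R
      block_sum m X (k - j) (\<lambda>Ys. F (Ys @ replicate j (X (Suc m)) @ [X (Suc m)])))) {0..real m + u}"
    by (rule has_integral_combine[OF _ _ ordered_integrand_total[OF Suc.IH] ordered_integrand_block[OF Suc.IH]])
      (use Suc.prems in auto)
  then have "integral {0..real m + u} ?g = block_sum m X (Suc k) F + (\<Sum>j\<le>k. (u ^ Suc j / fact (Suc j)) *\<^sub>R
      block_sum m X (k - j) (\<lambda>Ys. F (Ys @ replicate j (X (Suc m)) @ [X (Suc m)])))"
    by (rule integral_unique)
  moreover have "ordered_integral {0..real m + u} (Suc k) (\<lambda>ts. F (map (concat_density n X) ts)) =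
      integral {0..real m + u} ?g"
    unfolding ordered_integral.simps
  proof (rule integral_cong)
    fix t assume "t \<in> {0..real m + u}"
    then have *: "{0..real m + u} \<inter> {..t} = {0..t}" by auto
    show "ordered_integral ({0..real m + u} \<inter> {..t}) k (\<lambda>ts. F (map (concat_density n X) (ts @ [t]))) = ?g t"
      by (simp only: *)
  qed
  ultimately show ?case by (simp only: block_sum_Suc_split)
qed

lemma ordered_integral_concat_density:
  fixes F :: "'b::real_vector list \<Rightarrow> 'a::banach"
  shows "ordered_integral {0..<real n} k (\<lambda>ts. F (map (concat_density n X) ts)) = block_sum n X k F"
proof (cases k)
  case (Suc k)
  let ?g = "\<lambda>t. ordered_integral {0..t} k (\<lambda>ts. F (map (concat_density n X) (ts @ [t])))"
  have "ordered_integral {0..<real n} (Suc k) (\<lambda>ts. F (map (concat_density n X) ts)) = integral {0..<real n} ?g"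
    unfolding ordered_integral.simps
  proof (rule integral_cong)
    fix t assume "t \<in> {0..<real n}"
    then have *: "{0..<real n} \<inter> {..t} = {0..t}" by auto
    show "ordered_integral ({0..<real n} \<inter> {..t}) k (\<lambda>ts. F (map (concat_density n X) (ts @ [t]))) = ?g t"
      by (simp only: *)
  qed
  also have "\<dots> = integral {0..real n} ?g"
  proof (rule integral_spike_set)
    show "negligible {t \<in> {0..<real n} - {0..real n}. ?g t \<noteq> 0}"
      by (rule negligible_subset[of "{}"]) auto
    show "negligible {t \<in> {0..real n} - {0..<real n}. ?g t \<noteq> 0}"
      by (rule negligible_subset[of "{real n}"]) auto
  qed
  also have "\<dots> = block_sum n X (Suc k) F"
    by (rule integral_unique, rule ordered_integrand_total) (auto intro: ordered_integral_block)
  finally show ?thesis by (simp add: Suc)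
qed simp


section \<open>Shuffle products\<close>

text \<open>All ways of dealing out the entries, in order, to \<open>f\<close> and \<open>g\<close>:
  the integrand whose ordered integral is the product of the ordered integrals of \<open>f\<close>
  and \<open>g\<close>.\<close>

definition shuffle_prod :: "('b list \<Rightarrow> 'a) \<Rightarrow> ('b list \<Rightarrow> 'a) \<Rightarrow> 'b list \<Rightarrow> 'a::semiring_1"
  where "shuffle_prod f g Ys = (\<Sum>S\<in>Pow {..<length Ys}. f (nths Ys S) * g (nths Ys (- S)))"

lemma nths_eq_map: "nths xs S = map ((!) xs) (filter (\<lambda>i. i \<in> S) [0..<length xs])"
proof -
  have "zip xs [0..<length xs] = map (\<lambda>i. (xs ! i, i)) [0..<length xs]"
    by (rule nth_equalityI) auto
  then show ?thesis by (simp add: nths_def filter_map o_def)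
qed

lemma nths_cong: "(\<And>i. i < length xs \<Longrightarrow> i \<in> S \<longleftrightarrow> i \<in> T) \<Longrightarrow> nths xs S = nths xs T"
  unfolding nths_eq_map by (intro arg_cong[where f = "map _"] filter_cong) auto

lemma shuffle_prod_snoc:
  "shuffle_prod f g (Ys @ [y]) = shuffle_prod (\<lambda>Zs. f (Zs @ [y])) g Ys + shuffle_prod f (\<lambda>Zs. g (Zs @ [y])) Ys"
proof -
  let ?k = "length Ys"
  let ?h = "\<lambda>S. f (nths (Ys @ [y]) S) * g (nths (Ys @ [y]) (- S))"
  have 1: "?h S = f (nths Ys S) * g (nths Ys (- S) @ [y])" if "S \<in> Pow {..<?k}" for S
    using that by (auto simp: nths_append)
  have 2: "?h (insert ?k S) = f (nths Ys S @ [y]) * g (nths Ys (- S))" if "S \<in> Pow {..<?k}" for S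
    using that nths_cong[of Ys "insert ?k S" S] nths_cong[of Ys "- insert ?k S" "- S"]
    by (auto simp: nths_append)
  have "shuffle_prod f g (Ys @ [y]) = (\<Sum>S\<in>Pow (insert ?k {..<?k}). ?h S)"
    by (simp add: shuffle_prod_def lessThan_Suc)
  also have "\<dots> = (\<Sum>S\<in>Pow {..<?k}. ?h S) + (\<Sum>S\<in>insert ?k ` Pow {..<?k}. ?h S)"
    unfolding Pow_insert by (rule sum.union_disjoint) auto
  also have "(\<Sum>S\<in>insert ?k ` Pow {..<?k}. ?h S) = (\<Sum>S\<in>Pow {..<?k}. ?h (insert ?k S))"
  proof (subst sum.reindex)
    show "inj_on (insert ?k) (Pow {..<?k})"
      by (rule inj_onI) (metis Diff_insert_absorb PowD lessThan_iff less_irrefl subsetD)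
  qed simp
  finally show ?thesis
    using 1 2 by (simp add: shuffle_prod_def add.commute)
qed

lemma shuffle_prod_replicate:
  fixes f g :: "'b list \<Rightarrow> 'a::real_algebra_1"
  shows "shuffle_prod f g (Ys @ replicate j y) = (\<Sum>a\<le>j. real (j choose a) *\<^sub>R
    shuffle_prod (\<lambda>Zs. f (Zs @ replicate a y)) (\<lambda>Zs. g (Zs @ replicate (j - a) y)) Ys)"
proof (induction j arbitrary: f g)
  case (Suc j)
  let ?T = "\<lambda>a b. shuffle_prod (\<lambda>Zs. f (Zs @ replicate a y)) (\<lambda>Zs. g (Zs @ replicate b y)) Ys"
  have rep: "replicate a y @ [y] = replicate (Suc a) y" for a by (simp add: replicate_append_same)
  have "shuffle_prod f g (Ys @ replicate (Suc j) y) = shuffle_prod f g ((Ys @ replicate j y) @ [y])"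
    by (simp add: replicate_append_same)
  also have "\<dots> = (\<Sum>a\<le>j. real (j choose a) *\<^sub>R ?T (Suc a) (j - a)) + (\<Sum>a\<le>j. real (j choose a) *\<^sub>R ?T a (Suc (j - a)))"
    by (subst shuffle_prod_snoc) (simp only: Suc.IH append_assoc rep)
  also have "(\<Sum>a\<le>j. real (j choose a) *\<^sub>R ?T a (Suc (j - a))) = (\<Sum>a\<le>Suc j. real (j choose a) *\<^sub>R ?T a (Suc j - a))"
    by (simp add: Suc_diff_le)
  also have "\<dots> = ?T 0 (Suc j) + (\<Sum>a\<le>j. real (j choose Suc a) *\<^sub>R ?T (Suc a) (j - a))"
    by (subst sum.atMost_Suc_shift) simp
  also have "(\<Sum>a\<le>j. real (j choose a) *\<^sub>R ?T (Suc a) (j - a)) + \<dots> =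
      ?T 0 (Suc j) + (\<Sum>a\<le>j. real (Suc j choose Suc a) *\<^sub>R ?T (Suc a) (j - a))"
    by (simp add: sum.distrib scaleR_left_distrib)
  also have "\<dots> = (\<Sum>a\<le>Suc j. real (Suc j choose a) *\<^sub>R ?T a (Suc j - a))"
    by (subst sum.atMost_Suc_shift) simp
  finally show ?case .
qed simp

text \<open>Shuffling a repeated entry produces binomial coefficients, and dividing
  \<open>j choose a\<close> by \<open>fact j\<close> leaves
  \<open>1 / (fact a * fact (j - a))\<close>, which separates the two factors.\<close>

lemma block_sum_shuffle:
  fixes f g :: "'b list \<Rightarrow> 'a::real_algebra_1"
  shows "block_sum n X k (shuffle_prod f g) = (\<Sum>i\<le>k. block_sum n X i f * block_sum n X (k - i) g)"
proof (induction n arbitrary: k f g)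
  case 0
  show ?case by (cases k) (auto simp: shuffle_prod_def intro!: sum.neutral)
next
  case (Suc n)
  let ?y = "X (Suc n)"
  let ?f = "\<lambda>a Zs. f (Zs @ replicate a ?y)" and ?g = "\<lambda>a Zs. g (Zs @ replicate a ?y)"
  let ?B = "block_sum n X"
  let ?t = "\<lambda>a c b d. (1 / (fact a * fact c)) *\<^sub>R (?B b (?f a) * ?B d (?g c))"
  have "block_sum (Suc n) X k (shuffle_prod f g) =
      (\<Sum>j\<le>k. \<Sum>a\<le>j. (1 / fact j) *\<^sub>R real (j choose a) *\<^sub>R (\<Sum>b\<le>k - j. ?B b (?f a) * ?B (k - j - b) (?g (j - a))))"
    by (simp add: shuffle_prod_replicate block_sum_sum block_sum_scaleR Suc.IH scaleR_sum_right)
  also have "\<dots> = (\<Sum>j\<le>k. \<Sum>a\<le>j. \<Sum>b\<le>k - j. ?t a (j - a) b (k - j - b))"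
    by (intro sum.cong refl) (simp add: scaleR_sum_right binomial_fact)
  also have "\<dots> = (\<Sum>(j, a, b)\<in>(SIGMA j:{..k}. {..j} \<times> {..k - j}). ?t a (j - a) b (k - j - b))"
    by (simp add: sum.Sigma sum.cartesian_product)
  \<comment> \<open>\<open>i = a + b\<close> counts all entries dealt to \<open>f\<close>, and
    \<open>c = j - a\<close> those of the last block dealt to \<open>g\<close>.\<close>
  also have "\<dots> = (\<Sum>(i, a, c)\<in>(SIGMA i:{..k}. {..i} \<times> {..k - i}). ?t a c (i - a) (k - i - c))"
    by (rule sum.reindex_bij_witness[of _ "\<lambda>(i, a, c). (a + c, a, i - a)" "\<lambda>(j, a, b). (a + b, a, j - a)"])
      (auto simp: add.commute)
  also have "\<dots> = (\<Sum>i\<le>k. \<Sum>a\<le>i. \<Sum>c\<le>k - i. ?t a c (i - a) (k - i - c))"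
    by (simp add: sum.Sigma sum.cartesian_product)
  also have "\<dots> = (\<Sum>i\<le>k. block_sum (Suc n) X i f * block_sum (Suc n) X (k - i) g)"
    by (simp add: sum_product mult.commute)
  finally show ?case .
qed


section \<open>The Magnus terms\<close>

text \<open>The weight of a permutation read off from its one-line notation, so that it also makes
  sense for prefixes and for other sets of indices.\<close>

fun ascent_weight :: "real \<Rightarrow> nat list \<Rightarrow> real"
  where
    "ascent_weight l (x # y # zs) = (if x < y then l else l - 1) * ascent_weight l (y # zs)"
  | "ascent_weight l zs = 1"

lemma ascent_weight_eq:
  assumes "distinct xs"
  shows "ascent_weight l xs = l ^ card {i. Suc i < length xs \<and> xs ! i < xs ! Suc i} *
    (l - 1) ^ card {i. Suc i < length xs \<and> xs ! i > xs ! Suc i}"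
  using assms
proof (induction l xs rule: ascent_weight.induct)
  case (1 l x y zs)
  let ?S = "\<lambda>P xs. {i. Suc i < length xs \<and> P (xs ! i) (xs ! Suc i)}"
  have S: "?S P (x # y # zs) = (if P x y then {0} else {}) \<union> Suc ` ?S P (y # zs)" for P :: "nat \<Rightarrow> nat \<Rightarrow> bool"
  proof (rule Set.set_eqI)
    fix i show "i \<in> ?S P (x # y # zs) \<longleftrightarrow> i \<in> (if P x y then {0} else {}) \<union> Suc ` ?S P (y # zs)"
      by (cases i) auto
  qed
  have fin: "finite (?S P (y # zs))" for P by (rule finite_subset[of _ "{..<length (y # zs)}"]) auto
  have c: "card (?S P (x # y # zs)) = (if P x y then 1 else 0) + card (?S P (y # zs))" for P
    unfolding S by (subst card_Un_disjoint) (auto simp: fin card_image)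
  have "x < y \<or> y < x" using 1(2) by auto
  then show ?case using 1 c[of "(<)"] c[of "(>)"] by auto
qed (auto simp: less_Suc_eq)

text \<open>Only the relative order of positions matters. Arbitrary increasing index lists are
  allowed because a shuffle feeds \<open>mu_res\<close> with entries from arbitrary
  positions.\<close>

lemma mu_res_permutations:
  assumes "sorted_wrt (<) s"
  shows "mu_res l (map y s) = (\<Sum>xs\<in>permutations_of_set (set s). ascent_weight l xs *\<^sub>R prod_list (map y xs))"
proof -
  have s: "sorted s" "distinct s" using assms by (simp_all add: strict_sorted_iff)
  have bij: "bij_betw (\<lambda>\<sigma>. permute_list \<sigma> s) {\<sigma>. \<sigma> permutes {..<length s}} (permutations_of_set (set s))"
    unfolding bij_betw_def
  proof (intro conjI Set.set_eqI iffI)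
    show "inj_on (\<lambda>\<sigma>. permute_list \<sigma> s) {\<sigma>. \<sigma> permutes {..<length s}}"
    proof (rule inj_onI, rule ext)
      fix \<sigma> \<tau> i assume *: "\<sigma> \<in> {\<sigma>. \<sigma> permutes {..<length s}}" "\<tau> \<in> {\<sigma>. \<sigma> permutes {..<length s}}"
        "permute_list \<sigma> s = permute_list \<tau> s"
      show "\<sigma> i = \<tau> i"
      proof (cases "i < length s")
        case True
        have "s ! \<sigma> i = s ! \<tau> i"
          using * True by (metis mem_Collect_eq permute_list_nth)
        moreover have "\<sigma> i < length s" "\<tau> i < length s"
          using * True by (metis lessThan_iff mem_Collect_eq permutes_in_image)+
        ultimately show ?thesis using s(2) by (simp add: nth_eq_iff_index_eq)
      next
        case False
        then show ?thesis using * by (simp add: permutes_def)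
      qed
    qed
  next
    fix xs assume "xs \<in> (\<lambda>\<sigma>. permute_list \<sigma> s) ` {\<sigma>. \<sigma> permutes {..<length s}}"
    then show "xs \<in> permutations_of_set (set s)" using s by auto
  next
    fix xs assume "xs \<in> permutations_of_set (set s)"
    then have "mset xs = mset s"
      using s by (metis mset_set_set permutations_of_setD(1) permutations_of_setD(2))
    then obtain p where "p permutes {..<length s}" "permute_list p s = xs"
      by (rule mset_eq_permutation)
    then show "xs \<in> (\<lambda>\<sigma>. permute_list \<sigma> s) ` {\<sigma>. \<sigma> permutes {..<length s}}" by blast
  qed
  have "(\<Sum>\<sigma> | \<sigma> permutes {..<length s}. (l ^ asc (length s) \<sigma> * (l - 1) ^ des (length s) \<sigma>) *\<^sub>R
      prod_list (map (\<lambda>i. map y s ! \<sigma> i) [0..<length s])) =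
    (\<Sum>\<sigma> | \<sigma> permutes {..<length s}. ascent_weight l (permute_list \<sigma> s) *\<^sub>R prod_list (map y (permute_list \<sigma> s)))"
  proof (rule sum.cong[OF refl])
    fix \<sigma> assume "\<sigma> \<in> {\<sigma>. \<sigma> permutes {..<length s}}"
    then have \<sigma>: "\<sigma> permutes {..<length s}" by simp
    have lt: "\<sigma> i < length s" if "i < length s" for i
      using that permutes_in_image[OF \<sigma>, of i] by simp
    have less: "s ! i < s ! j \<longleftrightarrow> i < j" if "i < length s" "j < length s" for i j
      using that assms by (metis linorder_neqE_nat not_less_iff_gr_or_eq sorted_wrt_nth_less)
    have "ascent_weight l (permute_list \<sigma> s) = l ^ asc (length s) \<sigma> * (l - 1) ^ des (length s) \<sigma>"
    proof -
      have "{i. Suc i < length s \<and> permute_list \<sigma> s ! i < permute_list \<sigma> s ! Suc i} = {i. Suc i < length s \<and> \<sigma> i < \<sigma> (Suc i)}"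
        "{i. Suc i < length s \<and> permute_list \<sigma> s ! Suc i < permute_list \<sigma> s ! i} = {i. Suc i < length s \<and> \<sigma> (Suc i) < \<sigma> i}"
        using lt less by (auto simp: permute_list_nth[OF \<sigma>])
      then show ?thesis using s \<sigma> by (subst ascent_weight_eq) (simp_all add: asc_def des_def)
    qed
    moreover have "map (\<lambda>i. map y s ! \<sigma> i) [0..<length s] = map y (permute_list \<sigma> s)"
      using lt by (auto simp: permute_list_def)
    ultimately show "(l ^ asc (length s) \<sigma> * (l - 1) ^ des (length s) \<sigma>) *\<^sub>R prod_list (map (\<lambda>i. map y s ! \<sigma> i) [0..<length s]) =
      ascent_weight l (permute_list \<sigma> s) *\<^sub>R prod_list (map y (permute_list \<sigma> s))" by simp
  qed
  also have "\<dots> = (\<Sum>xs\<in>permutations_of_set (set s). ascent_weight l xs *\<^sub>R prod_list (map y xs))"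
    by (rule sum.reindex_bij_betw[OF bij])
  finally show ?thesis by (simp add: mu_res_def Let_def)
qed

text \<open>A new first letter multiplies everything by \<open>c\<close>, and a sorted tail admits
  one more cut, adding \<open>1 - l\<close>. The sum \<open>c + (1 - l)\<close> is 1 at an ascent
  and 0 at a descent, so only sorted words survive.\<close>

lemma ascent_weight_suffix_sum:
  assumes "distinct w" "w \<noteq> []"
  shows "ascent_weight l w + (1 - l) * (\<Sum>i\<in>{i \<in> {1..<length w}. sorted (drop i w)}. ascent_weight l (take i w)) =
    (if sorted w then 1 else 0)"
  using assms
proof (induction l w rule: ascent_weight.induct)
  case (1 l x y zs)
  let ?v = "y # zs"
  define c where "c = (if x < y then l else l - 1)"
  let ?I = "\<lambda>w. {i \<in> {1..<length w}. sorted (drop i w)}"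
  have I: "?I (x # ?v) = (if sorted ?v then {1} else {}) \<union> Suc ` ?I ?v"
  proof (rule Set.set_eqI)
    fix i show "i \<in> ?I (x # ?v) \<longleftrightarrow> i \<in> (if sorted ?v then {1} else {}) \<union> Suc ` ?I ?v"
      by (cases i; cases "i - 1") (auto simp: image_iff)
  qed
  have "(\<Sum>i\<in>?I (x # ?v). ascent_weight l (take i (x # ?v))) =
      (\<Sum>i\<in>(if sorted ?v then {1} else {}). ascent_weight l (take i (x # ?v))) +
      (\<Sum>i\<in>Suc ` ?I ?v. ascent_weight l (take i (x # ?v)))"
    unfolding I by (rule sum.union_disjoint) auto
  also have "(\<Sum>i\<in>Suc ` ?I ?v. ascent_weight l (take i (x # ?v))) = (\<Sum>i\<in>?I ?v. c * ascent_weight l (take i ?v))"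
    by (subst sum.reindex) (auto simp: c_def take_Cons' intro!: sum.cong)
  finally have "ascent_weight l (x # ?v) + (1 - l) * (\<Sum>i\<in>?I (x # ?v). ascent_weight l (take i (x # ?v))) =
      c * (ascent_weight l ?v + (1 - l) * (\<Sum>i\<in>?I ?v. ascent_weight l (take i ?v))) + (if sorted ?v then 1 - l else 0)"
    by (simp add: c_def sum_distrib_left algebra_simps)
  also have "ascent_weight l ?v + (1 - l) * (\<Sum>i\<in>?I ?v. ascent_weight l (take i ?v)) = (if sorted ?v then 1 else 0)"
    using 1 by simp
  also have "c * (if sorted ?v then 1 else 0) + (if sorted ?v then 1 - l else 0) = (if sorted (x # ?v) then 1 else 0)"
    using 1(2) by (auto simp: c_def)
  finally show ?case .
qed auto

text \<open>\<open>mu_res l []\<close> and \<open>prod_list []\<close> are both 1, whereas the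
  resolvent and A - 1 have no constant term.\<close>

definition off_Nil :: "('b list \<Rightarrow> 'a) \<Rightarrow> 'b list \<Rightarrow> 'a::zero"
  where "off_Nil f Ys = (if Ys = [] then 0 else f Ys)"

text \<open>The equation A - 1 = R + (1 - l) R (A - 1) on the level of integrands. Permuted entries
  followed by the remaining ones in order are words with a marked increasing suffix, whose weights
  \<open>ascent_weight_suffix_sum\<close> adds up.\<close>

lemma mu_res_shuffle:
  "off_Nil prod_list Ys = off_Nil (mu_res l) Ys + (1 - l) *\<^sub>R shuffle_prod (off_Nil (mu_res l)) (off_Nil prod_list) Ys"
proof (cases "Ys = []")
  case True
  then show ?thesis by (simp add: off_Nil_def shuffle_prod_def)
next
  case False
  let ?k = "length Ys"
  let ?A = "{..<?k}"
  let ?s = "\<lambda>S. filter (\<lambda>i. i \<in> S) [0..<?k]"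
  let ?y = "(!) Ys"
  let ?Q = "Pow ?A - {{}, ?A}"
  have k: "0 < ?k" using False by simp
  have set_s: "set (?s S) = S \<inter> ?A" for S by auto
  have sorted_s: "sorted_wrt (<) (?s S)" for S by (rule sorted_wrt_filter) simp
  have Nil_iff: "nths Ys S = [] \<longleftrightarrow> S \<inter> ?A = {}" for S
    by (auto simp: nths_eq_map filter_empty_conv)
  have "shuffle_prod (off_Nil (mu_res l)) (off_Nil prod_list) Ys =
      (\<Sum>S\<in>?Q. off_Nil (mu_res l) (nths Ys S) * off_Nil prod_list (nths Ys (- S)))"
    unfolding shuffle_prod_def
    by (rule sum.mono_neutral_right) (auto simp: off_Nil_def Nil_iff)
  also have "\<dots> = (\<Sum>S\<in>?Q. \<Sum>xs\<in>permutations_of_set S. ascent_weight l xs *\<^sub>R prod_list (map ?y (xs @ ?s (- S))))"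
  proof (rule sum.cong[OF refl])
    fix S assume S: "S \<in> ?Q"
    then have ne: "nths Ys S \<noteq> []" "nths Ys (- S) \<noteq> []" "S \<inter> ?A = S" unfolding Nil_iff by auto
    have "mu_res l (nths Ys S) = (\<Sum>xs\<in>permutations_of_set S. ascent_weight l xs *\<^sub>R prod_list (map ?y xs))"
      unfolding nths_eq_map mu_res_permutations[OF sorted_s] set_s ne(3) ..
    then show "off_Nil (mu_res l) (nths Ys S) * off_Nil prod_list (nths Ys (- S)) =
        (\<Sum>xs\<in>permutations_of_set S. ascent_weight l xs *\<^sub>R prod_list (map ?y (xs @ ?s (- S))))"
      using ne by (simp add: off_Nil_def sum_distrib_right) (simp add: nths_eq_map)
  qed
  also have "\<dots> = (\<Sum>(S, xs)\<in>(SIGMA S:?Q. permutations_of_set S). ascent_weight l xs *\<^sub>R prod_list (map ?y (xs @ ?s (- S))))"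
    by (rule sum.Sigma) auto
  \<comment> \<open>A subset \<open>S\<close> with an arrangement \<open>xs\<close> corresponds to
    the word \<open>xs\<close> followed by the complement in increasing order, cut after
    \<open>xs\<close>.\<close>
  also have "\<dots> = (\<Sum>(w, i)\<in>(SIGMA w:permutations_of_set ?A. {i \<in> {1..<length w}. sorted (drop i w)}).
      ascent_weight l (take i w) *\<^sub>R prod_list (map ?y w))"
  proof (rule sum.reindex_bij_witness[of _ "\<lambda>(w, i). (set (take i w), take i w)" "\<lambda>(S, xs). (xs @ ?s (- S), length xs)"])
    fix p assume p: "p \<in> (SIGMA S:?Q. permutations_of_set S)"
    then obtain S xs where Sxs: "p = (S, xs)" "S \<in> ?Q" "set xs = S" "distinct xs"
      by (auto simp: permutations_of_set_def)
    show "(case case p of (S, xs) \<Rightarrow> (xs @ ?s (- S), length xs) of (w, i) \<Rightarrow> (set (take i w), take i w)) = p"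
      using Sxs by simp
    have ne: "?s (- S) \<noteq> []" "xs \<noteq> []" using Sxs(2,3) by (auto simp: filter_empty_conv)
    have "set (xs @ ?s (- S)) = ?A" using Sxs by auto
    moreover have "distinct (xs @ ?s (- S))" using Sxs by auto
    moreover have "sorted (?s (- S))" by (rule sorted_wrt_filter) simp
    ultimately show "(case p of (S, xs) \<Rightarrow> (xs @ ?s (- S), length xs)) \<in>
        (SIGMA w:permutations_of_set ?A. {i \<in> {1..<length w}. sorted (drop i w)})"
      using ne unfolding Sxs(1) by (simp add: permutations_of_set_def Suc_le_eq)
    show "(case case p of (S, xs) \<Rightarrow> (xs @ ?s (- S), length xs) of (w, i) \<Rightarrow> ascent_weight l (take i w) *\<^sub>R prod_list (map ?y w)) =
        (case p of (S, xs) \<Rightarrow> ascent_weight l xs *\<^sub>R prod_list (map ?y (xs @ ?s (- S))))"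
      by (simp add: Sxs(1))
  next
    fix p assume "p \<in> (SIGMA w:permutations_of_set ?A. {i \<in> {1..<length w}. sorted (drop i w)})"
    then obtain w i where wi: "p = (w, i)" "set w = ?A" "distinct w" "1 \<le> i" "i < length w" "sorted (drop i w)"
      by (auto simp: permutations_of_set_def)
    have w: "set (take i w) \<union> set (drop i w) = ?A" "set (take i w) \<inter> set (drop i w) = {}"
      using wi(2,3) by (metis append_take_drop_id set_append, metis append_take_drop_id distinct_append)
    have "?s (- set (take i w)) = drop i w"
    proof (rule sorted_distinct_set_unique)
      show "set (?s (- set (take i w))) = set (drop i w)" unfolding set_s using w by auto
      show "distinct (drop i w)" using wi by simp
      show "sorted (?s (- set (take i w)))" by (rule sorted_wrt_filter) simp
      show "distinct (?s (- set (take i w)))" by simp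
      show "sorted (drop i w)" by (rule wi(6))
    qed
    then show "(case case p of (w, i) \<Rightarrow> (set (take i w), take i w) of (S, xs) \<Rightarrow> (xs @ ?s (- S), length xs)) = p"
      using wi by simp
    have "set (take i w) \<noteq> {}" "set (drop i w) \<noteq> {}" unfolding set_empty using wi(4,5) by auto
    moreover have "a \<noteq> c \<and> a \<subseteq> c" if "a \<union> b = c" "a \<inter> b = {}" "b \<noteq> {}" for a b c :: "nat set"
      using that by blast
    ultimately have ne: "set (take i w) \<noteq> {}" "set (take i w) \<noteq> ?A \<and> set (take i w) \<subseteq> ?A" using w by metis+
    have "distinct (take i w)" using wi by simp
    with ne show "(case p of (w, i) \<Rightarrow> (set (take i w), take i w)) \<in> (SIGMA S:?Q. permutations_of_set S)"
      unfolding wi(1) by (simp add: permutations_of_set_def)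
  qed
  also have "\<dots> = (\<Sum>w\<in>permutations_of_set ?A. \<Sum>i\<in>{i \<in> {1..<length w}. sorted (drop i w)}.
      ascent_weight l (take i w) *\<^sub>R prod_list (map ?y w))"
    by (rule sum.Sigma[symmetric]) auto
  finally have sh: "shuffle_prod (off_Nil (mu_res l)) (off_Nil prod_list) Ys = \<dots>" .
  have Ys: "map ?y [0..<?k] = Ys" by (rule map_nth)
  have mu: "off_Nil (mu_res l) Ys = (\<Sum>w\<in>permutations_of_set ?A. ascent_weight l w *\<^sub>R prod_list (map ?y w))"
    using mu_res_permutations[of "[0..<?k]" l ?y] False by (simp add: Ys off_Nil_def lessThan_atLeast0)
  have "off_Nil (mu_res l) Ys + (1 - l) *\<^sub>R shuffle_prod (off_Nil (mu_res l)) (off_Nil prod_list) Ys =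
      (\<Sum>w\<in>permutations_of_set ?A. (ascent_weight l w + (1 - l) *
        (\<Sum>i\<in>{i \<in> {1..<length w}. sorted (drop i w)}. ascent_weight l (take i w))) *\<^sub>R prod_list (map ?y w))"
    unfolding sh mu
    by (simp only: scaleR_sum_left[symmetric] scaleR_sum_right scaleR_scaleR sum.distrib[symmetric] scaleR_left_distrib)
  also have "\<dots> = (\<Sum>w\<in>permutations_of_set ?A. (if sorted w then 1 else 0) *\<^sub>R prod_list (map ?y w))"
  proof (rule sum.cong[OF refl])
    fix w assume w: "w \<in> permutations_of_set ?A"
    have "w \<noteq> []"
    proof
      assume "w = []"
      then have "?A = {}" using permutations_of_setD(1)[OF w] by simp
      moreover have "0 \<in> ?A" using k by simp
      ultimately show False by blast
    qed
    from ascent_weight_suffix_sum[OF permutations_of_setD(2)[OF w] this]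
    show "(ascent_weight l w + (1 - l) * (\<Sum>i\<in>{i \<in> {1..<length w}. sorted (drop i w)}. ascent_weight l (take i w))) *\<^sub>R
        prod_list (map ?y w) = (if sorted w then 1 else 0) *\<^sub>R prod_list (map ?y w)"
      by (simp only:)
  qed
  also have "\<dots> = (\<Sum>w\<in>{[0..<?k]}. (if sorted w then 1 else 0) *\<^sub>R prod_list (map ?y w))"
  proof (rule sum.mono_neutral_right)
    show "\<forall>w\<in>permutations_of_set ?A - {[0..<?k]}. (if sorted w then 1 else 0) *\<^sub>R prod_list (map ?y w) = 0"
    proof
      fix w assume w: "w \<in> permutations_of_set ?A - {[0..<?k]}"
      have "\<not> sorted w"
      proof
        assume "sorted w"
        moreover have "set w = set [0..<?k]" "distinct w"
          using w permutations_of_setD[of w ?A] by (simp_all add: lessThan_atLeast0)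
        ultimately have "w = [0..<?k]" by (intro sorted_distinct_set_unique) simp_all
        with w show False by simp
      qed
      then show "(if sorted w then 1 else 0) *\<^sub>R prod_list (map ?y w) = 0" by simp
    qed
  qed (auto simp: lessThan_atLeast0)
  also have "\<dots> = off_Nil prod_list Ys" using False by (simp add: Ys off_Nil_def)
  finally show ?thesis ..
qed

section \<open>Magnus terms as homogeneous parts of the resolvent\<close>

lemma block_sum_prod_list:
  assumes "m \<le> n"
  shows "block_sum m X k prod_list = ev n X (ncps_exp_prod m) k"
  using assms
proof (induction m arbitrary: k)
  case 0
  show ?case by (simp add: ev_simps)
next
  case (Suc m)
  have "block_sum (Suc m) X k prod_list = (\<Sum>j\<le>k. ev n X (ncps_exp_prod m) (k - j) * ((1 / fact j) *\<^sub>R X (Suc m) ^ j))"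
    using Suc by (simp add: block_sum_mult_right prod_list_replicate)
  also have "\<dots> = (\<Sum>j\<le>k. ev n X (ncps_exp_prod m) (k - j) * ev n X (ncps_exp (ncps_var (Suc m))) j)"
    using Suc.prems by (simp add: ev_exp_var)
  also have "\<dots> = (\<Sum>j\<le>k. ev n X (ncps_exp_prod m) j * ev n X (ncps_exp (ncps_var (Suc m))) (k - j))"
    by (rule sum.reindex_bij_witness[of _ "\<lambda>j. k - j" "\<lambda>j. k - j"]) auto
  finally show ?case by (simp add: ev_mult)
qed

lemma block_sum_off_Nil: "0 < k \<Longrightarrow> block_sum n X k (off_Nil f) = block_sum n X k f"
  by (rule block_sum_cong) (auto simp: off_Nil_def)

text \<open>Both sides satisfy the recursion coming from A - 1 = R + (1 - l) R (A - 1). As A - 1 has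
  no constant term, the recursion determines each degree from the lower ones.\<close>

lemma block_sum_mu_res:
  assumes "0 < k"
  shows "block_sum n X k (mu_res l) = ev n X (resolvent_fn l (ncps_exp_prod n)) k"
proof -
  let ?R = "resolvent_fn l (ncps_exp_prod n)" and ?N = "ncps_exp_prod n - 1"
  let ?r = "\<lambda>k. block_sum n X k (off_Nil (mu_res l))"
  have N: "block_sum n X k (off_Nil prod_list) = ev n X ?N k" for k
  proof (cases "k = 0")
    case True
    then show ?thesis by (simp add: off_Nil_def ev_0)
  next
    case False
    then show ?thesis by (simp add: block_sum_off_Nil block_sum_prod_list ev_simps)
  qed
  have "?R + (1 - l) *\<^sub>R (?R * ?N) = ?R * (of_real l + (1 - l) *\<^sub>R ncps_exp_prod n)"
    by (simp add: of_real_def algebra_simps)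
  then have "ev n X (?R + (1 - l) *\<^sub>R (?R * ?N)) k = ev n X ?N k" for k
    by (simp add: resolvent_fn_mult)
  then have ev_rec: "ev n X ?R k + (1 - l) *\<^sub>R (\<Sum>i\<le>k. ev n X ?R i * ev n X ?N (k - i)) = ev n X ?N k" for k
    by (simp only: ev_simps ev_mult)
  have mu_rec: "?r k + (1 - l) *\<^sub>R (\<Sum>i\<le>k. ?r i * ev n X ?N (k - i)) = ev n X ?N k" for k
  proof -
    have "ev n X ?N k = block_sum n X k (\<lambda>Ys. off_Nil (mu_res l) Ys +
        (1 - l) *\<^sub>R shuffle_prod (off_Nil (mu_res l)) (off_Nil prod_list) Ys)"
      unfolding N[symmetric] by (rule block_sum_cong) (rule mu_res_shuffle)
    then show ?thesis by (simp only: block_sum_add block_sum_scaleR block_sum_shuffle N)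
  qed
  have N0: "ev n X ?N 0 = 0" by (simp add: ev_0)
  have "?r k = ev n X ?R k" for k
  proof (induction k rule: less_induct)
    case (less k)
    have "(\<Sum>i\<le>k. ?r i * ev n X ?N (k - i)) = (\<Sum>i\<le>k. ev n X ?R i * ev n X ?N (k - i))"
    proof (rule sum.cong[OF refl])
      fix i assume "i \<in> {..k}"
      then show "?r i * ev n X ?N (k - i) = ev n X ?R i * ev n X ?N (k - i)"
        using less N0 by (cases "i = k") auto
    qed
    then show ?case using ev_rec[of k] mu_rec[of k] by (metis add_right_cancel)
  qed
  then show ?thesis using block_sum_off_Nil[OF assms, of n X "mu_res l"] by simp
qed

lemma mu_res_R_eq_ev:
  "mu_res_R l {0..<real n} (concat_density n X) (Suc k) = ev n X (resolvent_fn l (ncps_exp_prod n)) (Suc k)"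
  unfolding mu_res_R_def ordered_integral_concat_density by (simp add: block_sum_mu_res)

lemma mu_res_has_integral: "((\<lambda>l. mu_res l Ys) has_integral mu Ys) {0..1}"
  unfolding mu_def mu_res_def Let_def
  by (intro integrable_integral integrable_continuous_interval continuous_intros) 

text \<open>\<open>block_sum\<close> is a finite linear combination, so it commutes with the
  integral over \<open>l\<close> that defines \<open>mu\<close>.\<close>

lemma mu_R_has_integral:
  "((\<lambda>l. ev n X (resolvent_fn l (ncps_exp_prod n)) (Suc k)) has_integral
    mu_R {0..<real n} (concat_density n X) (Suc k)) {0..1}"
  using block_sum_has_integral[of mu_res mu "{0..1}", OF mu_res_has_integral, of n X "Suc k"]
  unfolding mu_R_def ordered_integral_concat_density by (simp add: block_sum_mu_res)


section \<open>Convergence of the Magnus expansion\<close>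

lemma exp_R_concat_density:
  fixes X :: "nat \<Rightarrow> 'a::{real_normed_algebra_1, banach}"
  shows "exp_R {0..<real n} (concat_density n X) = exp_prod n X"
proof -
  let ?x = "\<lambda>i. norm (X i)"
  have "abs_conv ?x (ncps_exp_prod n)" by (rule abs_convI[OF series_ell1_exp])
  then have s: "summable (ev n X (ncps_exp_prod n))"
    using summable_ev[of n X ?x] by (auto intro: summable_norm_cancel)
  have "exp_prod n X = (\<Sum>k. ev n X (ncps_exp_prod n) k)"
    using evs_exp_prod[of n X ?x] by (simp add: evs_def)
  also have "\<dots> = 1 + (\<Sum>k. ev n X (ncps_exp_prod n) (Suc k))"
    using suminf_split_head[OF s] by (simp add: ev_0)
  finally show ?thesis
    unfolding exp_R_def ordered_integral_concat_density block_sum_prod_list[OF order_refl] by simp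
qed

lemma suminf_norm_ev_le:
  fixes X :: "nat \<Rightarrow> 'a::real_normed_algebra_1"
  shows "(\<Sum>k. ennreal (norm (ev n X f (Suc k)))) \<le> abs_value n f (\<lambda>i. ennreal (norm (X i)))"
proof (rule suminf_le_const)
  fix K
  let ?x = "\<lambda>i. norm (X i)"
  let ?F = "\<Union>k<K. words n (Suc k)"
  have F: "finite ?F" "?F \<subseteq> lists {1..n}" by (simp, auto simp: words_def)
  have pos: "0 \<le> prod_list (map ?x w)" for w by (auto intro!: prod_list_nonneg)
  have "(\<Sum>k<K. norm (ev n X f (Suc k))) \<le> (\<Sum>k<K. \<Sum>w\<in>words n (Suc k). \<bar>ncps_nth (ncps_scale ?x f) w\<bar>)"
    using norm_ev_le[of n X ?x f] pos by (intro sum_mono) (simp add: abs_mult)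
  also have "\<dots> = (\<Sum>w\<in>?F. \<bar>ncps_nth (ncps_scale ?x f) w\<bar>)"
    by (rule sum.UNION_disjoint[symmetric]) (simp, simp, auto simp: words_def)
  finally have "ennreal (\<Sum>k<K. norm (ev n X f (Suc k))) \<le> (\<Sum>w\<in>?F. ennreal \<bar>ncps_nth f w\<bar> * prod_list (map (\<lambda>i. ennreal (?x i)) w))"
    using abs_value_finite_sum[OF F(2), of ?x f] by (simp add: ennreal_leI)
  also have "\<dots> \<le> abs_value n f (\<lambda>i. ennreal (?x i))"
    unfolding abs_value_eq_SUP using F by (intro SUP_upper) simp
  finally show "(\<Sum>k<K. ennreal (norm (ev n X f (Suc k)))) \<le> abs_value n f (\<lambda>i. ennreal (?x i))"
    by (simp add: sum_ennreal)
qed (rule summableI)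

lemma Gamma_sup_finite:
  assumes "\<And>l. l \<in> {0..1} \<Longrightarrow> regular n l x" "\<And>i. 0 \<le> x i"
  shows "Gamma_sup n (\<lambda>i. ennreal (x i)) < \<infinity>"
proof -
  obtain K where K: "\<forall>l\<in>{0..1}. l1_bound (ncps_scale x (resolvent_fn l (ncps_exp_prod n))) K"
    using resolvent_uniform_bound[OF assms(1)] by blast
  have "Gamma_sup n (\<lambda>i. ennreal (x i)) \<le> ennreal K"
    unfolding Gamma_sup_def Gamma_res_def using K assms(2) by (intro SUP_least abs_value_le) auto
  also have "\<dots> < \<infinity>" by simp
  finally show ?thesis .
qed

text \<open>The geometric decay, uniform in \<open>l\<close>, comes from enlarging the norms slightly without
  reaching a total of \<open>C_const n\<close>.\<close>

lemma ev_resolvent_geometric: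
  fixes X :: "nat \<Rightarrow> 'a::{real_normed_algebra_1, banach}"
  assumes "2 \<le> n" "(\<Sum>i = 1..n. norm (X i)) < C_const n"
  shows "\<exists>K \<theta>. 0 < \<theta> \<and> \<theta> < 1 \<and>
    (\<forall>l\<in>{0..1}. \<forall>k. norm (ev n X (resolvent_fn l (ncps_exp_prod n)) k) \<le> K * \<theta> ^ k)"
proof -
  let ?s = "\<Sum>i = 1..n. norm (X i)"
  \<comment> \<open>The mean of \<open>?s / C_const n\<close> and 1: it is positive even if
    \<open>?s = 0\<close>, and dividing the norms by it keeps their sum below
    \<open>C_const n\<close>.\<close>
  define \<theta> where "\<theta> = (?s + C_const n) / (2 * C_const n)"
  have s: "0 \<le> ?s" by (simp add: sum_nonneg)
  then have C: "0 < C_const n" using assms(2) by linarith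
  have \<theta>: "0 < \<theta>" "\<theta> < 1" using s C assms(2) by (simp_all add: \<theta>_def field_simps)
  define y where "y i = norm (X i) / \<theta>" for i
  have "?s < C_const n * \<theta>" using C assms(2) by (simp add: \<theta>_def field_simps)
  then have "(\<Sum>i = 1..n. y i) < C_const n"
    using \<theta> by (simp add: y_def sum_divide_distrib[symmetric] field_simps)
  moreover have "0 \<le> y i" for i using \<theta> by (simp add: y_def)
  ultimately have "regular n l y" if "l \<in> {0..1}" for l
    using C_const_properties(2)[OF assms(1)] that by blast
  then obtain K where K: "\<forall>l\<in>{0..1}. l1_bound (ncps_scale y (resolvent_fn l (ncps_exp_prod n))) K"
    using resolvent_uniform_bound by blast
  have "norm (ev n X (resolvent_fn l (ncps_exp_prod n)) k) \<le> K * \<theta> ^ k" if l: "l \<in> {0..1}" for l k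
  proof -
    have "prod_list (map (\<lambda>i. norm (X i)) w) = \<theta> ^ length w * prod_list (map y w)" for w
      using \<theta> by (induction w) (auto simp: y_def)
    moreover have "0 \<le> prod_list (map y w)" for w
      using \<theta> by (auto simp: y_def intro!: prod_list_nonneg)
    ultimately have "(\<Sum>w\<in>words n k. \<bar>res_coeff n l w\<bar> * prod_list (map (\<lambda>i. norm (X i)) w)) =
        (\<Sum>w\<in>words n k. \<bar>ncps_nth (ncps_scale y (resolvent_fn l (ncps_exp_prod n))) w\<bar>) * \<theta> ^ k"
      unfolding sum_distrib_right by (intro sum.cong) (auto simp: words_def abs_mult)
    also have "\<dots> \<le> K * \<theta> ^ k"
      using bspec[OF K l] \<theta> unfolding l1_bound_def by (intro mult_right_mono) auto
    finally show ?thesis using norm_ev_le[of n X "\<lambda>i. norm (X i)"] by (meson order_refl order_trans)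
  qed
  then show ?thesis using \<theta> by blast
qed

text \<open>The expansion of the resolvent is integrated termwise over \<open>l\<close>. The
  geometric bound, uniform in \<open>l\<close>, justifies the interchange by the Weierstrass test
  and dominates the integrated terms.\<close>

lemma magnus_expansion:
  fixes X :: "nat \<Rightarrow> 'a::{real_normed_algebra_1, banach}"
  assumes n: "2 \<le> n" and less: "(\<Sum>i = 1..n. norm (X i)) < C_const n"
  shows "summable (\<lambda>k. norm (mu_R {0..<real n} (concat_density n X) (Suc k)))"
    and "alg_log (exp_prod n X) = (\<Sum>k. mu_R {0..<real n} (concat_density n X) (Suc k))"
proof -
  let ?e = "\<lambda>l k. ev n X (resolvent_fn l (ncps_exp_prod n)) k"
  let ?mu = "\<lambda>k. mu_R {0..<real n} (concat_density n X) (Suc k)"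
  obtain K \<theta> where \<theta>: "0 < \<theta>" "\<theta> < 1" and bound: "\<forall>l\<in>{0..1}. \<forall>k. norm (?e l k) \<le> K * \<theta> ^ k"
    using ev_resolvent_geometric[OF n less] by blast
  have K: "0 \<le> K" using order_trans[OF norm_ge_zero bound[rule_format, of 0 0]] by simp
  have M: "summable (\<lambda>k. K * \<theta> ^ Suc k)"
    using \<theta> by (simp add: summable_mult summable_geometric)
  have mu_bound: "norm (?mu k) \<le> K * \<theta> ^ Suc k" for k
  proof -
    have "norm (?mu k) \<le> K * \<theta> ^ Suc k * measure lborel {0..1 :: real}"
    proof (rule has_integral_bound_real[OF _ finite.emptyI mu_R_has_integral])
      show "0 \<le> K * \<theta> ^ Suc k" using K \<theta> by simp
      show "norm (?e l (Suc k)) \<le> K * \<theta> ^ Suc k" if "l \<in> {0..1} - {}" for l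
        using bound that by blast
    qed
    then show ?thesis by simp
  qed
  then show "summable (\<lambda>k. norm (?mu k))"
    by (intro summable_comparison_test[OF _ M]) auto
  have reg: "regular n l (\<lambda>i. norm (X i))" if "l \<in> {0..1}" for l
    using C_const_properties(2)[OF n _ less that] by simp
  have sum: "resolvent_fn l (exp_prod n X) = (\<Sum>k. ?e l (Suc k))" if l: "l \<in> {0..1}" for l
  proof -
    have geo: "summable (\<lambda>k. K * \<theta> ^ k)" using \<theta> by (simp add: summable_mult summable_geometric)
    have "norm (norm (?e l k)) \<le> K * \<theta> ^ k" for k using bound l by simp
    then have "summable (?e l)"
      by (blast intro: summable_norm_cancel summable_comparison_test[OF _ geo])
    then have "(\<Sum>k. ?e l k) = (\<Sum>k. ?e l (Suc k))"
      using suminf_split_head[of "?e l"] by (simp add: ev_0)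
    then show ?thesis using resolvent_exp_prod(2)[OF _ reg[OF l], of X] by simp
  qed
  have u: "uniform_limit {0..1} (\<lambda>m l. \<Sum>k<m. ?e l (Suc k)) (\<lambda>l. \<Sum>k. ?e l (Suc k)) sequentially"
    by (rule Weierstrass_m_test[OF bound[rule_format] M])
  have c: "continuous_on {0..1} (\<lambda>l. \<Sum>k<m. ?e l (Suc k))" for m
    unfolding ev_def by (intro continuous_intros)
  obtain I J where "\<forall>m. ((\<lambda>l. \<Sum>k<m. ?e l (Suc k)) has_integral I m) {0..1}"
    "((\<lambda>l. \<Sum>k. ?e l (Suc k)) has_integral J) {0..1}" "I \<longlonglongrightarrow> J"
    by (rule uniform_limit_integral[OF u c sequentially_bot]) metis
  then have IJ: "\<And>m. ((\<lambda>l. \<Sum>k<m. ?e l (Suc k)) has_integral I m) {0..1}"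
    "((\<lambda>l. \<Sum>k. ?e l (Suc k)) has_integral J) {0..1}" "I \<longlonglongrightarrow> J"
    by metis+
  have I: "I = (\<lambda>m. \<Sum>k<m. ?mu k)"
    by (rule ext, rule has_integral_unique[OF IJ(1)]) (intro has_integral_sum mu_R_has_integral, simp)
  have "?mu sums J" using IJ(3) unfolding sums_def I .
  moreover have "alg_log (exp_prod n X) = integral {0..1} (\<lambda>l. \<Sum>k. ?e l (Suc k))"
    unfolding alg_log_def by (rule integral_cong) (rule sum)
  ultimately show "alg_log (exp_prod n X) = (\<Sum>k. ?mu k)"
    using IJ(2) by (simp add: integral_unique sums_unique)
qed

section \<open>Existence of the logarithm and M-control\<close>

lemma has_inverse_scaleR:
  fixes a :: "'a::real_algebra_1"
  assumes "has_inverse (r *\<^sub>R a)"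
  shows "has_inverse a"
proof -
  obtain b where "(r *\<^sub>R a) * b = 1" "b * (r *\<^sub>R a) = 1" using assms by (auto simp: has_inverse_def)
  then show ?thesis by (intro has_inverseI[of _ "r *\<^sub>R b"]) simp_all
qed

text \<open>The substitution l = -r/(1 - r) maps r \<le> 0 into [0, 1), and l + (1 - l)a is then a
  nonzero multiple of r - a.\<close>

lemma log_existsI:
  fixes a :: "'a::complex_banach_algebra"
  assumes "\<And>l. l \<in> {0..1} \<Longrightarrow> has_inverse (res_denom l a)"
  shows "log_exists a"
proof -
  have "has_inverse (complex_of_real r *\<^sub>C 1 - a)" if r: "r \<le> 0" for r
  proof -
    let ?l = "- r / (1 - r)"
    have "?l \<in> {0..1}" using r by (auto simp: field_simps)
    moreover have "res_denom ?l a = (- 1 / (1 - r)) *\<^sub>R (r *\<^sub>R 1 - a)"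
    proof -
      have "1 - ?l = 1 / (1 - r)" using r by (simp add: field_simps)
      then show ?thesis by (simp add: res_denom_def of_real_def scaleR_right_diff_distrib)
    qed
    ultimately have "has_inverse ((- 1 / (1 - r)) *\<^sub>R (r *\<^sub>R 1 - a))" using assms by metis
    then show ?thesis unfolding scaleC_of_real by (rule has_inverse_scaleR)
  qed
  then show ?thesis by (auto simp: log_exists_def alg_spectrum_def)
qed

lemma log_exists_exp_prod:
  fixes Z :: "nat \<Rightarrow> 'b::complex_banach_algebra"
  assumes "2 \<le> n" "(\<Sum>i = 1..n. x i) < C_const n" "\<And>i. norm (Z i) \<le> x i"
  shows "log_exists (exp_prod n Z)"
proof (rule log_existsI)
  fix l :: real assume "l \<in> {0..1}"
  then have "regular n l x"
    by (rule C_const_properties(2)[OF assms(1) order_trans[OF norm_ge_zero assms(3)] assms(2)])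
  then show "has_inverse (res_denom l (exp_prod n Z))"
    by (rule resolvent_exp_prod(1)[rotated]) (rule assms(3))
qed

lemma scaleC_concat_density:
  fixes Z :: "nat \<Rightarrow> 'b::complex_banach_algebra"
  shows "t *\<^sub>C concat_density n Z s = concat_density n (\<lambda>i. t *\<^sub>C Z i) s"
proof -
  have zero: "t *\<^sub>C (0 :: 'b) = 0" using scaleC_add_right[of t "0 :: 'b" 0] by simp
  have R: "t *\<^sub>C (r *\<^sub>R z) = r *\<^sub>R (t *\<^sub>C z)" for r and z :: 'b
    by (simp add: scaleC_scaleC mult.commute flip: scaleC_of_real)
  have "t *\<^sub>C (\<Sum>i\<in>A. f i) = (\<Sum>i\<in>A. t *\<^sub>C f i)" for f :: "nat \<Rightarrow> 'b" and A
    by (induction A rule: infinite_finite_induct) (simp_all add: zero scaleC_add_right)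
  then show ?thesis by (simp add: concat_density_def R)
qed

lemma M_controlled_concat_density:
  fixes Z :: "nat \<Rightarrow> 'b::complex_banach_algebra"
  assumes "2 \<le> n" "(\<Sum>i = 1..n. norm (Z i)) < C_const n"
  shows "M_controlled {0..<real n} (concat_density n Z)"
  unfolding M_controlled_def
proof (intro allI impI)
  fix t assume t: "cmod t \<le> 1"
  have "norm (t *\<^sub>C Z i) \<le> norm (Z i)" for i
    using t by (simp add: norm_scaleC mult_left_le_one_le)
  then show "log_exists (exp_R {0..<real n} (\<lambda>s. t *\<^sub>C concat_density n Z s))"
    unfolding scaleC_concat_density exp_R_concat_density by (rule log_exists_exp_prod[OF assms])
qed

lemma bounded_linear_complexify: "bounded_linear (complexify :: 'a::real_normed_algebra_1 \<Rightarrow> _)"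
  by (rule bounded_linear_intro[where K = 1]) (simp_all add: cplx_eq_iff norm_cplx_def norm_complexify)

text \<open>\<open>complexify\<close> is a continuous unital homomorphism. As it also preserves
  norms, real algebras fall under the complex results with the same bound.\<close>

lemma complexify_exp_prod:
  fixes X :: "nat \<Rightarrow> 'a::{real_normed_algebra_1, banach}"
  shows "complexify (exp_prod n X) = exp_prod n (\<lambda>i. complexify (X i))"
proof -
  interpret complexify: bounded_linear "complexify :: 'a \<Rightarrow> _" by (rule bounded_linear_complexify)
  have mult: "complexify (a * b) = complexify a * complexify b" for a b :: 'a
    by (simp add: cplx_eq_iff)
  have one: "complexify (1 :: 'a) = 1" by (simp add: cplx_eq_iff)
  have pow: "complexify (a ^ k) = complexify a ^ k" for a :: 'a and k
    by (induction k) (simp_all add: one mult)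
  have "complexify (exp a) = exp (complexify a)" for a :: 'a
    unfolding exp_def using complexify.suminf[OF summable_exp_generic[of a]]
    by (simp add: complexify.scaleR pow)
  then show ?thesis by (induction n) (simp_all add: one mult)
qed

lemma complexify_concat_density:
  fixes X :: "nat \<Rightarrow> 'a::real_normed_algebra_1"
  shows "complexify (concat_density n X t) = concat_density n (\<lambda>i. complexify (X i)) t"
proof -
  interpret complexify: bounded_linear "complexify :: 'a \<Rightarrow> _" by (rule bounded_linear_complexify)
  show ?thesis by (simp add: concat_density_def complexify.sum complexify.scaleR)
qed


section \<open>A Banach algebra without logarithm\<close>

lemma series_exp_Nil: "ncps_nth (series (exp w)) [] = exp (ncps_nth (series w) [])"
proof -
  have pow: "ncps_nth (series w ^ k) [] = ncps_nth (series w) [] ^ k" for k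
    by (induction k) simp_all
  show ?thesis
    unfolding exp_def using bounded_linear.suminf[OF bounded_linear_ncps_nth summable_exp_generic[of w]]
    by (simp add: pow)
qed

text \<open>The scalars are real, so exp c = 1 forces the constant term c of \<open>w\<close> to be
  0; then \<open>ncps_log_exp\<close> identifies \<open>w\<close> with the formal logarithm, whose
  coefficients are not summable.\<close>

lemma no_logarithm:
  assumes "\<And>B. \<not> l1_bound (ncps_scale x (ncps_log (ncps_exp_prod n))) B"
  shows "exp w \<noteq> ell1_exp n x"
proof
  assume w: "exp w = ell1_exp n x"
  have "exp (ncps_nth (series w) []) = 1"
    using series_exp_Nil[of w] by (simp add: w series_ell1_exp)
  then have "ncps_exp (series w) = ncps_scale x (ncps_exp_prod n)" "ncps_nth (series w) [] = 0"
    using series_exp[of w] by (simp_all add: w series_ell1_exp)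
  then have "series w = ncps_scale x (ncps_log (ncps_exp_prod n))"
    using ncps_log_exp[of "series w"] by (simp add: ncps_scale_log)
  then show False using assms l1_bound_norm[of w] by metis
qed

text \<open>Carries an algebra given as a type over to a structure on the image of an injection, so
  that its elements live in a prescribed type.\<close>

definition transport :: "('a::real_normed_algebra_1 \<Rightarrow> 'b) \<Rightarrow> 'b normed_ring"
  where "transport \<rho> = \<lparr>carrier = range \<rho>, mult = (\<lambda>f g. \<rho> (the_inv \<rho> f * the_inv \<rho> g)), one = \<rho> 1, zero = \<rho> 0,
    add = (\<lambda>f g. \<rho> (the_inv \<rho> f + the_inv \<rho> g)), scal = (\<lambda>r f. \<rho> (r *\<^sub>R the_inv \<rho> f)), nrm = (\<lambda>f. norm (the_inv \<rho> f))\<rparr>"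

context
  fixes \<rho> :: "'a::{real_normed_algebra_1, banach} \<Rightarrow> 'b"
  assumes inj: "inj \<rho>"
begin

lemma transport_simps:
  "carrier (transport \<rho>) = range \<rho>"
  "\<rho> a \<otimes>\<^bsub>transport \<rho>\<^esub> \<rho> b = \<rho> (a * b)"
  "\<one>\<^bsub>transport \<rho>\<^esub> = \<rho> 1"
  "\<zero>\<^bsub>transport \<rho>\<^esub> = \<rho> 0"
  "\<rho> a \<oplus>\<^bsub>transport \<rho>\<^esub> \<rho> b = \<rho> (a + b)"
  "scal (transport \<rho>) r (\<rho> a) = \<rho> (r *\<^sub>R a)"
  "nrm (transport \<rho>) (\<rho> a) = norm a"
  by (simp_all add: transport_def the_inv_f_f[OF inj])

lemma ring_transport: "ring (transport \<rho>)"
proof (rule ringI)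
  show "abelian_group (transport \<rho>)"
  proof (rule abelian_groupI)
    fix x assume "x \<in> carrier (transport \<rho>)"
    then obtain a where "x = \<rho> a" by (auto simp: transport_simps)
    then show "\<exists>y\<in>carrier (transport \<rho>). y \<oplus>\<^bsub>transport \<rho>\<^esub> x = \<zero>\<^bsub>transport \<rho>\<^esub>"
      by (intro bexI[of _ "\<rho> (- a)"]) (simp_all add: transport_simps)
  qed (auto simp: transport_simps ac_simps)
  show "monoid (transport \<rho>)"
    by (rule monoidI) (auto simp: transport_simps mult.assoc)
qed (auto simp: transport_simps algebra_simps)

lemma transport_minus: "\<rho> a \<ominus>\<^bsub>transport \<rho>\<^esub> \<rho> b = \<rho> (a - b)"
proof -
  interpret ring "transport \<rho>" by (rule ring_transport)
  have "\<ominus>\<^bsub>transport \<rho>\<^esub> \<rho> b = \<rho> (- b)"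
    by (rule minus_equality) (simp_all add: transport_simps)
  then show ?thesis by (simp add: a_minus_def transport_simps)
qed

lemma struct_lim_transport: "struct_lim (transport \<rho>) (\<lambda>k. \<rho> (f k)) (\<rho> a) \<longleftrightarrow> f \<longlonglongrightarrow> a"
  by (simp add: struct_lim_def transport_minus transport_simps tendsto_norm_zero_iff LIM_zero_iff)

lemma banach_algebra_transport: "banach_algebra (transport \<rho>)"
proof -
  interpret ring "transport \<rho>" by (rule ring_transport)
  show ?thesis
  proof unfold_locales
    fix f :: "nat \<Rightarrow> 'b"
    assume f: "\<And>n. f n \<in> carrier (transport \<rho>)"
      and cauchy: "\<And>e. 0 < e \<Longrightarrow> \<exists>N. \<forall>m\<ge>N. \<forall>n\<ge>N. nrm (transport \<rho>) (f m \<ominus>\<^bsub>transport \<rho>\<^esub> f n) < e"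
    define g where "g n = the_inv \<rho> (f n)" for n
    have fg: "f n = \<rho> (g n)" for n
      using f[of n] by (simp add: g_def f_the_inv_into_f[OF inj] transport_simps)
    have "Cauchy g"
      unfolding Cauchy_def dist_norm using cauchy unfolding fg transport_minus transport_simps by blast
    then obtain a where "g \<longlonglongrightarrow> a" using Cauchy_convergent convergent_def by blast
    then have "struct_lim (transport \<rho>) f (\<rho> a)"
      unfolding struct_lim_transport[symmetric] fg[symmetric] by simp
    then show "\<exists>y. struct_lim (transport \<rho>) f y" ..
  qed (auto simp: transport_simps algebra_simps norm_triangle_ineq norm_mult_ineq inj_eq[OF inj])
qed

lemma struct_exp_transport: "struct_exp (transport \<rho>) (\<rho> a) = \<rho> (exp a)"
proof -
  interpret ring "transport \<rho>" by (rule ring_transport)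
  have pow: "\<rho> a [^]\<^bsub>transport \<rho>\<^esub> k = \<rho> (a ^ k)" for k :: nat
    by (induction k) (simp_all add: transport_simps power_commutes)
  have sum: "(\<Oplus>\<^bsub>transport \<rho>\<^esub>k\<in>{..<N}. \<rho> (f k)) = \<rho> (\<Sum>k<N. f k)" for f :: "nat \<Rightarrow> 'a" and N
  proof (induction N)
    case (Suc N)
    then show ?case
      by (subst lessThan_Suc, subst finsum_insert) (auto simp: transport_simps add.commute)
  qed (simp add: transport_simps)
  have lim: "(\<lambda>N. \<Sum>k<N. (1 / fact k) *\<^sub>R a ^ k) \<longlonglongrightarrow> exp a"
    using summable_LIMSEQ[OF summable_exp_generic[of a]] by (simp add: exp_def inverse_eq_divide)
  show ?thesis
    unfolding struct_exp_def pow transport_simps sum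
  proof (rule the_equality)
    show "struct_lim (transport \<rho>) (\<lambda>N. \<rho> (\<Sum>k<N. (1 / fact k) *\<^sub>R a ^ k)) (\<rho> (exp a))"
      using lim by (simp add: struct_lim_transport)
    fix y assume y: "struct_lim (transport \<rho>) (\<lambda>N. \<rho> (\<Sum>k<N. (1 / fact k) *\<^sub>R a ^ k)) y"
    then obtain b where b: "y = \<rho> b" by (auto simp: struct_lim_def transport_simps)
    show "y = \<rho> (exp a)"
      using y LIMSEQ_unique[OF lim] unfolding b struct_lim_transport by simp
  qed
qed

lemma struct_exp_prod_transport: "struct_exp_prod (transport \<rho>) n (\<lambda>i. \<rho> (Y i)) = \<rho> (exp_prod n Y)"
proof -
  have "foldr (\<lambda>i. (\<otimes>\<^bsub>transport \<rho>\<^esub>) (\<rho> (exp (Y i)))) is (\<rho> 1) = \<rho> (prod_list (map (\<lambda>i. exp (Y i)) is))" for "is"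
    by (induction "is") (simp_all add: transport_simps)
  then show ?thesis
    unfolding struct_exp_prod_def exp_prod_def struct_exp_transport transport_simps .
qed

end

lemma inj_series_nth: "inj (\<lambda>a :: nat ell1. ncps_nth (series a))"
  by (rule injI) (metis ell1_eqI ncps_nth_inject)


(* Conjuncts: (1), stated for real algebras, which include the complex ones as only the real
   structure enters; (2) for real algebras; (2) for complex algebras; (3), where the type
   nat list => real has the cardinality of the continuum. *)

theorem theorem3p22:
  fixes n :: nat
    and X :: "nat \<Rightarrow> 'a::{real_normed_algebra_1, banach}"
    and Z :: "nat \<Rightarrow> 'b::complex_banach_algebra"
  assumes "2 \<le> n"
  shows
    "(\<forall>l\<in>{0..1}. let \<phi> = concat_density n X; x = (\<lambda>i. ennreal (norm (X i))) in
       (\<Sum>k. ennreal (norm (mu_res_R l {0..<real n} \<phi> (Suc k)))) \<le> Gamma_res l n x \<and>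
       Gamma_res l n x \<le> Gamma_sup n x \<and>
       ((\<Sum>i = 1..n. norm (X i)) < C_const n \<longrightarrow> Gamma_sup n x < \<infinity>)) \<and>
     ((\<Sum>i = 1..n. norm (X i)) < C_const n \<longrightarrow> (let \<phi> = concat_density n X in
       M_controlled {0..<real n} (\<lambda>t. complexify (\<phi> t)) \<and>
       log_exists (complexify (exp_prod n X)) \<and>
       summable (\<lambda>k. norm (mu_R {0..<real n} \<phi> (Suc k))) \<and>
       alg_log (exp_prod n X) = (\<Sum>k. mu_R {0..<real n} \<phi> (Suc k)))) \<and>
     ((\<Sum>i = 1..n. norm (Z i)) < C_const n \<longrightarrow> (let \<phi> = concat_density n Z in
       M_controlled {0..<real n} \<phi> \<and>
       log_exists (exp_prod n Z) \<and>
       summable (\<lambda>k. norm (mu_R {0..<real n} \<phi> (Suc k))) \<and>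
       alg_log (exp_prod n Z) = (\<Sum>k. mu_R {0..<real n} \<phi> (Suc k)))) \<and>
     (\<exists>(A :: (nat list \<Rightarrow> real) normed_ring) Y. banach_algebra A \<and>
       (\<forall>i\<in>{1..n}. Y i \<in> carrier A) \<and>
       (\<Sum>i = 1..n. nrm A (Y i)) = C_const n \<and>
       \<not> (\<exists>W\<in>carrier A. struct_exp A W = struct_exp_prod A n Y))"
proof (intro conjI impI ballI; (unfold Let_def)?; (intro conjI impI)?)
  fix l :: real assume l: "l \<in> {0..1}"
  show "(\<Sum>k. ennreal (norm (mu_res_R l {0..<real n} (concat_density n X) (Suc k)))) \<le>
      Gamma_res l n (\<lambda>i. ennreal (norm (X i)))"
    unfolding mu_res_R_eq_ev Gamma_res_def by (rule suminf_norm_ev_le)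
  show "Gamma_res l n (\<lambda>i. ennreal (norm (X i))) \<le> Gamma_sup n (\<lambda>i. ennreal (norm (X i)))"
    unfolding Gamma_sup_def using l by (rule SUP_upper)
  assume "(\<Sum>i = 1..n. norm (X i)) < C_const n"
  then show "Gamma_sup n (\<lambda>i. ennreal (norm (X i))) < \<infinity>"
    using C_const_properties(2)[OF assms] by (intro Gamma_sup_finite) auto
next
  assume less: "(\<Sum>i = 1..n. norm (X i)) < C_const n"
  then have less': "(\<Sum>i = 1..n. norm (complexify (X i))) < C_const n"
    by (simp add: norm_cplx_def norm_complexify)
  show "M_controlled {0..<real n} (\<lambda>t. complexify (concat_density n X t))"
    unfolding complexify_concat_density using assms less' by (rule M_controlled_concat_density)
  show "log_exists (complexify (exp_prod n X))"
    unfolding complexify_exp_prod using assms less' by (rule log_exists_exp_prod) simp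
  show "summable (\<lambda>k. norm (mu_R {0..<real n} (concat_density n X) (Suc k)))"
    using assms less by (rule magnus_expansion)
  show "alg_log (exp_prod n X) = (\<Sum>k. mu_R {0..<real n} (concat_density n X) (Suc k))"
    using assms less by (rule magnus_expansion)
next
  assume less: "(\<Sum>i = 1..n. norm (Z i)) < C_const n"
  show "M_controlled {0..<real n} (concat_density n Z)"
    using assms less by (rule M_controlled_concat_density)
  show "log_exists (exp_prod n Z)"
    using assms less by (rule log_exists_exp_prod) simp
  show "summable (\<lambda>k. norm (mu_R {0..<real n} (concat_density n Z) (Suc k)))"
    using assms less by (rule magnus_expansion)
  show "alg_log (exp_prod n Z) = (\<Sum>k. mu_R {0..<real n} (concat_density n Z) (Suc k))"
    using assms less by (rule magnus_expansion)
next
  obtain x where x: "\<forall>i. 0 \<le> x i" "(\<Sum>i = 1..n. x i) = C_const n"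
    "\<forall>B. \<not> l1_bound (ncps_scale x (ncps_log (ncps_exp_prod n))) B"
    using C_const_properties(1)[OF assms] by blast
  \<comment> \<open>Elements are represented by their coefficient functions, which belong to the
    carrier type of the final statement.\<close>
  define \<rho> where "\<rho> = (\<lambda>a :: nat ell1. ncps_nth (series a))"
  have inj: "inj \<rho>" unfolding \<rho>_def by (rule inj_series_nth)
  define Y where "Y i = \<rho> (x i *\<^sub>R ell1_var i)" for i
  show "\<exists>(A :: (nat list \<Rightarrow> real) normed_ring) Y. banach_algebra A \<and>
       (\<forall>i\<in>{1..n}. Y i \<in> carrier A) \<and>
       (\<Sum>i = 1..n. nrm A (Y i)) = C_const n \<and>
       \<not> (\<exists>W\<in>carrier A. struct_exp A W = struct_exp_prod A n Y)"
  proof (intro exI[of _ "transport \<rho>"] exI[of _ Y] conjI ballI notI)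
    show "banach_algebra (transport \<rho>)" by (rule banach_algebra_transport[OF inj])
    show "Y i \<in> carrier (transport \<rho>)" for i by (simp add: Y_def transport_simps[OF inj])
    show "(\<Sum>i = 1..n. nrm (transport \<rho>) (Y i)) = C_const n"
      using x(1,2) by (simp add: Y_def transport_simps[OF inj])
    assume "\<exists>W\<in>carrier (transport \<rho>). struct_exp (transport \<rho>) W = struct_exp_prod (transport \<rho>) n Y"
    then obtain w where "struct_exp (transport \<rho>) (\<rho> w) = struct_exp_prod (transport \<rho>) n Y"
      by (auto simp: transport_simps[OF inj])
    then have "\<rho> (exp w) = \<rho> (ell1_exp n x)"
      unfolding Y_def struct_exp_transport[OF inj] struct_exp_prod_transport[OF inj] ell1_exp_def .
    then have "exp w = ell1_exp n x" using inj by (simp add: inj_eq)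
    with no_logarithm x(3) show False by blast
  qed
qed

end
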